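(* Let $\mathbb{F}$ be a field. The alternating trilinear form equivalence problem over $\mathbb{F}$ is polynomial-time equivalent to the symmetric trilinear form equivalence problem over $\mathbb{F}$.
   Context: A trilinear form $\phi:\mathbb{F}^n\times\mathbb{F}^n\times\mathbb{F}^n\to\mathbb{F}$ is symmetric if $\phi(u_1,u_2,u_3)=\phi(u_{\sigma(1)},u_{\sigma(2)},u_{\sigma(3)})$ for all $\sigma\in S_3$ and all $u_i$, and alternating if $\phi$ evaluates to zero whenever two of its arguments are equal. A trilinear form is represented as the 3-way array $(\phi(e_i,e_j,e_k))_{i,j,k\in[n]}$, where $e_i$ are the standard basis vectors. $A\in\mathrm{GL}(n,\mathbb{F})$ acts by $(\phi\circ A)(u,v,w)=\phi(A^{-1}u,A^{-1}v,A^{-1}w)$. The (symmetric, resp. alternating) trilinear form equivalence problem asks: given two (symmetric, resp. alternating) trilinear forms $\phi,\psi$ on $\mathbb{F}^n$, decide whether there exists $A\in\mathrm{GL}(n,\mathbb{F})$ with $\phi=\psi\circ A$. *)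

theory Defs
  imports
    "Jordan_Normal_Form.Matrix"
    "HOL-Combinatorics.Permutations"
    "HOL-Computational_Algebra.Polynomial"
begin

section \<open>Trilinear forms on F^n\<close>

text \<open>
  A form on F^n is a HOL function on all vectors; only its values on \<open>carrier_vec n\<close> matter, and
  everything below is relativised to that carrier.
\<close>

type_synonym 'a form3 = "'a vec \<Rightarrow> 'a vec \<Rightarrow> 'a vec \<Rightarrow> 'a"

definition linear_form :: "nat \<Rightarrow> ('a::field vec \<Rightarrow> 'a) \<Rightarrow> bool" where
  "linear_form n f \<longleftrightarrow>
     (\<forall>u\<in>carrier_vec n. \<forall>v\<in>carrier_vec n. f (u + v) = f u + f v) \<and>
     (\<forall>a. \<forall>u\<in>carrier_vec n. f (a \<cdot>\<^sub>v u) = a * f u)"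

definition trilinear_form :: "nat \<Rightarrow> 'a::field form3 \<Rightarrow> bool" where
  "trilinear_form n \<phi> \<longleftrightarrow>
     (\<forall>v\<in>carrier_vec n. \<forall>w\<in>carrier_vec n.
        linear_form n (\<lambda>u. \<phi> u v w) \<and> linear_form n (\<lambda>u. \<phi> v u w) \<and> linear_form n (\<lambda>u. \<phi> v w u))"

definition symmetric_form :: "nat \<Rightarrow> 'a::field form3 \<Rightarrow> bool" where
  "symmetric_form n \<phi> \<longleftrightarrow>
     (\<forall>u :: nat \<Rightarrow> 'a vec. \<forall>\<sigma>. u ` {1..3} \<subseteq> carrier_vec n \<longrightarrow> \<sigma> permutes {1..3} \<longrightarrow>
        \<phi> (u 1) (u 2) (u 3) = \<phi> (u (\<sigma> 1)) (u (\<sigma> 2)) (u (\<sigma> 3)))"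

definition alternating_form :: "nat \<Rightarrow> 'a::field form3 \<Rightarrow> bool" where
  "alternating_form n \<phi> \<longleftrightarrow>
     (\<forall>u\<in>carrier_vec n. \<forall>v\<in>carrier_vec n. \<phi> u u v = 0 \<and> \<phi> u v u = 0 \<and> \<phi> v u u = 0)"

abbreviation GL :: "nat \<Rightarrow> 'a::field mat set" where
  "GL n \<equiv> Units (ring_mat TYPE('a) n ())"

definition form_act :: "nat \<Rightarrow> 'a::field form3 \<Rightarrow> 'a mat \<Rightarrow> 'a form3" where
  "form_act n \<phi> A = (\<lambda>u v w.
     let B = inv\<^bsub>ring_mat TYPE('a) n ()\<^esub> A in \<phi> (B *\<^sub>v u) (B *\<^sub>v v) (B *\<^sub>v w))"

definition equivalent_forms :: "nat \<Rightarrow> 'a::field form3 \<Rightarrow> 'a form3 \<Rightarrow> bool" where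
  "equivalent_forms n \<phi> \<psi> \<longleftrightarrow>
     (\<exists>A\<in>GL n. \<forall>u\<in>carrier_vec n. \<forall>v\<in>carrier_vec n. \<forall>w\<in>carrier_vec n.
        \<phi> u v w = form_act n \<psi> A u v w)"


section \<open>The equivalence problems as decision problems over F\<close>

text \<open>
  A problem is a set of valid inputs (words over F) together with the set of yes-inputs.
  An instance is the pair of 3-way arrays of the two forms, each listed in lexicographic order of
  the index triples; the word has length \<open>2 * n ^ 3\<close>, so it determines \<open>n\<close> and, since the forms
  are trilinear, both forms on \<open>carrier_vec n\<close>.
\<close>

type_synonym 'a problem = "'a list set \<times> 'a list set"

definition form_array :: "nat \<Rightarrow> 'a::field form3 \<Rightarrow> 'a list" where
  "form_array n \<phi> =
     [\<phi> (unit_vec n i) (unit_vec n j) (unit_vec n k). i \<leftarrow> [0..<n], j \<leftarrow> [0..<n], k \<leftarrow> [0..<n]]"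

definition form_equivalence_problem :: "(nat \<Rightarrow> 'a::field form3 \<Rightarrow> bool) \<Rightarrow> 'a problem" where
  "form_equivalence_problem P =
     ({form_array n \<phi> @ form_array n \<psi> | n \<phi> \<psi>.
         trilinear_form n \<phi> \<and> trilinear_form n \<psi> \<and> P n \<phi> \<and> P n \<psi>},
      {form_array n \<phi> @ form_array n \<psi> | n \<phi> \<psi>.
         trilinear_form n \<phi> \<and> trilinear_form n \<psi> \<and> P n \<phi> \<and> P n \<psi> \<and> equivalent_forms n \<phi> \<psi>})"

definition symmetric_form_equivalence :: "'a::field problem" where
  "symmetric_form_equivalence = form_equivalence_problem symmetric_form"

definition alternating_form_equivalence :: "'a::field problem" where
  "alternating_form_equivalence = form_equivalence_problem alternating_form"


section \<open>Random access machines over F\<close>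

text \<open>
  The machine has index registers holding natural numbers and a memory of field elements.
  Field memory is addressed indirectly: an operand \<open>r\<close> of a field instruction denotes the memory
  cell whose address is the content of index register \<open>r\<close>. Index registers admit addition and
  truncated subtraction but no multiplication, so that an index computed in \<open>t\<close> steps has
  \<open>O(t)\<close> bits beyond the bit length of the input length. Finitely many constants of F may occur in a
  program.
\<close>

datatype field_op = FPlus | FMinus | FTimes | FDivide

fun eval_op :: "field_op \<Rightarrow> 'a::field \<Rightarrow> 'a \<Rightarrow> 'a" where
  "eval_op FPlus x y = x + y"
| "eval_op FMinus x y = x - y"
| "eval_op FTimes x y = x * y"
| "eval_op FDivide x y = x / y"

datatype test = IndexLess nat nat | FieldZero nat

datatype 'a com =
    Skip
  | IndexConst nat nat
  | IndexAdd nat nat nat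
  | IndexSub nat nat nat
  | FieldConst nat 'a
  | FieldCopy nat nat
  | FieldOp field_op nat nat nat
  | Seq "'a com" "'a com"
  | Cond test "'a com" "'a com"
  | While test "'a com"

type_synonym 'a state = "(nat \<Rightarrow> nat) \<times> (nat \<Rightarrow> 'a)"

fun test_holds :: "test \<Rightarrow> 'a::field state \<Rightarrow> bool" where
  "test_holds (IndexLess r s) (I, M) \<longleftrightarrow> I r < I s"
| "test_holds (FieldZero r) (I, M) \<longleftrightarrow> M (I r) = 0"

text \<open>
  Costs are relative to a size \<open>sz\<close> of field elements: an instruction costs one plus the sizes of
  the field elements it reads and writes. With \<open>sz = (\<lambda>_. 0)\<close> this is the unit-cost
  (Blum--Shub--Smale) model over F; for F the rationals and \<open>sz\<close> the bit length of
  numerator and denominator it is the logarithmic-cost model, which is polynomially equivalent to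
  Turing machines.
\<close>

fun test_cost :: "('a::field \<Rightarrow> nat) \<Rightarrow> test \<Rightarrow> 'a state \<Rightarrow> nat" where
  "test_cost sz (IndexLess r s) (I, M) = 1"
| "test_cost sz (FieldZero r) (I, M) = 1 + sz (M (I r))"

inductive exec :: "('a::field \<Rightarrow> nat) \<Rightarrow> 'a com \<Rightarrow> 'a state \<Rightarrow> nat \<Rightarrow> 'a state \<Rightarrow> bool"
  for sz :: "'a::field \<Rightarrow> nat" where
  Skip: "exec sz Skip s 1 s"
| IndexConst: "exec sz (IndexConst r k) (I, M) 1 (I(r := k), M)"
| IndexAdd: "exec sz (IndexAdd r p q) (I, M) 1 (I(r := I p + I q), M)"
| IndexSub: "exec sz (IndexSub r p q) (I, M) 1 (I(r := I p - I q), M)"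
| FieldConst: "exec sz (FieldConst r a) (I, M) (1 + sz a) (I, M(I r := a))"
| FieldCopy: "exec sz (FieldCopy r p) (I, M) (1 + sz (M (I p))) (I, M(I r := M (I p)))"
| FieldOp: "x = M (I p) \<Longrightarrow> y = M (I q) \<Longrightarrow> z = eval_op f x y \<Longrightarrow>
    exec sz (FieldOp f r p q) (I, M) (1 + sz x + sz y + sz z) (I, M(I r := z))"
| Seq: "exec sz c1 s t1 s' \<Longrightarrow> exec sz c2 s' t2 s'' \<Longrightarrow> exec sz (Seq c1 c2) s (t1 + t2) s''"
| CondTrue: "test_holds b s \<Longrightarrow> exec sz c1 s t s' \<Longrightarrow>
    exec sz (Cond b c1 c2) s (test_cost sz b s + t) s'"
| CondFalse: "\<not> test_holds b s \<Longrightarrow> exec sz c2 s t s' \<Longrightarrow>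
    exec sz (Cond b c1 c2) s (test_cost sz b s + t) s'"
| WhileFalse: "\<not> test_holds b s \<Longrightarrow> exec sz (While b c) s (test_cost sz b s) s"
| WhileTrue: "test_holds b s \<Longrightarrow> exec sz c s t1 s' \<Longrightarrow> exec sz (While b c) s' t2 s'' \<Longrightarrow>
    exec sz (While b c) s (test_cost sz b s + t1 + t2) s''"

inductive_cases exec_elims:
  "exec sz Skip s t s'"
  "exec sz (IndexConst r k) s t s'"
  "exec sz (IndexAdd r p q) s t s'"
  "exec sz (IndexSub r p q) s t s'"
  "exec sz (FieldConst r a) s t s'"
  "exec sz (FieldCopy r p) s t s'"
  "exec sz (FieldOp f r p q) s t s'"
  "exec sz (Seq c1 c2) s t s'"
  "exec sz (Cond b c1 c2) s t s'"
inductive_cases exec_WhileE: "exec sz (While b c) s t s'"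

lemma exec_deterministic:
  "exec sz c s t s' \<Longrightarrow> exec sz c s u s'' \<Longrightarrow> u = t \<and> s'' = s'"
proof (induction arbitrary: u s'' rule: exec.induct)
  case (WhileFalse b s c)
  from WhileFalse.prems WhileFalse.hyps show ?case by (auto elim: exec_WhileE)
next
  case (WhileTrue b s c t1 s1 t2 s2)
  from WhileTrue.prems WhileTrue.hyps(1) obtain v1 r v2
    where r: "exec sz c s v1 r" "exec sz (While b c) r v2 s''" "u = test_cost sz b s + v1 + v2"
    by (auto elim: exec_WhileE)
  from WhileTrue.IH(1)[OF r(1)] WhileTrue.IH(2) r(2,3) show ?case by auto
next
  case (Seq c1 s t1 s1 c2 t2 s2)
  from Seq.prems obtain v1 r v2
    where r: "exec sz c1 s v1 r" "exec sz c2 r v2 s''" "u = v1 + v2"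
    by (auto elim: exec_elims)
  from Seq.IH(1)[OF r(1)] Seq.IH(2) r(2,3) show ?case by auto
qed (erule exec_elims; fastforce)+

text \<open>
  The input length is in index register 0 and the input word in the memory cells
  0, 1, 2, ...; the output is read off in the same way.
\<close>

definition input_state :: "'a::field list \<Rightarrow> 'a state" where
  "input_state w = ((\<lambda>_. 0)(0 := length w), \<lambda>i. if i < length w then w ! i else 0)"

definition output_word :: "'a state \<Rightarrow> 'a list" where
  "output_word s = map (snd s) [0..<fst s 0]"

definition word_size :: "('a \<Rightarrow> nat) \<Rightarrow> 'a list \<Rightarrow> nat" where
  "word_size sz w = (\<Sum>x\<leftarrow>w. 1 + sz x)"

text \<open>Field operations increase sizes at most polynomially, as for bit lengths and heights.\<close>

definition admissible_size :: "('a::field \<Rightarrow> nat) \<Rightarrow> bool" where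
  "admissible_size sz \<longleftrightarrow>
     (\<exists>p :: nat poly. \<forall>f x y. sz (eval_op f x y) \<le> poly p (sz x + sz y))"

lemma admissible_size_unit_cost: "admissible_size (\<lambda>_. 0)"
  by (simp add: admissible_size_def)


section \<open>Polynomial-time equivalence\<close>

text \<open>
  Polynomial-time many-one reducibility. Index addition could make the output exponentially
  longer than the running time, hence the size of the output is charged as well.
\<close>

definition poly_time_reducible ::
    "('a::field \<Rightarrow> nat) \<Rightarrow> 'a problem \<Rightarrow> 'a problem \<Rightarrow> bool" where
  "poly_time_reducible sz P Q \<longleftrightarrow>
     (\<exists>c :: 'a com. \<exists>p :: nat poly. \<forall>w\<in>fst P. \<exists>t s.
        exec sz c (input_state w) t s \<and>
        t + word_size sz (output_word s) \<le> poly p (word_size sz w) \<and>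
        output_word s \<in> fst Q \<and>
        (w \<in> snd P \<longleftrightarrow> output_word s \<in> snd Q))"

definition poly_time_equivalent ::
    "('a::field \<Rightarrow> nat) \<Rightarrow> 'a problem \<Rightarrow> 'a problem \<Rightarrow> bool" where
  "poly_time_equivalent sz P Q \<longleftrightarrow> poly_time_reducible sz P Q \<and> poly_time_reducible sz Q P"

end

theory Submission
  imports Defs "Jordan_Normal_Form.Determinant"
begin

text \<open>
  One construction serves both directions. To a trilinear form \<open>\<phi>\<close> on \<open>U = F^n\<close> attach three copies
  \<open>U\<^sub>0, U\<^sub>1, U\<^sub>2\<close> of \<open>U\<close>, one copy \<open>X\<close> of its dual, three scalars \<open>z\<^sub>0, z\<^sub>1, z\<^sub>2\<close>, and the trilinear form
  \<open>\<phi>(u\<^sub>0, u\<^sub>1, u\<^sub>2) + \<Sum>\<^sub>i \<langle>u\<^sub>i, x\<rangle> z\<^sub>i + z\<^sub>0 z\<^sub>1 z\<^sub>2\<close>, and (skew-)symmetrise it over the six permutations of the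
  arguments; the sign \<open>\<epsilon> = 1\<close> or \<open>\<epsilon> = -1\<close> of the odd ones decides whether the result is symmetric or
  alternating. If an isomorphism acts on the seven summands separately, by \<open>A\<^sub>i\<close> on \<open>U\<^sub>i\<close>, \<open>C\<close> on
  \<open>X\<close> and \<open>\<zeta>\<^sub>i\<close> on the scalars, then the middle terms give \<open>\<zeta>\<^sub>i A\<^sub>i = C\<^sup>-\<^sup>T\<close> for all \<open>i\<close> and the last one
  \<open>\<zeta>\<^sub>0 \<zeta>\<^sub>1 \<zeta>\<^sub>2 = 1\<close>, so \<open>C\<^sup>-\<^sup>T\<close> is an isomorphism of the original forms.

  Isomorphisms are forced to respect the summands, modulo a harmless subspace, by a labelling gadget:
  the \<open>i\<close>-th summand \<open>E\<^sub>i\<close> is paired with new spaces \<open>P\<^sub>i\<close> and \<open>Q\<^sub>i = (E\<^sub>i \<otimes> P\<^sub>i)\<^sup>*\<close>, where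
  \<open>dim P\<^sub>i = M + i\<close> with \<open>M\<close> larger than the sum of the dimensions of the \<open>E\<^sub>i\<close>. The vectors
  \<open>v\<close> for which the bilinear form \<open>\<Phi>(v, _, _)\<close> has small rank form the sum \<open>D\<close> of all \<open>P\<^sub>i\<close> and
  \<open>Q\<^sub>i\<close>, and on \<open>D\<close> the rank of \<open>\<Phi>(v, _, _)\<close> is twice the sum of \<open>M + i\<close> over the summands in which
  \<open>v\<close> has a component; as \<open>M + i < 2 M\<close>, this rank determines the summand of a vector lying in one of
  them.
\<close>

section \<open>Linear algebra\<close>

text \<open>Symmetrising \<phi> directly fails: a form that is already symmetric or alternating
  turns into 6 \<phi> or 0, and 6 may vanish in F. On arguments from three different summands only
  one of the six permutations survives, so nothing is ever divided and all characteristics are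
  treated alike. The price is that an isomorphism may act differently on the three copies. The dual
  copy ties the three maps together up to scalars, and the three separate scalars absorb this
  freedom without any cube root, which F need not contain. The labels must not destroy isomorphisms
  either: as \<open>Q_i\<close> is dual to the tensor product of \<open>E_i\<close> and
  \<open>P_i\<close>, any change of coordinates of \<open>E_i\<close> is compensated on
  \<open>Q_i\<close>. Only D and the spaces \<open>E_i + D\<close> are preserved, not
  \<open>E_i\<close> itself. Images of vectors of \<open>E_i\<close> therefore carry D components,
  and the terms these cause must be shown to vanish, by testing against vectors of D with a single
  label. For the running time it is essential that an output entry is a sum of boundedly many cells:
  the polynomial bound on the size of one operation may be iterated a constant number of times, but
  not n times.\<close>

lemma underdetermined_solution:
  fixes B :: "nat \<Rightarrow> 'b \<Rightarrow> 'a::field"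
  assumes "finite S" "k < card S"
  shows "\<exists>y. (\<exists>s\<in>S. y s \<noteq> 0) \<and> (\<forall>l<k. (\<Sum>s\<in>S. B l s * y s) = 0)"
  using assms
proof (induction k arbitrary: S B)
  case 0
  then obtain s where "s \<in> S" by fastforce
  then show ?case by (intro exI[of _ "\<lambda>_. 1"]) auto
next
  case (Suc k)
  show ?case
  proof (cases "\<forall>s\<in>S. B k s = 0")
    case True
    obtain y where "\<exists>s\<in>S. y s \<noteq> 0" "\<forall>l<k. (\<Sum>s\<in>S. B l s * y s) = 0"
      using Suc.IH[of S B] Suc.prems by auto
    with True show ?thesis by (intro exI[of _ y]) (auto simp: less_Suc_eq)
  next
    case False
    then obtain t where t: "t \<in> S" "B k t \<noteq> 0" by auto
    define S' where "S' = S - {t}"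
    have S': "finite S'" "k < card S'" "S = insert t S'" "t \<notin> S'"
      using Suc.prems t by (auto simp: S'_def)
    obtain y where y: "\<exists>s\<in>S'. y s \<noteq> 0"
      "\<forall>l<k. (\<Sum>s\<in>S'. (B l s - B l t * (B k s / B k t)) * y s) = 0"
      using Suc.IH[OF S'(1,2), of "\<lambda>l s. B l s - B l t * (B k s / B k t)"] by auto
    \<comment> \<open>Equation \<open>k\<close>, solved for the eliminated coordinate
      \<open>t\<close>, extends the solution of the reduced system.\<close>
    define z where "z = y(t := - (\<Sum>s\<in>S'. B k s / B k t * y s))"
    have z: "(\<Sum>s\<in>S. B l s * z s) =
        (\<Sum>s\<in>S'. (B l s - B l t * (B k s / B k t)) * y s)" for l
    proof -
      have "(\<Sum>s\<in>S. B l s * z s) = B l t * z t + (\<Sum>s\<in>S'. B l s * y s)"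
        using S' by (auto simp: z_def intro!: sum.cong)
      also have "\<dots> = (\<Sum>s\<in>S'. (B l s - B l t * (B k s / B k t)) * y s)"
        by (simp add: z_def left_diff_distrib sum_subtractf sum_distrib_left mult.assoc)
      finally show ?thesis .
    qed
    have "\<exists>s\<in>S. z s \<noteq> 0" using y(1) S' by (auto simp: z_def)
    moreover have "(\<Sum>s\<in>S. B l s * z s) = 0" if "l < Suc k" for l
      using that y(2) t unfolding z by (cases "l = k") auto
    ultimately show ?thesis by blast
  qed
qed

text \<open>A factorisation through \<open>k\<close> coordinates. The factors may be arbitrary
  functions on an arbitrary set, so a bound is transported along a map by composing the factors with
  it; lower bounds need only finitely many vectors.\<close>

definition rank_le :: "nat \<Rightarrow> 'b set \<Rightarrow> ('b \<Rightarrow> 'b \<Rightarrow> 'a::field) \<Rightarrow> bool" where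
  "rank_le k D b \<longleftrightarrow> (\<exists>A B. \<forall>v\<in>D. \<forall>w\<in>D. b v w = (\<Sum>l<k. A l v * B l w))"

lemma rank_le_add:
  assumes "\<And>v w. v \<in> D \<Longrightarrow> w \<in> D \<Longrightarrow>
    b v w = (\<Sum>l<k. A l v * B l w) + (\<Sum>l<k'. A' l v * B' l w)"
  shows "rank_le (k + k') D b"
  unfolding rank_le_def
proof (intro exI ballI)
  fix v w assume vw: "v \<in> D" "w \<in> D"
  let ?A = "\<lambda>l. if l < k then A l else A' (l - k)"
  let ?B = "\<lambda>l. if l < k then B l else B' (l - k)"
  have "{..<k + k'} = {..<k} \<union> {k..<k + k'}" by auto
  then have "(\<Sum>l<k+k'. ?A l v * ?B l w) =
      (\<Sum>l<k. ?A l v * ?B l w) + (\<Sum>l=k..<k+k'. ?A l v * ?B l w)"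
    by (simp add: sum.union_disjoint ivl_disj_int)
  also have "(\<Sum>l=k..<k+k'. ?A l v * ?B l w) = (\<Sum>l<k'. A' l v * B' l w)"
    by (rule sum.reindex_bij_witness[of _ "\<lambda>l. l + k" "\<lambda>l. l - k"]) auto
  finally show "b v w = (\<Sum>l<k+k'. ?A l v * ?B l w)" using assms[OF vw] by simp
qed

text \<open>With more than \<open>k\<close> columns, some nontrivial combination is killed by all
  functionals \<open>B l\<close>; yet its entry in a row \<open>s\<close> with
  \<open>c s \<noteq> 0\<close> is a nonzero multiple of a diagonal entry.\<close>

lemma rank_le_card_diagonal:
  fixes b :: "'b \<Rightarrow> 'b \<Rightarrow> 'a::field"
  assumes "rank_le k D b" "finite S"
    and x: "\<And>s. s \<in> S \<Longrightarrow> x s \<in> D \<and> y s \<in> D"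
    and diag: "\<And>s. s \<in> S \<Longrightarrow> b (x s) (y s) \<noteq> 0"
    and off: "\<And>s t. s \<in> S \<Longrightarrow> t \<in> S \<Longrightarrow> s \<noteq> t \<Longrightarrow> b (x s) (y t) = 0"
  shows "card S \<le> k"
proof (rule ccontr)
  assume "\<not> card S \<le> k"
  obtain A B where AB: "\<And>v w. v \<in> D \<Longrightarrow> w \<in> D \<Longrightarrow> b v w = (\<Sum>l<k. A l v * B l w)"
    using assms(1) unfolding rank_le_def by blast
  obtain c where c: "\<exists>s\<in>S. c s \<noteq> 0" "\<forall>l<k. (\<Sum>t\<in>S. B l (y t) * c t) = 0"
    using underdetermined_solution[of S k "\<lambda>l t. B l (y t)"] \<open>\<not> card S \<le> k\<close> assms(2) by auto
  then obtain s where s: "s \<in> S" "c s \<noteq> 0" by auto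
  have "b (x s) (y s) * c s = (\<Sum>t\<in>S. b (x s) (y t) * c t)"
    using off[OF s(1)] s(1) assms(2) by (subst sum.remove[of _ s]) (force intro!: sum.neutral)+
  also have "\<dots> = (\<Sum>t\<in>S. \<Sum>l<k. A l (x s) * B l (y t) * c t)"
    using x s(1) by (auto intro!: sum.cong simp: AB sum_distrib_right)
  also have "\<dots> = (\<Sum>l<k. A l (x s) * (\<Sum>t\<in>S. B l (y t) * c t))"
    by (subst sum.swap) (simp add: sum_distrib_left mult.assoc)
  also have "\<dots> = 0" using c(2) by simp
  finally show False using diag s by simp
qed

section \<open>Coordinates of linear and trilinear forms, and linear endomorphisms\<close>

lemma linear_form_expand:
  assumes f: "linear_form n f" and v: "v \<in> carrier_vec n"
  shows "f v = (\<Sum>i<n. v $ i * f (unit_vec n i))"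
proof -
  have add: "f (u + w) = f u + f w" if "u \<in> carrier_vec n" "w \<in> carrier_vec n" for u w
    using f that by (auto simp: linear_form_def)
  have smult: "f (a \<cdot>\<^sub>v u) = a * f u" if "u \<in> carrier_vec n" for a u
    using f that by (auto simp: linear_form_def)
  have "f (vec n (\<lambda>i. if i < k then v $ i else 0)) = (\<Sum>i<k. v $ i * f (unit_vec n i))"
    if "k \<le> n" for k
    using that
  proof (induction k)
    case 0
    have "vec n (\<lambda>i. if i < 0 then v $ i else 0) = 0 \<cdot>\<^sub>v v" using v by auto
    then show ?case using smult[OF v] by simp
  next
    case (Suc k)
    have "vec n (\<lambda>i. if i < Suc k then v $ i else 0) =
        vec n (\<lambda>i. if i < k then v $ i else 0) + v $ k \<cdot>\<^sub>v unit_vec n k"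
      using Suc.prems by (intro eq_vecI) (auto simp: less_Suc_eq)
    then show ?case using Suc by (simp add: add smult)
  qed
  from this[of n] have "f (vec n (\<lambda>i. if i < n then v $ i else 0)) =
      (\<Sum>i<n. v $ i * f (unit_vec n i))" by simp
  moreover have "vec n (\<lambda>i. if i < n then v $ i else 0) = v" using v by auto
  ultimately show ?thesis by simp
qed

lemma trilinear_form_linear:
  assumes "trilinear_form n \<phi>" "v \<in> carrier_vec n" "w \<in> carrier_vec n"
  shows "linear_form n (\<lambda>u. \<phi> u v w)" "linear_form n (\<lambda>u. \<phi> v u w)" "linear_form n (\<lambda>u. \<phi> v w u)"
  using assms by (auto simp: trilinear_form_def)

lemma trilinear_form_expand:
  assumes \<phi>: "trilinear_form n \<phi>"
    and uvw: "u \<in> carrier_vec n" "v \<in> carrier_vec n" "w \<in> carrier_vec n"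
  shows "\<phi> u v w = (\<Sum>a<n. \<Sum>b<n. \<Sum>c<n.
    \<phi> (unit_vec n a) (unit_vec n b) (unit_vec n c) * u $ a * v $ b * w $ c)"
proof -
  have "\<phi> u v w = (\<Sum>a<n. u $ a * \<phi> (unit_vec n a) v w)"
    by (rule linear_form_expand[OF trilinear_form_linear(1)[OF \<phi>]]) (use uvw in auto)
  also have "\<dots> = (\<Sum>a<n. u $ a * (\<Sum>b<n. v $ b * \<phi> (unit_vec n a) (unit_vec n b) w))"
    by (intro sum.cong refl arg_cong2[of _ _ _ _ "(*)"] linear_form_expand
        trilinear_form_linear(2)[OF \<phi>]) (use uvw in auto)
  also have "\<dots> = (\<Sum>a<n. u $ a * (\<Sum>b<n. v $ b *
      (\<Sum>c<n. w $ c * \<phi> (unit_vec n a) (unit_vec n b) (unit_vec n c))))"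
    by (intro sum.cong refl arg_cong2[of _ _ _ _ "(*)"]
        linear_form_expand[OF trilinear_form_linear(3)[OF \<phi>]]) (use uvw in auto)
  finally show ?thesis by (simp add: sum_distrib_left mult_ac)
qed

lemma trilinear_form_cong_unit:
  assumes \<phi>: "trilinear_form n \<phi>" and \<psi>: "trilinear_form n \<psi>"
    and eq: "\<And>a b c. a < n \<Longrightarrow> b < n \<Longrightarrow> c < n \<Longrightarrow>
      \<phi> (unit_vec n a) (unit_vec n b) (unit_vec n c) = \<psi> (unit_vec n a) (unit_vec n b) (unit_vec n c)"
    and uvw: "u \<in> carrier_vec n" "v \<in> carrier_vec n" "w \<in> carrier_vec n"
  shows "\<phi> u v w = \<psi> u v w"
  unfolding trilinear_form_expand[OF \<phi> uvw] trilinear_form_expand[OF \<psi> uvw]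
  by (intro sum.cong refl) (simp add: eq)

lemma trilinear_form_monomial:
  assumes "i < n" "j < n" "k < n"
  shows "trilinear_form n (\<lambda>u v w. c * u $ i * v $ j * w $ k)"
  using assms by (auto simp: trilinear_form_def linear_form_def algebra_simps)

lemma trilinear_form_add:
  "trilinear_form n S \<Longrightarrow> trilinear_form n T \<Longrightarrow> trilinear_form n (\<lambda>u v w. S u v w + T u v w)"
  by (auto simp: trilinear_form_def linear_form_def algebra_simps)

lemma trilinear_form_sum:
  "(\<And>i. i \<in> I \<Longrightarrow> trilinear_form n (T i)) \<Longrightarrow> trilinear_form n (\<lambda>u v w. \<Sum>i\<in>I. T i u v w)"
  by (auto simp: trilinear_form_def linear_form_def sum.distrib sum_distrib_left)

definition linear_endo :: "nat \<Rightarrow> ('a::field vec \<Rightarrow> 'a vec) \<Rightarrow> bool" where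
  "linear_endo n f \<longleftrightarrow>
     (\<forall>u\<in>carrier_vec n. f u \<in> carrier_vec n) \<and>
     (\<forall>u\<in>carrier_vec n. \<forall>v\<in>carrier_vec n. f (u + v) = f u + f v) \<and>
     (\<forall>a. \<forall>u\<in>carrier_vec n. f (a \<cdot>\<^sub>v u) = a \<cdot>\<^sub>v f u)"

lemma linear_endo_carrier: "linear_endo n f \<Longrightarrow> u \<in> carrier_vec n \<Longrightarrow> f u \<in> carrier_vec n"
  by (simp add: linear_endo_def)

lemma linear_endo_mult_mat_vec: "A \<in> carrier_mat n n \<Longrightarrow> linear_endo n ((*\<^sub>v) A)"
  by (auto simp: linear_endo_def mult_add_distrib_mat_vec mult_mat_vec)

lemma linear_endo_index:
  assumes "linear_endo n f" "i < n" "v \<in> carrier_vec n"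
  shows "f v $ i = (\<Sum>j<n. v $ j * f (unit_vec n j) $ i)"
proof (rule linear_form_expand[of n "\<lambda>v. f v $ i"])
  have *: "dim_vec (f w) = n" if "w \<in> carrier_vec n" for w
    using assms(1) that unfolding linear_endo_def by auto
  show "linear_form n (\<lambda>v. f v $ i)"
    using assms(1,2) unfolding linear_form_def linear_endo_def by (auto simp: *)
qed fact

lemma linear_endo_matrix:
  assumes f: "linear_endo n f"
  shows "\<exists>A\<in>carrier_mat n n. \<forall>v\<in>carrier_vec n. f v = A *\<^sub>v v"
proof (intro bexI ballI)
  let ?A = "mat n n (\<lambda>(i, j). f (unit_vec n j) $ i)"
  show "?A \<in> carrier_mat n n" by simp
  fix v :: "'a vec" assume v: "v \<in> carrier_vec n"
  show "f v = ?A *\<^sub>v v"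
  proof (rule eq_vecI)
    fix i assume "i < dim_vec (?A *\<^sub>v v)"
    then show "f v $ i = (?A *\<^sub>v v) $ i"
      using v by (simp add: linear_endo_index[OF f _ v] scalar_prod_def mult.commute lessThan_atLeast0)
  qed (use linear_endo_carrier[OF f v] in auto)
qed

lemma mat_eq_oneI:
  fixes A :: "'a::field mat"
  assumes "A \<in> carrier_mat n n" "\<And>v. v \<in> carrier_vec n \<Longrightarrow> A *\<^sub>v v = v"
  shows "A = 1\<^sub>m n"
proof (rule eq_matI)
  fix i j assume ij: "i < dim_row (1\<^sub>m n :: 'a mat)" "j < dim_col (1\<^sub>m n :: 'a mat)"
  have "A $$ (i, j) = (A *\<^sub>v unit_vec n j) $ i" using assms(1) ij by (auto simp: scalar_prod_right_unit)
  then show "A $$ (i, j) = 1\<^sub>m n $$ (i, j)" using assms(2)[of "unit_vec n j"] ij by (simp add: unit_vec_def)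
qed (use assms in auto)

text \<open>Trades matrices and the group action for a pair of mutually inverse linear maps, the
  shape in which isomorphisms are analysed and constructed below. \<open>f\<close> is the inverse of
  the acting matrix, because the action substitutes the inverse.\<close>

lemma equivalent_forms_iff:
  fixes \<phi> \<psi> :: "'a::field form3"
  shows "equivalent_forms n \<phi> \<psi> \<longleftrightarrow>
    (\<exists>f g. linear_endo n f \<and> linear_endo n g \<and>
      (\<forall>v\<in>carrier_vec n. g (f v) = v \<and> f (g v) = v) \<and>
      (\<forall>u\<in>carrier_vec n. \<forall>v\<in>carrier_vec n. \<forall>w\<in>carrier_vec n. \<phi> u v w = \<psi> (f u) (f v) (f w)))"
proof -
  interpret ring "ring_mat TYPE('a) n ()" by (rule ring_mat)
  note simps = ring_mat_simps
  show ?thesis (is "_ \<longleftrightarrow> ?R")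
  proof
    assume "equivalent_forms n \<phi> \<psi>"
    then obtain A where A: "A \<in> GL n"
      and eq: "\<forall>u\<in>carrier_vec n. \<forall>v\<in>carrier_vec n. \<forall>w\<in>carrier_vec n. \<phi> u v w = form_act n \<psi> A u v w"
      by (auto simp: equivalent_forms_def)
    define B where "B = inv\<^bsub>ring_mat TYPE('a) n ()\<^esub> A"
    have AB: "A \<in> carrier_mat n n" "B \<in> carrier_mat n n" "A * B = 1\<^sub>m n" "B * A = 1\<^sub>m n"
      using Units_closed[OF A] Units_inv_closed[OF A] Units_r_inv[OF A] Units_l_inv[OF A]
      by (simp_all add: B_def simps)
    show ?R
      using AB eq assoc_mult_mat_vec[OF AB(1,2), symmetric] assoc_mult_mat_vec[OF AB(2,1), symmetric]
      by (intro exI[of _ "(*\<^sub>v) B"] exI[of _ "(*\<^sub>v) A"])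
        (simp add: linear_endo_mult_mat_vec form_act_def B_def[symmetric])
  next
    assume ?R
    then obtain f g where fg: "linear_endo n f" "linear_endo n g"
      "\<And>v. v \<in> carrier_vec n \<Longrightarrow> g (f v) = v" "\<And>v. v \<in> carrier_vec n \<Longrightarrow> f (g v) = v"
      and eq: "\<forall>u\<in>carrier_vec n. \<forall>v\<in>carrier_vec n. \<forall>w\<in>carrier_vec n. \<phi> u v w = \<psi> (f u) (f v) (f w)"
      by blast
    obtain A B where A: "A \<in> carrier_mat n n" "\<forall>v\<in>carrier_vec n. g v = A *\<^sub>v v"
      and B: "B \<in> carrier_mat n n" "\<forall>v\<in>carrier_vec n. f v = B *\<^sub>v v"
      using linear_endo_matrix[OF fg(1)] linear_endo_matrix[OF fg(2)] by blast
    have "A * B = 1\<^sub>m n"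
      using A B fg assoc_mult_mat_vec[OF A(1) B(1)] linear_endo_carrier[OF fg(1)]
      by (intro mat_eq_oneI) simp_all
    moreover have "B * A = 1\<^sub>m n"
      using A B fg assoc_mult_mat_vec[OF B(1) A(1)] linear_endo_carrier[OF fg(2)]
      by (intro mat_eq_oneI) simp_all
    ultimately have AB: "A \<in> GL n" "inv\<^bsub>ring_mat TYPE('a) n ()\<^esub> A = B"
      using A(1) B(1) by (auto simp: Units_def simps intro!: inv_unique'[symmetric])
    show "equivalent_forms n \<phi> \<psi>"
      unfolding equivalent_forms_def
      using AB eq B by (intro bexI[of _ A]) (auto simp: form_act_def)
  qed
qed

section \<open>The labelling gadget\<close>

definition sym3 :: "'a::field \<Rightarrow> 'a form3 \<Rightarrow> 'a form3" where
  "sym3 \<epsilon> T u v w = T u v w + T v w u + T w u v + \<epsilon> * (T v u w + T u w v + T w v u)"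

lemma trilinear_form_sym3: "trilinear_form n T \<Longrightarrow> trilinear_form n (sym3 \<epsilon> T)"
  by (auto simp: trilinear_form_def linear_form_def sym3_def algebra_simps)

text \<open>With two equal arguments every even permutation cancels against an odd one, so the
  result is alternating in characteristic 2 as well.\<close>

lemma alternating_form_sym3: "alternating_form n (sym3 (-1) T)"
  by (auto simp: alternating_form_def sym3_def)

lemma symmetric_form_sym3: "symmetric_form n (sym3 1 T)"
  unfolding symmetric_form_def
proof (intro allI impI)
  fix u :: "nat \<Rightarrow> 'a vec" and \<sigma> :: "nat \<Rightarrow> nat"
  assume \<sigma>: "\<sigma> permutes {1..3}"
  have *: "\<sigma> i = 1 \<or> \<sigma> i = 2 \<or> \<sigma> i = 3" if "i \<in> {1..3}" for i
  proof -
    have "\<sigma> i \<in> {1..3}" using permutes_in_image[OF \<sigma>, of i] that by blast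
    then show ?thesis by auto
  qed
  have "\<sigma> 1 = 1 \<or> \<sigma> 1 = 2 \<or> \<sigma> 1 = 3" "\<sigma> 2 = 1 \<or> \<sigma> 2 = 2 \<or> \<sigma> 2 = 3"
    "\<sigma> 3 = 1 \<or> \<sigma> 3 = 2 \<or> \<sigma> 3 = 3"
    by (rule *, simp)+
  moreover have "\<sigma> 1 \<noteq> \<sigma> 2" "\<sigma> 1 \<noteq> \<sigma> 3" "\<sigma> 2 \<noteq> \<sigma> 3"
    using permutes_inj[OF \<sigma>] by (simp_all add: inj_eq)
  ultimately have "\<sigma> 1 = 1 \<and> \<sigma> 2 = 2 \<and> \<sigma> 3 = 3 \<or> \<sigma> 1 = 1 \<and> \<sigma> 2 = 3 \<and> \<sigma> 3 = 2 \<or>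
    \<sigma> 1 = 2 \<and> \<sigma> 2 = 1 \<and> \<sigma> 3 = 3 \<or> \<sigma> 1 = 2 \<and> \<sigma> 2 = 3 \<and> \<sigma> 3 = 1 \<or>
    \<sigma> 1 = 3 \<and> \<sigma> 2 = 1 \<and> \<sigma> 3 = 2 \<or> \<sigma> 1 = 3 \<and> \<sigma> 2 = 2 \<and> \<sigma> 3 = 1"
    by metis
  then show "sym3 1 T (u 1) (u 2) (u 3) = sym3 1 T (u (\<sigma> 1)) (u (\<sigma> 2)) (u (\<sigma> 3))"
    by (elim disjE conjE) (simp_all only: sym3_def mult_1 add_ac)
qed

lemma trilinear_form_add_left:
  assumes "trilinear_form n T" "u \<in> carrier_vec n" "u' \<in> carrier_vec n" "v \<in> carrier_vec n" "w \<in> carrier_vec n"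
  shows "T (u + u') v w = T u v w + T u' v w" "T v (u + u') w = T v u w + T v u' w"
    "T v w (u + u') = T v w u + T v w u'"
  using assms by (auto simp: trilinear_form_def linear_form_def)

section \<open>The gadget form and the ranks it produces\<close>

text \<open>Coordinates below \<open>K\<close> are those of the \<open>E_i\<close>;
  \<open>cl x\<close> is the label of \<open>x\<close> and \<open>R i\<close> the dimension of
  \<open>P_i\<close>. \<open>p i r\<close> is coordinate \<open>r\<close> of \<open>P_i\<close>, and
  \<open>q x r\<close> the coordinate of \<open>Q_i\<close> dual to the tensor of coordinates
  \<open>x\<close> of \<open>E_i\<close> and \<open>r\<close> of \<open>P_i\<close>. All rank
  comparisons rest on \<open>K < M\<close>, \<open>M \<le> R i\<close> and
  \<open>R i < 2 * M\<close>.\<close>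

locale rank_gadget =
  fixes N K M :: nat and cl :: "nat \<Rightarrow> nat" and R :: "nat \<Rightarrow> nat" and p q :: "nat \<Rightarrow> nat \<Rightarrow> nat"
    and \<epsilon> :: "'a::field"
  assumes K_less: "K < M" and K_le: "K \<le> N" and eps: "\<epsilon> \<noteq> 0"
    and R_bounds: "x < K \<Longrightarrow> M \<le> R (cl x)" "x < K \<Longrightarrow> R (cl x) < 2 * M"
    and R_inj: "x < K \<Longrightarrow> y < K \<Longrightarrow> R (cl x) = R (cl y) \<Longrightarrow> cl x = cl y"
    and p_ge: "x < K \<Longrightarrow> r < R (cl x) \<Longrightarrow> K \<le> p (cl x) r"
    and p_less: "x < K \<Longrightarrow> r < R (cl x) \<Longrightarrow> p (cl x) r < N"
    and q_ge: "x < K \<Longrightarrow> r < R (cl x) \<Longrightarrow> K \<le> q x r"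
    and q_less: "x < K \<Longrightarrow> r < R (cl x) \<Longrightarrow> q x r < N"
    and p_inj: "x < K \<Longrightarrow> y < K \<Longrightarrow> r < R (cl x) \<Longrightarrow> s < R (cl y) \<Longrightarrow>
      p (cl x) r = p (cl y) s \<longleftrightarrow> cl x = cl y \<and> r = s"
    and q_inj: "x < K \<Longrightarrow> y < K \<Longrightarrow> r < R (cl x) \<Longrightarrow> s < R (cl y) \<Longrightarrow>
      q x r = q y s \<longleftrightarrow> x = y \<and> r = s"
    and p_neq_q: "x < K \<Longrightarrow> y < K \<Longrightarrow> r < R (cl x) \<Longrightarrow> s < R (cl y) \<Longrightarrow> p (cl x) r \<noteq> q y s"
begin

text \<open>The natural contraction on \<open>E_i\<close>, \<open>P_i\<close> and the dual of their
  tensor product, summed over the labels. The factor 1 is the coefficient that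
  \<open>trilinear_form_monomial\<close> expects.\<close>

definition gadget :: "'a form3" where
  "gadget u v w = (\<Sum>x<K. \<Sum>r<R (cl x). 1 * u $ x * v $ p (cl x) r * w $ q x r)"

definition deep :: "'a vec set" where
  "deep = {v \<in> carrier_vec N. \<forall>x<K. v $ x = 0}"

definition flat :: "'a vec set" where
  "flat = {v \<in> carrier_vec N. \<forall>x<N. K \<le> x \<longrightarrow> v $ x = 0}"

text \<open>This is \<open>E_i + D\<close> with D the space \<open>deep\<close>: an isomorphism has
  no reason to respect the chosen complement of D, so no smaller space can be expected to be
  preserved.\<close>

definition pure :: "nat \<Rightarrow> 'a vec set" where
  "pure i = {v \<in> carrier_vec N. \<forall>x<K. cl x \<noteq> i \<longrightarrow> v $ x = 0}"

text \<open>Such a form is pulled back from the quotient by D.\<close>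

definition top_form :: "'a form3 \<Rightarrow> bool" where
  "top_form T \<longleftrightarrow> trilinear_form N T \<and>
    (\<forall>u\<in>carrier_vec N. \<forall>v\<in>carrier_vec N. \<forall>w\<in>carrier_vec N.
      u \<in> deep \<or> v \<in> deep \<or> w \<in> deep \<longrightarrow> T u v w = 0)"

definition gform :: "'a form3 \<Rightarrow> 'a form3" where
  "gform T = sym3 \<epsilon> (\<lambda>u v w. T u v w + gadget u v w)"

lemma deepD: "v \<in> deep \<Longrightarrow> v \<in> carrier_vec N" and flatD: "v \<in> flat \<Longrightarrow> v \<in> carrier_vec N"
  and pureD: "v \<in> pure i \<Longrightarrow> v \<in> carrier_vec N"
  by (auto simp: deep_def flat_def pure_def)

lemma trilinear_form_gadget: "trilinear_form N gadget"
  unfolding gadget_def[abs_def]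
  by (intro trilinear_form_sum trilinear_form_monomial) (use K_le p_less q_less in auto)

lemma trilinear_form_gform: "top_form T \<Longrightarrow> trilinear_form N (gform T)"
  unfolding gform_def top_form_def
  by (intro trilinear_form_sym3 trilinear_form_add trilinear_form_gadget) auto

lemma gadget_deep: "u \<in> deep \<Longrightarrow> gadget u v w = 0"
  by (simp add: gadget_def deep_def)

lemma gadget_flat: "v \<in> flat \<Longrightarrow> gadget u v w = 0" "w \<in> flat \<Longrightarrow> gadget u v w = 0"
  by (auto simp: gadget_def flat_def p_ge p_less q_ge q_less intro!: sum.neutral)

text \<open>What remains of \<open>gform T v\<close> on D (see \<open>gform_deep\<close>):
  \<open>T\<close> drops out, and so do the four permutations that put a vector of D into the first
  slot of the gadget.\<close>

definition pairing :: "'a vec \<Rightarrow> 'a vec \<Rightarrow> 'a vec \<Rightarrow> 'a" where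
  "pairing v d d' = gadget v d d' + \<epsilon> * gadget v d' d"

lemma gform_deep:
  assumes "top_form T" "v \<in> carrier_vec N" "d \<in> deep" "d' \<in> deep"
  shows "gform T v d d' = pairing v d d'" "gform T d v d' = pairing v d' d" "gform T d d' v = pairing v d d'"
  using assms by (auto simp: gform_def sym3_def pairing_def top_form_def gadget_deep deepD)

text \<open>Of two flat arguments one always lands in the \<open>P\<close> or the \<open>Q\<close>
  slot of the gadget, where it has no coordinates.\<close>

lemma gform_flat_flat_deep:
  assumes "top_form T" "e \<in> flat" "e' \<in> flat" "d \<in> deep"
  shows "gform T e e' d = 0" "gform T e d e' = 0" "gform T d e e' = 0"
  using assms by (auto simp: gform_def sym3_def top_form_def gadget_deep gadget_flat deepD flatD)

lemma gform_flat:
  assumes "e \<in> flat" "e' \<in> flat" "e'' \<in> flat"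
  shows "gform T e e' e'' = sym3 \<epsilon> T e e' e''"
  using assms by (auto simp: gform_def sym3_def gadget_flat)

lemma pairing_deep: "v \<in> deep \<Longrightarrow> pairing v d d' = 0"
  by (simp add: pairing_def gadget_deep)

definition top_part :: "'a vec \<Rightarrow> 'a vec" where
  "top_part v = vec N (\<lambda>x. if x < K then v $ x else 0)"

definition deep_part :: "'a vec \<Rightarrow> 'a vec" where
  "deep_part v = vec N (\<lambda>x. if x < K then 0 else v $ x)"

lemma top_part_flat: "top_part v \<in> flat" and deep_part_deep: "deep_part v \<in> deep"
  using K_le by (auto simp: top_part_def deep_part_def flat_def deep_def)

lemma top_part_add_deep_part: "v \<in> carrier_vec N \<Longrightarrow> top_part v + deep_part v = v"
  by (rule eq_vecI) (auto simp: top_part_def deep_part_def)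

lemma top_part_carrier[simp]: "top_part v \<in> carrier_vec N"
  and deep_part_carrier[simp]: "deep_part v \<in> carrier_vec N"
  by (auto simp: top_part_def deep_part_def)

lemma top_part_index: "x < K \<Longrightarrow> top_part v $ x = v $ x"
  using K_le by (simp add: top_part_def)

lemma pure_top_part: "v \<in> pure i \<Longrightarrow> top_part v \<in> pure i"
  using K_le by (auto simp: pure_def top_part_def)

lemma gadget_unit:
  assumes v: "v \<in> carrier_vec N" and a: "a < N" and b: "b < N"
  shows "gadget v (unit_vec N a) (unit_vec N b) =
    (\<Sum>x<K. \<Sum>r<R (cl x). if p (cl x) r = a \<and> q x r = b then v $ x else 0)"
  unfolding gadget_def using a b
  by (intro sum.cong refl) (auto simp: p_less q_less)

lemma gadget_unit_pq:
  assumes "v \<in> carrier_vec N" "x < K" "y < K" "r < R (cl x)" "s < R (cl y)"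
  shows "gadget v (unit_vec N (p (cl x) r)) (unit_vec N (q y s)) =
    (if cl x = cl y \<and> r = s then v $ y else 0)"
proof -
  have "gadget v (unit_vec N (p (cl x) r)) (unit_vec N (q y s)) =
    (\<Sum>z<K. \<Sum>t<R (cl z). if p (cl z) t = p (cl x) r \<and> q z t = q y s then v $ z else 0)"
    using assms by (intro gadget_unit) (auto simp: p_less q_less)
  also have "\<dots> = (\<Sum>z<K. \<Sum>t<R (cl z). if z = y \<and> t = s then if cl x = cl y \<and> r = s then v $ y else 0 else 0)"
    using assms by (intro sum.cong refl) (auto simp: p_inj q_inj)
  also have "\<dots> = (\<Sum>z<K. if z = y then if cl x = cl y \<and> r = s then v $ y else 0 else 0)"
    using assms by (intro sum.cong refl) (auto simp: sum.delta)
  also have "\<dots> = (if cl x = cl y \<and> r = s then v $ y else 0)"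
    using assms by (simp add: sum.delta)
  finally show ?thesis .
qed

lemma gadget_unit_not_p:
  assumes "v \<in> carrier_vec N" "a < N" "b < N" "\<And>x r. x < K \<Longrightarrow> r < R (cl x) \<Longrightarrow> a \<noteq> p (cl x) r"
  shows "gadget v (unit_vec N a) (unit_vec N b) = 0"
  unfolding gadget_unit[OF assms(1-3)] using assms(4) by (fastforce intro!: sum.neutral)

lemma gadget_unit_not_q:
  assumes "v \<in> carrier_vec N" "a < N" "b < N" "\<And>x r. x < K \<Longrightarrow> r < R (cl x) \<Longrightarrow> b \<noteq> q x r"
  shows "gadget v (unit_vec N a) (unit_vec N b) = 0"
  unfolding gadget_unit[OF assms(1-3)] using assms(4) by (fastforce intro!: sum.neutral)

lemma unit_p_deep: "x < K \<Longrightarrow> r < R (cl x) \<Longrightarrow> unit_vec N (p (cl x) r) \<in> deep"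
  and unit_q_deep: "x < K \<Longrightarrow> r < R (cl x) \<Longrightarrow> unit_vec N (q x r) \<in> deep"
  using K_le p_ge[of x r] q_ge[of x r] p_less[of x r] q_less[of x r] by (auto simp: deep_def)

text \<open>Testing against the basis vectors of the \<open>P\<close> and \<open>Q\<close>
  coordinates attached to the chosen \<open>x\<close> exhibits a diagonal matrix with entries
  \<open>v $ x\<close> and \<open>\<epsilon> * v $ x\<close>. Distinct labels in \<open>X\<close>
  keep the \<open>P\<close> coordinates of different \<open>x\<close> apart.\<close>

lemma rank_pairing_ge:
  assumes rank: "rank_le k deep (pairing v)" and v: "v \<in> carrier_vec N"
    and X: "X \<subseteq> {..<K}" "inj_on cl X" "\<And>x. x \<in> X \<Longrightarrow> v $ x \<noteq> 0"
  shows "(\<Sum>x\<in>X. 2 * R (cl x)) \<le> k"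
proof -
  \<comment> \<open>The boolean selects the block \<open>P\<close> against \<open>Q\<close> or the
    block \<open>Q\<close> against \<open>P\<close>, whence the factor 2.\<close>
  define S where "S = Sigma X (\<lambda>x. {..<R (cl x)} \<times> (UNIV :: bool set))"
  define a where "a = (\<lambda>(x, r, b). unit_vec N (if b then p (cl x) r else q x r) :: 'a vec)"
  define a' where "a' = (\<lambda>(x, r, b). unit_vec N (if b then q x r else p (cl x) r) :: 'a vec)"
  have fin: "finite X" using X(1) finite_subset by blast
  have XK: "x < K" if "x \<in> X" for x using X(1) that by auto
  have pp: "gadget v (unit_vec N (p (cl x) r)) (unit_vec N (p (cl y) s)) = 0"
    if "x \<in> X" "y \<in> X" "r < R (cl x)" "s < R (cl y)" for x y r s
    using that XK by (intro gadget_unit_not_q v p_less p_neq_q) auto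
  have qq: "gadget v (unit_vec N (q x r)) (unit_vec N c) = 0"
    if "x \<in> X" "r < R (cl x)" "c < N" for x r c
    using that XK p_neq_q by (intro gadget_unit_not_p v q_less) (auto simp: eq_commute)
  have pq: "gadget v (unit_vec N (p (cl x) r)) (unit_vec N (q y s)) = (if x = y \<and> r = s then v $ y else 0)"
    if "x \<in> X" "y \<in> X" "r < R (cl x)" "s < R (cl y)" for x y r s
    using that XK inj_onD[OF X(2), of x y] by (subst gadget_unit_pq) (auto simp: v)
  have val: "pairing v (a s) (a' t) = (if s = t then if snd (snd s) then v $ fst s else \<epsilon> * v $ fst s else 0)"
    if st: "s \<in> S" "t \<in> S" for s t
  proof -
    obtain x r b y r' b' where [simp]: "s = (x, r, b)" "t = (y, r', b')" by (metis surj_pair)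
    have xy: "x \<in> X" "y \<in> X" "r < R (cl x)" "r' < R (cl y)" using st by (auto simp: S_def)
    note lt = p_less[OF XK[OF xy(1)] xy(3)] p_less[OF XK[OF xy(2)] xy(4)]
      q_less[OF XK[OF xy(1)] xy(3)] q_less[OF XK[OF xy(2)] xy(4)]
    show ?thesis
      using xy lt by (cases b; cases b') (auto simp: pairing_def a_def a'_def pp qq pq)
  qed
  have "card S \<le> k"
  proof (rule rank_le_card_diagonal[OF rank, where x = a and y = a'])
    show "finite S" using fin by (auto simp: S_def)
    fix s assume s: "s \<in> S"
    show "a s \<in> deep \<and> a' s \<in> deep"
      using s XK by (auto simp: a_def a'_def S_def unit_p_deep unit_q_deep)
    show "pairing v (a s) (a' s) \<noteq> 0" using s X(3) eps by (auto simp: val S_def)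
  qed (simp add: val)
  moreover have "card S = (\<Sum>x\<in>X. 2 * R (cl x))"
    unfolding S_def using fin by (simp add: card_cartesian_product mult.commute)
  ultimately show ?thesis by simp
qed

text \<open>\<open>gform T d\<close> vanishes on flat times flat and on D times D. Each of the two
  mixed blocks factors through the \<open>K\<close> top coordinates.\<close>

lemma rank_gform_deep_le:
  assumes T: "top_form T" and d: "d \<in> deep"
  shows "rank_le (K + K) (carrier_vec N) (gform T d)"
proof (rule rank_le_add)
  fix v w :: "'a vec" assume v: "v \<in> carrier_vec N" and w: "w \<in> carrier_vec N"
  let ?F = "gform T d"
  note tri = trilinear_form_gform[OF T]
  note add = trilinear_form_add_left[OF tri]
  note dc = deepD[OF d]
  have "?F v w = ?F (top_part v + deep_part v) (top_part w + deep_part w)"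
    by (simp add: top_part_add_deep_part v w)
  also have "\<dots> = ?F (top_part v) (deep_part w) + ?F (deep_part v) (top_part w)"
    using gform_flat_flat_deep(3)[OF T top_part_flat top_part_flat d]
      gform_deep(1)[OF T dc deep_part_deep deep_part_deep] pairing_deep[OF d] dc
    by (simp add: add)
  also have "?F (top_part v) (deep_part w) = (\<Sum>x<N. top_part v $ x * ?F (unit_vec N x) (deep_part w))"
    by (rule linear_form_expand[OF trilinear_form_linear(2)[OF tri]]) (use dc in auto)
  also have "\<dots> = (\<Sum>x<K. v $ x * ?F (unit_vec N x) (deep_part w))"
    using K_le by (intro sum.mono_neutral_cong_right) (auto simp: top_part_def)
  also have "?F (deep_part v) (top_part w) = (\<Sum>x<N. top_part w $ x * ?F (deep_part v) (unit_vec N x))"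
    by (rule linear_form_expand[OF trilinear_form_linear(3)[OF tri]]) (use dc in auto)
  also have "\<dots> = (\<Sum>x<K. w $ x * ?F (deep_part v) (unit_vec N x))"
    using K_le by (intro sum.mono_neutral_cong_right) (auto simp: top_part_def)
  finally show "?F v w = (\<Sum>x<K. v $ x * ?F (unit_vec N x) (deep_part w))
      + (\<Sum>x<K. ?F (deep_part v) (unit_vec N x) * w $ x)"
    by (simp add: mult.commute)
qed

lemma gadget_pure:
  assumes "v \<in> pure i"
  shows "gadget v d d' = (\<Sum>r<R i. d $ p i r * (\<Sum>x | x < K \<and> cl x = i. v $ x * d' $ q x r))"
proof -
  have "gadget v d d' = (\<Sum>x | x < K \<and> cl x = i. \<Sum>r<R i. d $ p i r * (v $ x * d' $ q x r))"
    unfolding gadget_def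
  proof (intro sum.mono_neutral_cong_right ballI)
    fix x assume "x \<in> {..<K} - {x. x < K \<and> cl x = i}"
    then have "v $ x = 0" using assms by (auto simp: pure_def)
    then show "(\<Sum>r<R (cl x). 1 * v $ x * d $ p (cl x) r * d' $ q x r) = 0" by simp
  qed (auto simp: mult_ac)
  also have "\<dots> = (\<Sum>r<R i. \<Sum>x | x < K \<and> cl x = i. d $ p i r * (v $ x * d' $ q x r))"
    by (rule sum.swap)
  finally show ?thesis by (simp add: sum_distrib_left)
qed

text \<open>Both terms of \<open>pairing v\<close> factor through the \<open>R i\<close> coordinates
  of \<open>P_i\<close>, however large \<open>E_i\<close> is. With \<open>rank_pairing_ge\<close>,
  the rank is exactly \<open>2 * R i\<close> once \<open>v\<close> lies outside D.\<close>

lemma rank_pairing_pure_le: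
  assumes "v \<in> pure i"
  shows "rank_le (R i + R i) deep (pairing v)"
proof (rule rank_le_add)
  fix d d' :: "'a vec"
  let ?B = "\<lambda>r d. \<Sum>x | x < K \<and> cl x = i. v $ x * d $ q x r"
  show "pairing v d d' = (\<Sum>r<R i. d $ p i r * ?B r d') + (\<Sum>r<R i. (\<epsilon> * ?B r d) * d' $ p i r)"
    unfolding pairing_def gadget_pure[OF assms] by (simp add: sum_distrib_left mult_ac)
qed

text \<open>By \<open>gadget_pure\<close>, a \<open>v\<close> of label \<open>i\<close> makes
  \<open>pairing v\<close> blind to all coordinates outside \<open>P_i\<close> and
  \<open>Q_i\<close>. This and the next lemma serve to separate labels in
  \<open>pairing_image_eq_0\<close>.\<close>

lemma pairing_pure_eq_0:
  assumes "v \<in> pure i"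
    and "\<And>r. r < R i \<Longrightarrow> d $ p i r = 0"
    and "\<And>x r. x < K \<Longrightarrow> cl x = i \<Longrightarrow> r < R i \<Longrightarrow> d $ q x r = 0"
  shows "pairing v d d' = 0" "pairing v d' d = 0"
  using assms(2,3) by (auto simp: pairing_def gadget_pure[OF assms(1)] intro!: sum.neutral)

lemma pairing_pure_cong:
  assumes "v \<in> pure i"
    and "\<And>r. r < R i \<Longrightarrow> d $ p i r = c $ p i r"
    and "\<And>x r. x < K \<Longrightarrow> cl x = i \<Longrightarrow> r < R i \<Longrightarrow> d $ q x r = c $ q x r"
  shows "pairing v d' d = pairing v d' c"
  using assms(2,3) by (auto simp: pairing_def gadget_pure[OF assms(1)] intro!: sum.cong)

end

section \<open>Isomorphisms of gadget forms respect the labels\<close>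

locale gadget_isomorphism = rank_gadget N K M cl R p q \<epsilon>
  for N K M :: nat and cl R p q and \<epsilon> :: "'a::field" +
  fixes T T' :: "'a form3" and f g :: "'a vec \<Rightarrow> 'a vec"
  assumes T: "top_form T" and T': "top_form T'"
    and f: "linear_endo N f" and g: "linear_endo N g"
    and gf: "v \<in> carrier_vec N \<Longrightarrow> g (f v) = v" and fg: "v \<in> carrier_vec N \<Longrightarrow> f (g v) = v"
    and iso: "u \<in> carrier_vec N \<Longrightarrow> v \<in> carrier_vec N \<Longrightarrow> w \<in> carrier_vec N \<Longrightarrow>
      gform T u v w = gform T' (f u) (f v) (f w)"
begin

lemma f_carrier[simp]: "v \<in> carrier_vec N \<Longrightarrow> f v \<in> carrier_vec N"
  and g_carrier[simp]: "v \<in> carrier_vec N \<Longrightarrow> g v \<in> carrier_vec N"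
  using f g by (auto simp: linear_endo_def)

lemma inverse: "gadget_isomorphism N K M cl R p q \<epsilon> T' T g f"
  by unfold_locales (use T T' f g gf fg iso in simp_all)

text \<open>The form at \<open>f v\<close> has the same rank as the form at \<open>v\<close>, hence
  at most \<open>2 * K\<close>, whereas a nonzero top coordinate of \<open>f v\<close> would force
  at least \<open>2 * M\<close>.\<close>

lemma f_deep:
  assumes v: "v \<in> deep"
  shows "f v \<in> deep"
proof (rule ccontr)
  assume "f v \<notin> deep"
  then obtain x where x: "x < K" "f v $ x \<noteq> 0" using deepD[OF v] by (auto simp: deep_def)
  \<comment> \<open>The factorisation is needed on the whole space, as \<open>g d\<close> is not yet
    known to lie in D.\<close>
  obtain A B where "\<And>w w'. w \<in> carrier_vec N \<Longrightarrow> w' \<in> carrier_vec N \<Longrightarrow>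
      gform T v w w' = (\<Sum>l<K+K. A l w * B l w')"
    using rank_gform_deep_le[OF T v] unfolding rank_le_def by blast
  moreover have "pairing (f v) d d' = gform T v (g d) (g d')" if "d \<in> deep" "d' \<in> deep" for d d'
    unfolding iso[OF deepD[OF v] g_carrier[OF deepD[OF that(1)]] g_carrier[OF deepD[OF that(2)]]]
      fg[OF deepD[OF that(1)]] fg[OF deepD[OF that(2)]]
    by (rule gform_deep(1)[OF T' f_carrier[OF deepD[OF v]] that, symmetric])
  ultimately have *: "pairing (f v) d d' = (\<Sum>l<K+K. A l (g d) * B l (g d'))" if "d \<in> deep" "d' \<in> deep" for d d'
    using that by (simp add: deepD)
  then have "rank_le (K + K) deep (pairing (f v))"
    unfolding rank_le_def by (intro exI[of _ "\<lambda>l d. A l (g d)"] exI[of _ "\<lambda>l d. B l (g d)"] ballI *)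
  from rank_pairing_ge[OF this, of "{x}"] show False
    using x deepD[OF v] R_bounds(1)[OF x(1)] K_less by simp
qed

lemma f_deep_iff: "v \<in> carrier_vec N \<Longrightarrow> f v \<in> deep \<longleftrightarrow> v \<in> deep"
  using f_deep gadget_isomorphism.f_deep[OF inverse, of "f v"] gf by auto

text \<open>Since D is now known to be preserved, the rank on D alone is an invariant; this is the
  one that detects labels.\<close>

lemma rank_pairing_image:
  assumes "v \<in> carrier_vec N" "rank_le k deep (pairing v)"
  shows "rank_le k deep (pairing (f v))"
proof -
  obtain A B where "\<And>w w'. w \<in> deep \<Longrightarrow> w' \<in> deep \<Longrightarrow> pairing v w w' = (\<Sum>l<k. A l w * B l w')"
    using assms(2) unfolding rank_le_def by blast
  moreover have "pairing (f v) d d' = pairing v (g d) (g d')" if d: "d \<in> deep" "d' \<in> deep" for d d'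
  proof -
    note gd = gadget_isomorphism.f_deep[OF inverse d(1)] gadget_isomorphism.f_deep[OF inverse d(2)]
    have "pairing v (g d) (g d') = gform T v (g d) (g d')" by (rule gform_deep(1)[OF T assms(1) gd, symmetric])
    also have "\<dots> = gform T' (f v) d d'"
      unfolding iso[OF assms(1) deepD[OF gd(1)] deepD[OF gd(2)]] fg[OF deepD[OF d(1)]] fg[OF deepD[OF d(2)]] ..
    also have "\<dots> = pairing (f v) d d'" by (rule gform_deep(1)[OF T' f_carrier[OF assms(1)] d])
    finally show ?thesis by simp
  qed
  ultimately have *: "pairing (f v) d d' = (\<Sum>l<k. A l (g d) * B l (g d'))" if "d \<in> deep" "d' \<in> deep" for d d'
    using that gadget_isomorphism.f_deep[OF inverse] by simp
  then show ?thesis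
    unfolding rank_le_def by (intro exI[of _ "\<lambda>l d. A l (g d)"] exI[of _ "\<lambda>l d. B l (g d)"] ballI *)
qed

text \<open>Two labels in \<open>f v\<close> would give rank at least \<open>4 * M\<close>, which
  exceeds \<open>2 * R i\<close>. For the single remaining label the same comparison bounds its
  \<open>R\<close>.\<close>

lemma f_pure_weak:
  assumes v: "v \<in> pure i" and nd: "v \<notin> deep"
  obtains y where "y < K" "R (cl y) \<le> R i" "f v \<in> pure (cl y)"
proof -
  have vc: "v \<in> carrier_vec N" using pureD[OF v] .
  obtain x where x: "x < K" "v $ x \<noteq> 0" using nd vc by (auto simp: deep_def)
  then have i: "i = cl x" using v by (auto simp: pure_def)
  note ge = rank_pairing_ge[OF rank_pairing_image[OF vc rank_pairing_pure_le[OF v]] f_carrier[OF vc]]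
  obtain y where y: "y < K" "f v $ y \<noteq> 0" using nd f_deep_iff[OF vc] vc by (auto simp: deep_def)
  have "cl z = cl y" if z: "z < K" "f v $ z \<noteq> 0" for z
  proof (rule ccontr)
    assume ne: "cl z \<noteq> cl y"
    then have "z \<noteq> y" by auto
    then have "2 * R (cl z) + 2 * R (cl y) \<le> R i + R i" using ge[of "{z, y}"] y z ne by auto
    then show False using R_bounds(1)[OF y(1)] R_bounds(1)[OF z(1)] R_bounds(2)[OF x(1)] i by simp
  qed
  then have "f v \<in> pure (cl y)" using vc by (auto simp: pure_def)
  moreover have "R (cl y) \<le> R i" using ge[of "{y}"] y by simp
  ultimately show ?thesis using that y by blast
qed

text \<open>Going forth with \<open>f\<close> and back with \<open>g\<close> gives
  \<open>R (cl z) \<le> R (cl y) \<le> R i\<close>. As \<open>g (f v)\<close> is \<open>v\<close>,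
  the label of \<open>z\<close> is \<open>i\<close> again, so equality holds and
  \<open>R_inj\<close> identifies the label.\<close>

lemma f_pure:
  assumes v: "v \<in> pure i"
  shows "f v \<in> pure i"
proof (cases "v \<in> deep")
  case True
  then show ?thesis using f_deep by (auto simp: deep_def pure_def)
next
  case False
  have vc: "v \<in> carrier_vec N" using pureD[OF v] .
  obtain x where x: "x < K" "v $ x \<noteq> 0" using False vc by (auto simp: deep_def)
  then have i: "i = cl x" using v by (auto simp: pure_def)
  obtain y where y: "y < K" "R (cl y) \<le> R i" "f v \<in> pure (cl y)" using f_pure_weak[OF v False] .
  obtain z where z: "z < K" "R (cl z) \<le> R (cl y)" "g (f v) \<in> pure (cl z)"
    using gadget_isomorphism.f_pure_weak[OF inverse y(3)] False f_deep_iff[OF vc] by blast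
  have "cl z = cl x" using z(3) x gf[OF vc] by (auto simp: pure_def)
  then have "R (cl y) = R i" using y z i by simp
  then have "cl y = i" using R_inj[OF y(1) x(1)] i by simp
  then show ?thesis using y by simp
qed

text \<open>\<open>gform T e e'\<close> vanishes on D; its image, split into top and D parts, yields
  \<open>anti\<close>. There the left side reads only the coordinates of \<open>c\<close> with label
  \<open>i\<close>, the right side only those with label \<open>j\<close>. Replacing
  \<open>d\<close> by its part \<open>c\<close> with label \<open>i\<close> keeps the left side and
  kills the right one.\<close>

lemma pairing_image_eq_0:
  assumes e: "e \<in> pure i" "e \<in> flat" and e': "e' \<in> pure j" "e' \<in> flat" and ij: "i \<noteq> j" and d: "d \<in> deep"
  shows "pairing (top_part (f e)) (deep_part (f e')) d = 0"
proof -
  let ?a = "top_part (f e)" and ?b = "deep_part (f e)" and ?a' = "top_part (f e')" and ?b' = "deep_part (f e')"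
  note add = trilinear_form_add_left[OF trilinear_form_gform[OF T']]
  have ec: "e \<in> carrier_vec N" "e' \<in> carrier_vec N" using pureD e e' by auto
  have anti: "pairing ?a ?b' c = - pairing ?a' c ?b" if c: "c \<in> deep" for c
  proof -
    have gc: "g c \<in> deep" using gadget_isomorphism.f_deep[OF inverse c] .
    have "0 = gform T e e' (g c)" using gform_flat_flat_deep(1)[OF T e(2) e'(2) gc] by simp
    also have "\<dots> = gform T' (?a + ?b) (?a' + ?b') c"
      unfolding iso[OF ec deepD[OF gc]] fg[OF deepD[OF c]]
      by (simp only: top_part_add_deep_part f_carrier ec)
    also have "\<dots> = gform T' ?a ?a' c + gform T' ?a ?b' c + gform T' ?b ?a' c + gform T' ?b ?b' c"
      using deepD[OF c] by (simp add: add)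
    also have "\<dots> = pairing ?a ?b' c + pairing ?a' c ?b"
      by (simp add: gform_flat_flat_deep[OF T'] gform_deep[OF T'] pairing_deep
          top_part_flat deep_part_deep c)
    finally show ?thesis by (simp add: eq_neg_iff_add_eq_0)
  qed
  define I where "I = {p i r | r. r < R i} \<union> {q x r | x r. x < K \<and> cl x = i \<and> r < R i}"
  define c where "c = vec N (\<lambda>z. if z \<in> I then d $ z else 0)"
  have pa: "?a \<in> pure i" "?a' \<in> pure j" using f_pure e e' pure_top_part by auto
  have c: "c \<in> deep" using d K_le by (auto simp: c_def deep_def)
  show ?thesis
  proof (cases "(\<exists>x<K. cl x = i) \<and> (\<exists>y<K. cl y = j)")
    case True
    then obtain x y where x: "x < K" "cl x = i" and y: "y < K" "cl y = j" by auto
    have cI: "c $ z = d $ z" if "z \<in> I" "z < N" for z using that by (simp add: c_def)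
    have c0: "c $ z = 0" if "z \<notin> I" "z < N" for z using that by (simp add: c_def)
    have "pairing ?a ?b' d = pairing ?a ?b' c"
    proof (rule pairing_pure_cong[OF pa(1)])
      show "d $ p i r = c $ p i r" if "r < R i" for r
        using that p_less[OF x(1)] x(2) by (intro cI[symmetric]) (auto simp: I_def)
      show "d $ q z r = c $ q z r" if "z < K" "cl z = i" "r < R i" for z r
        using that q_less[of z r] by (intro cI[symmetric]) (auto simp: I_def)
    qed
    also have "\<dots> = - pairing ?a' c ?b" using anti[OF c] .
    also have "pairing ?a' c ?b = 0"
    proof (rule pairing_pure_eq_0(1)[OF pa(2)])
      fix r assume r: "r < R j"
      have "p j r \<notin> I"
      proof
        assume "p j r \<in> I"
        then consider s where "s < R i" "p j r = p i s" | z s where "z < K" "cl z = i" "s < R i" "p j r = q z s"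
          unfolding I_def by blast
        then show False
        proof cases
          case (1 s)
          then show False using p_inj[OF y(1) x(1), of r s] x(2) y(2) r ij by simp
        next
          case (2 z s)
          then show False using p_neq_q[OF y(1), of z r s] y(2) r by simp
        qed
      qed
      then show "c $ p j r = 0" using p_less[OF y(1)] y(2) r by (intro c0) auto
      fix z assume z: "z < K" "cl z = j"
      have "q z r \<notin> I"
      proof
        assume "q z r \<in> I"
        then consider s where "s < R i" "q z r = p i s" | y s where "y < K" "cl y = i" "s < R i" "q z r = q y s"
          unfolding I_def by blast
        then show False
        proof cases
          case (1 s)
          then show False using p_neq_q[OF x(1) z(1), of s r] x(2) z(2) r by simp
        next
          case (2 y s)
          then show False using q_inj[OF z(1), of y r s] z(2) r ij by auto
        qed
      qed
      then show "c $ q z r = 0" using q_less[OF z(1)] z(2) r by (intro c0) auto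
    qed
    finally show ?thesis by simp
  next
    \<comment> \<open>The index bounds of the locale concern only labels that occur. For a label
      without coordinates the top part is itself in D.\<close>
    case False
    then consider "\<forall>x<K. cl x \<noteq> i" | "\<forall>y<K. cl y \<noteq> j" by blast
    then show ?thesis
    proof cases
      case 1
      then have "?a \<in> deep" using pa by (auto simp: pure_def deep_def)
      then show ?thesis by (rule pairing_deep)
    next
      case 2
      then have "?a' \<in> deep" using pa by (auto simp: pure_def deep_def)
      then show ?thesis using anti[OF d] by (simp add: pairing_deep)
    qed
  qed
qed

text \<open>Of the eight terms of the expansion, those with one D part have two flat arguments and
  vanish, the one with three vanishes since \<open>pairing\<close> does on D, and those with two are
  pairings that vanish by \<open>pairing_image_eq_0\<close>.\<close>

theorem top_form_image:
  assumes e: "e \<in> pure i" "e \<in> flat" "e' \<in> pure j" "e' \<in> flat" "e'' \<in> pure k" "e'' \<in> flat"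
    and ijk: "i \<noteq> j" "j \<noteq> k" "k \<noteq> i"
  shows "sym3 \<epsilon> T e e' e'' = sym3 \<epsilon> T' (top_part (f e)) (top_part (f e')) (top_part (f e''))"
proof -
  let ?a = "top_part (f e)" and ?b = "deep_part (f e)"
  let ?a' = "top_part (f e')" and ?b' = "deep_part (f e')"
  let ?a'' = "top_part (f e'')" and ?b'' = "deep_part (f e'')"
  note add = trilinear_form_add_left[OF trilinear_form_gform[OF T']]
  have ec: "e \<in> carrier_vec N" "e' \<in> carrier_vec N" "e'' \<in> carrier_vec N" using pureD e by auto
  have "sym3 \<epsilon> T e e' e'' = gform T e e' e''" by (rule gform_flat[OF e(2,4,6), symmetric])
  also have "\<dots> = gform T' (?a + ?b) (?a' + ?b') (?a'' + ?b'')"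
    unfolding iso[OF ec] by (simp only: top_part_add_deep_part f_carrier ec)
  also have "\<dots> =
      gform T' ?a ?a' ?a'' + gform T' ?a ?a' ?b'' + gform T' ?a ?b' ?a'' + gform T' ?a ?b' ?b'' +
      (gform T' ?b ?a' ?a'' + gform T' ?b ?a' ?b'' + gform T' ?b ?b' ?a'' + gform T' ?b ?b' ?b'')"
    by (simp add: add)
  also have "\<dots> = gform T' ?a ?a' ?a'' + pairing ?a ?b' ?b'' + pairing ?a' ?b'' ?b + pairing ?a'' ?b ?b'"
    by (simp add: gform_flat_flat_deep[OF T'] gform_deep[OF T'] pairing_deep
        top_part_flat deep_part_deep)
  also have "\<dots> = gform T' ?a ?a' ?a''"
    using pairing_image_eq_0[OF e(1-4) ijk(1) deep_part_deep]
      pairing_image_eq_0[OF e(3-6) ijk(2) deep_part_deep]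
      pairing_image_eq_0[OF e(5,6) e(1,2) ijk(3) deep_part_deep] by simp
  finally show ?thesis using gform_flat[OF top_part_flat top_part_flat top_part_flat] by simp
qed

end

section \<open>The reduction on forms\<close>

text \<open>
  The seven summands occupy blocks of equal width; the \<open>i\<close>-th copy of \<open>F^n\<close> is the start of block
  \<open>i < 3\<close>, the dual copy that of block 3, and the scalars are the first coordinates of blocks 4, 5, 6.
  Coordinates that do not occur in the form are harmless: those of the seven blocks are labelled like
  the others, and those of the gadget lie in the subspace that an isomorphism preserves anyway.
\<close>

definition width :: "nat \<Rightarrow> nat" where "width n = n + 1"
definition top_dim :: "nat \<Rightarrow> nat" where "top_dim n = 7 * width n"
definition stride :: "nat \<Rightarrow> nat" where "stride n = top_dim n + 8"
definition out_dim :: "nat \<Rightarrow> nat" where "out_dim n = top_dim n + 7 * stride n + top_dim n * stride n"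
definition p_index :: "nat \<Rightarrow> nat \<Rightarrow> nat \<Rightarrow> nat" where "p_index n i r = top_dim n + i * stride n + r"
definition q_index :: "nat \<Rightarrow> nat \<Rightarrow> nat \<Rightarrow> nat" where
  "q_index n x r = top_dim n + 7 * stride n + x * stride n + r"
text \<open>Here \<open>M\<close> is \<open>top_dim n + 1\<close>. With seven labels the value stays
  below \<open>2 * M\<close>, as \<open>top_dim n\<close> is at least 7, and below
  \<open>stride n\<close>, which is \<open>M + 7\<close>, so that \<open>P\<close> and
  \<open>Q\<close> coordinates can be numbered by digits in base \<open>stride n\<close>.\<close>

definition label_rank :: "nat \<Rightarrow> nat \<Rightarrow> nat" where "label_rank n i = top_dim n + 1 + i"

lemma class_less: "x < top_dim n \<Longrightarrow> x div width n < 7"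
  unfolding top_dim_def by (rule less_mult_imp_div_less)

lemma label_rank_less: "i < 7 \<Longrightarrow> label_rank n i < stride n"
  by (simp add: label_rank_def stride_def)

lemma mult_add_less: "(a::nat) < c \<Longrightarrow> b < d \<Longrightarrow> a * d + b < c * d"
proof -
  assume "a < c" "b < d"
  then have "a * d + b < Suc a * d" by simp
  also have "\<dots> \<le> c * d" using \<open>a < c\<close> by (intro mult_le_mono1) simp
  finally show ?thesis .
qed

text \<open>The extra coordinate of each block ensures that a block has a first coordinate, and that
  labels are quotients by a positive number, even for \<open>n = 0\<close>.\<close>

lemma width_pos[simp]: "0 < width n" and less_width[simp]: "a < width n \<longleftrightarrow> a \<le> n"
  by (auto simp: width_def)

lemma mult_add_eq_iff:
  assumes "(r::nat) < d" "s < d"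
  shows "a * d + r = b * d + s \<longleftrightarrow> a = b \<and> r = s"
proof
  assume *: "a * d + r = b * d + s"
  have "(a * d + r) div d = a" "(b * d + s) div d = b" "(a * d + r) mod d = r" "(b * d + s) mod d = s"
    using assms by auto
  then show "a = b \<and> r = s" using * by metis
qed auto

lemma p_index_less: "i < 7 \<Longrightarrow> r < stride n \<Longrightarrow> p_index n i r < top_dim n + 7 * stride n"
  using mult_add_less[of i 7 r "stride n"] by (simp add: p_index_def)

lemma q_index_less: "x < top_dim n \<Longrightarrow> r < stride n \<Longrightarrow> q_index n x r < out_dim n"
  using mult_add_less[of x "top_dim n" r "stride n"] by (simp add: q_index_def out_dim_def)

lemma index_cases:
  assumes "z < out_dim n"
  obtains "z < top_dim n" | i r where "i < 7" "r < stride n" "z = p_index n i r"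
  | x r where "x < top_dim n" "r < stride n" "z = q_index n x r"
proof -
  have S: "stride n > 0" by (simp add: stride_def)
  consider "z < top_dim n" | "top_dim n \<le> z" "z < top_dim n + 7 * stride n" | "top_dim n + 7 * stride n \<le> z"
    by linarith
  then show ?thesis
  proof cases
    case 2
    have "z - top_dim n < 7 * stride n" using 2 by linarith
    then have "(z - top_dim n) div stride n < 7" by (rule less_mult_imp_div_less)
    moreover have "z = p_index n ((z - top_dim n) div stride n) ((z - top_dim n) mod stride n)"
      using 2 by (simp add: p_index_def)
    ultimately show ?thesis using that(2) S mod_less_divisor by blast
  next
    case 3
    let ?y = "z - (top_dim n + 7 * stride n)"
    have "?y < top_dim n * stride n" using assms 3 by (simp add: out_dim_def)
    then have "?y div stride n < top_dim n" by (rule less_mult_imp_div_less)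
    moreover have "z = q_index n (?y div stride n) (?y mod stride n)"
      using 3 by (simp add: q_index_def)
    ultimately show ?thesis using that(3) S mod_less_divisor by blast
  qed (use that in auto)
qed

lemma rank_gadget_label:
  assumes "\<epsilon> \<noteq> (0 :: 'a::field)"
  shows "rank_gadget (out_dim n) (top_dim n) (top_dim n + 1) (\<lambda>x. x div width n) (label_rank n)
    (p_index n) (q_index n) \<epsilon>"
proof
  fix x y r s :: nat
  assume x: "x < top_dim n"
  let ?R = "\<lambda>x. label_rank n (x div width n)"
  note cx = class_less[OF x]
  show "top_dim n + 1 \<le> ?R x" by (simp add: label_rank_def)
  show "?R x < 2 * (top_dim n + 1)" using cx by (simp add: label_rank_def top_dim_def width_def)
  show "x div width n = y div width n" if "?R x = ?R y" using that by (simp add: label_rank_def)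
  assume r: "r < ?R x"
  then have rS: "r < stride n" using label_rank_less[OF cx, of n] by simp
  show "top_dim n \<le> p_index n (x div width n) r" "top_dim n \<le> q_index n x r"
    by (simp_all add: p_index_def q_index_def)
  note pl = p_index_less[OF cx rS]
  show "p_index n (x div width n) r < out_dim n" using pl by (simp add: out_dim_def)
  show "q_index n x r < out_dim n" by (rule q_index_less[OF x rS])
  assume y: "y < top_dim n" and s: "s < ?R y"
  have sS: "s < stride n" using s label_rank_less[OF class_less[OF y], of n] by simp
  show "(p_index n (x div width n) r = p_index n (y div width n) s) =
      (x div width n = y div width n \<and> r = s)"
    using mult_add_eq_iff[OF rS sS] by (simp add: p_index_def)
  show "(q_index n x r = q_index n y s) = (x = y \<and> r = s)"
    using mult_add_eq_iff[OF rS sS] by (simp add: q_index_def)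
  show "p_index n (x div width n) r \<noteq> q_index n y s"
    using pl by (simp add: q_index_def)
qed (use assms in \<open>auto simp: out_dim_def\<close>)

section \<open>The form on the seven summands\<close>

definition block :: "nat \<Rightarrow> nat \<Rightarrow> 'a::field vec \<Rightarrow> 'a vec" where
  "block n i v = vec n (\<lambda>a. v $ (i * width n + a))"

definition block_inc :: "nat \<Rightarrow> nat \<Rightarrow> 'a::field vec \<Rightarrow> 'a vec" where
  "block_inc n i v = vec (out_dim n) (\<lambda>z. if z div width n = i \<and> z mod width n < n then v $ (z mod width n) else 0)"

definition dot :: "nat \<Rightarrow> 'a::field vec \<Rightarrow> 'a vec \<Rightarrow> 'a" where
  "dot n u v = (\<Sum>a<n. u $ a * v $ a)"

definition base_form :: "nat \<Rightarrow> 'a::field form3 \<Rightarrow> 'a form3" where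
  "base_form n \<phi> u v w = \<phi> (block n 0 u) (block n 1 v) (block n 2 w)
    + (\<Sum>i<3. dot n (block n i u) (block n 3 v) * w $ ((4 + i) * width n))
    + u $ (4 * width n) * v $ (5 * width n) * w $ (6 * width n)"

text \<open>The gadget for the concrete numbering, free of the locale parameters so that
  \<open>out_form\<close> is defined for every \<open>\<epsilon>\<close>.\<close>

definition label_form :: "nat \<Rightarrow> 'a::field form3" where
  "label_form n u v w = (\<Sum>x<top_dim n. \<Sum>r<label_rank n (x div width n).
    u $ x * v $ p_index n (x div width n) r * w $ q_index n x r)"

definition out_form :: "nat \<Rightarrow> 'a::field \<Rightarrow> 'a form3 \<Rightarrow> 'a form3" where
  "out_form n \<epsilon> \<phi> = sym3 \<epsilon> (\<lambda>u v w. base_form n \<phi> u v w + label_form n u v w)"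

lemma block_carrier[simp]: "block n i v \<in> carrier_vec n"
  by (simp add: block_def)

lemma block_inc_carrier[simp]: "block_inc n i v \<in> carrier_vec (out_dim n)"
  by (simp add: block_inc_def)

lemma block_index_less: "i < 7 \<Longrightarrow> a \<le> n \<Longrightarrow> i * width n + a < top_dim n"
  unfolding top_dim_def by (rule mult_add_less) auto

lemma top_dim_le: "top_dim n \<le> out_dim n"
  by (simp add: out_dim_def)

lemma block_index_less': "i < 7 \<Longrightarrow> a \<le> n \<Longrightarrow> i * width n + a < out_dim n"
  using block_index_less top_dim_le less_le_trans by blast

lemma block_start_less: "i < 7 \<Longrightarrow> i * width n < out_dim n"
  using block_index_less'[of i 0 n] by simp

lemma block_add:
  assumes "i < 7" "u \<in> carrier_vec (out_dim n)" "v \<in> carrier_vec (out_dim n)"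
  shows "block n i (u + v) = block n i u + block n i v"
  using assms block_index_less'[OF assms(1)] by (intro eq_vecI) (auto simp: block_def)

lemma block_smult:
  assumes "i < 7" "u \<in> carrier_vec (out_dim n)"
  shows "block n i (c \<cdot>\<^sub>v u) = c \<cdot>\<^sub>v block n i u"
  using assms block_index_less'[OF assms(1)] by (intro eq_vecI) (auto simp: block_def)

lemma block_inc_add: "u \<in> carrier_vec n \<Longrightarrow> v \<in> carrier_vec n \<Longrightarrow>
  block_inc n i (u + v) = block_inc n i u + block_inc n i v"
  by (intro eq_vecI) (auto simp: block_inc_def)

lemma block_inc_smult: "u \<in> carrier_vec n \<Longrightarrow> block_inc n i (c \<cdot>\<^sub>v u) = c \<cdot>\<^sub>v block_inc n i u"
  by (intro eq_vecI) (auto simp: block_inc_def)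

lemma block_block_inc:
  assumes "i < 7" "u \<in> carrier_vec n"
  shows "block n i (block_inc n i u) = u"
proof (rule eq_vecI)
  fix a assume a: "a < dim_vec u"
  then have "(i * width n + a) div width n = i" "(i * width n + a) mod width n = a"
    using assms(2) by (auto)
  then show "block n i (block_inc n i u) $ a = u $ a"
    using a assms block_index_less'[OF assms(1), of a n]
    by (simp add: block_def block_inc_def)
qed (use assms in \<open>auto simp: block_def\<close>)

lemma dot_add: "u \<in> carrier_vec n \<Longrightarrow> u' \<in> carrier_vec n \<Longrightarrow> dot n (u + u') v = dot n u v + dot n u' v"
  "v \<in> carrier_vec n \<Longrightarrow> v' \<in> carrier_vec n \<Longrightarrow> dot n u (v + v') = dot n u v + dot n u v'"
  by (auto simp: dot_def algebra_simps sum.distrib)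

lemma dot_smult: "u \<in> carrier_vec n \<Longrightarrow> dot n (c \<cdot>\<^sub>v u) v = c * dot n u v"
  "v \<in> carrier_vec n \<Longrightarrow> dot n u (c \<cdot>\<^sub>v v) = c * dot n u v"
  by (auto simp: dot_def algebra_simps sum_distrib_left)

lemma dot_unit:
  "a < n \<Longrightarrow> b < n \<Longrightarrow> dot n (unit_vec n a) (unit_vec n b :: 'a::field vec) = (if a = b then 1 else 0)"
proof -
  assume ab: "a < n" "b < n"
  have "dot n (unit_vec n a) (unit_vec n b :: 'a vec) = (\<Sum>c<n. if c = a then if a = b then 1 else 0 else 0)"
    unfolding dot_def using ab by (intro sum.cong) auto
  then show ?thesis using ab by (simp add: sum.delta)
qed

lemma trilinear_form_base_form:
  assumes "trilinear_form n \<phi>"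
  shows "trilinear_form (out_dim n) (base_form n \<phi>)"
proof -
  have lt: "4 * width n < out_dim n" "5 * width n < out_dim n" "6 * width n < out_dim n"
    by (rule block_start_less, simp)+
  have 1: "trilinear_form (out_dim n) (\<lambda>u v w. \<phi> (block n 0 u) (block n 1 v) (block n 2 w))"
    using assms unfolding trilinear_form_def linear_form_def by (simp add: block_add block_smult)
  have 2: "trilinear_form (out_dim n) (\<lambda>u v w. dot n (block n i u) (block n 3 v) * w $ ((4 + i) * width n))"
    if "i < 3" for i
    using that block_start_less[of "4 + i" n] unfolding trilinear_form_def linear_form_def
    by (simp add: block_add block_smult dot_add dot_smult algebra_simps)
  have 3: "trilinear_form (out_dim n) (\<lambda>u v w. 1 * u $ (4 * width n) * v $ (5 * width n) * w $ (6 * width n))"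
    by (rule trilinear_form_monomial[OF lt])
  show ?thesis
    unfolding base_form_def[abs_def]
    using trilinear_form_add[OF trilinear_form_add[OF 1 trilinear_form_sum[of "{..<3}", OF 2]] 3] by simp
qed

lemma block_eq_0:
  assumes "i < 7" "\<And>x. x < top_dim n \<Longrightarrow> x div width n = i \<Longrightarrow> v $ x = 0"
  shows "block n i v = 0\<^sub>v n"
proof (rule eq_vecI)
  fix a assume "a < dim_vec (0\<^sub>v n :: 'a vec)"
  then have a: "a < n" by simp
  then have "(i * width n + a) div width n = i" by (simp)
  then show "block n i v $ a = 0\<^sub>v n $ a"
    using a assms(2)[OF block_index_less[OF assms(1), of a n]] by (simp add: block_def)
qed (auto simp: block_def)

lemma trilinear_form_zero:
  assumes "trilinear_form n \<phi>" "u \<in> carrier_vec n" "v \<in> carrier_vec n"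
  shows "\<phi> (0\<^sub>v n) u v = 0" "\<phi> u (0\<^sub>v n) v = 0" "\<phi> u v (0\<^sub>v n) = 0"
proof -
  have z: "f (0\<^sub>v n) = 0" if "linear_form n f" for f :: "'a vec \<Rightarrow> 'a"
    using linear_form_expand[OF that, of "0\<^sub>v n"] by simp
  show "\<phi> (0\<^sub>v n) u v = 0" "\<phi> u (0\<^sub>v n) v = 0" "\<phi> u v (0\<^sub>v n) = 0"
    using trilinear_form_linear[OF assms] z by (blast, blast, blast)
qed

lemma dot_zero: "dot n (0\<^sub>v n) v = 0" "dot n v (0\<^sub>v n) = 0"
  by (auto simp: dot_def)

section \<open>From an isomorphism of the output forms to one of the input forms\<close>

context
  fixes n :: nat and \<epsilon> :: "'a::field"
  assumes eps: "\<epsilon> \<noteq> 0"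
begin

interpretation rank_gadget "out_dim n" "top_dim n" "top_dim n + 1" "\<lambda>x. x div width n" "label_rank n"
    "p_index n" "q_index n" \<epsilon>
  by (rule rank_gadget_label[OF eps])

lemma gadget_label_form: "gadget = label_form n"
  by (intro ext) (simp add: gadget_def label_form_def)

lemma gform_out_form: "gform (base_form n \<phi>) = out_form n \<epsilon> \<phi>"
  by (simp add: gform_def out_form_def gadget_label_form)

lemma base_form_pure:
  assumes \<phi>: "trilinear_form n \<phi>" and u: "u \<in> pure i" and v: "v \<in> pure j" and w: "w \<in> pure k"
  shows "base_form n \<phi> u v w =
    (if i = 0 \<and> j = 1 \<and> k = 2 then \<phi> (block n 0 u) (block n 1 v) (block n 2 w) else 0)
    + (\<Sum>l<3. if i = l \<and> j = 3 \<and> k = 4 + l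
         then dot n (block n l u) (block n 3 v) * w $ ((4 + l) * width n) else 0)
    + (if i = 4 \<and> j = 5 \<and> k = 6 then u $ (4 * width n) * v $ (5 * width n) * w $ (6 * width n) else 0)"
proof -
  have blk: "block n l v = 0\<^sub>v n" if "v \<in> pure i" "i \<noteq> l" "l < 7" for v i l
    using that by (intro block_eq_0) (auto simp: pure_def)
  have start: "v $ (l * width n) = 0" if "v \<in> pure i" "i \<noteq> l" "l < 7" for v i l
  proof -
    have "l * width n < top_dim n" using block_index_less[OF that(3), of 0] by simp
    moreover have "l * width n div width n = l" by (simp)
    ultimately show ?thesis using that(1,2) unfolding pure_def by blast
  qed
  have 1: "\<phi> (block n 0 u) (block n 1 v) (block n 2 w) = 0" if "\<not> (i = 0 \<and> j = 1 \<and> k = 2)"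
    using that blk[OF u, of 0] blk[OF v, of 1] blk[OF w, of 2] trilinear_form_zero[OF \<phi>] by force
  have 2: "dot n (block n l u) (block n 3 v) * w $ ((4 + l) * width n) = 0"
    if "\<not> (i = l \<and> j = 3 \<and> k = 4 + l)" "l < 3" for l
    using that blk[OF u, of l] blk[OF v, of 3] start[OF w, of "4 + l"] dot_zero by force
  have 3: "u $ (4 * width n) * v $ (5 * width n) * w $ (6 * width n) = 0" if "\<not> (i = 4 \<and> j = 5 \<and> k = 6)"
    using that start[OF u, of 4] start[OF v, of 5] start[OF w, of 6] by force
  show ?thesis
    unfolding base_form_def
    by (intro arg_cong2[of _ _ _ _ "(+)"] sum.cong refl) (use 1 2 3 in auto)
qed

lemma sum_3: "(\<Sum>l<3. h l) = h 0 + h 1 + (h (2::nat) :: 'a)"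
  by (simp add: eval_nat_numeral)

text \<open>The label triples \<open>0 1 2\<close>, \<open>i 3 (4 + i)\<close> and
  \<open>4 5 6\<close> have distinct entries and differ as sets. Hence among all summands and all
  six permutations a single term survives, with coefficient 1 in every characteristic.\<close>

lemma sym3_base_form_pure:
  assumes \<phi>: "trilinear_form n \<phi>" and u: "u \<in> pure i" and v: "v \<in> pure j" and w: "w \<in> pure k"
  shows "i = 0 \<Longrightarrow> j = 1 \<Longrightarrow> k = 2 \<Longrightarrow>
      sym3 \<epsilon> (base_form n \<phi>) u v w = \<phi> (block n 0 u) (block n 1 v) (block n 2 w)"
    and "i < 3 \<Longrightarrow> j = 3 \<Longrightarrow> k = 4 + i \<Longrightarrow>
      sym3 \<epsilon> (base_form n \<phi>) u v w = dot n (block n i u) (block n 3 v) * w $ ((4 + i) * width n)"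
    and "i = 4 \<Longrightarrow> j = 5 \<Longrightarrow> k = 6 \<Longrightarrow>
      sym3 \<epsilon> (base_form n \<phi>) u v w = u $ (4 * width n) * v $ (5 * width n) * w $ (6 * width n)"
  unfolding sym3_def base_form_pure[OF \<phi> u v w] base_form_pure[OF \<phi> v w u] base_form_pure[OF \<phi> w u v]
    base_form_pure[OF \<phi> v u w] base_form_pure[OF \<phi> u w v] base_form_pure[OF \<phi> w v u] sum_3
  by (auto simp: less_Suc_eq eval_nat_numeral)

lemma top_form_base_form:
  assumes \<phi>: "trilinear_form n \<phi>"
  shows "top_form (base_form n \<phi>)"
  unfolding top_form_def
proof (intro conjI ballI impI)
  show "trilinear_form (out_dim n) (base_form n \<phi>)" by (rule trilinear_form_base_form[OF \<phi>])
  fix u v w :: "'a vec"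
  assume "u \<in> deep \<or> v \<in> deep \<or> w \<in> deep"
  have blk: "block n l v = 0\<^sub>v n" if "v \<in> deep" "l < 7" for v l
    using that by (intro block_eq_0) (auto simp: deep_def)
  have start: "v $ (l * width n) = 0" if "v \<in> deep" "l < 7" for v l
    using block_index_less[OF that(2), of 0] that unfolding deep_def by simp
  show "base_form n \<phi> u v w = 0"
    using \<open>u \<in> deep \<or> v \<in> deep \<or> w \<in> deep\<close>
  proof (elim disjE)
    assume u: "u \<in> deep"
    show ?thesis unfolding base_form_def
      using blk[OF u] start[OF u, of 4] trilinear_form_zero[OF \<phi>] by (simp add: dot_zero)
  next
    assume v: "v \<in> deep"
    show ?thesis unfolding base_form_def
      using blk[OF v] start[OF v, of 5] trilinear_form_zero[OF \<phi>] by (simp add: dot_zero)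
  next
    assume w: "w \<in> deep"
    have "w $ ((4 + i) * width n) = 0" if "i < 3" for i using start[OF w, of "4 + i"] that by simp
    then show ?thesis unfolding base_form_def
      using blk[OF w] start[OF w, of 6] trilinear_form_zero[OF \<phi>] by simp
  qed
qed

lemma trilinear_form_out_form: "trilinear_form n \<phi> \<Longrightarrow> trilinear_form (out_dim n) (out_form n \<epsilon> \<phi>)"
  using trilinear_form_gform[OF top_form_base_form] by (simp add: gform_out_form)

lemma block_inc_pure: "block_inc n i u \<in> pure i" and block_inc_flat: "i < 7 \<Longrightarrow> block_inc n i u \<in> flat"
proof -
  show "block_inc n i u \<in> pure i" using top_dim_le[of n] by (auto simp: pure_def block_inc_def)
  assume i: "i < 7"
  have "z div width n \<noteq> i" if "top_dim n \<le> z" for z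
    using div_le_mono[OF that, of "width n"] i by (simp add: top_dim_def)
  then show "block_inc n i u \<in> flat" by (auto simp: flat_def block_inc_def)
qed

lemma unit_pure: "i < 7 \<Longrightarrow> unit_vec (out_dim n) (i * width n) \<in> pure i"
  and unit_flat: "i < 7 \<Longrightarrow> unit_vec (out_dim n) (i * width n) \<in> flat"
proof -
  assume i: "i < 7"
  have "i * width n < top_dim n" using block_index_less[OF i, of 0] by simp
  moreover have "i * width n div width n = i" by (simp)
  ultimately show "unit_vec (out_dim n) (i * width n) \<in> pure i" "unit_vec (out_dim n) (i * width n) \<in> flat"
    using top_dim_le[of n] by (auto simp: pure_def flat_def)
qed

lemma block_top_part: "i < 7 \<Longrightarrow> block n i (top_part v) = block n i v"
  by (intro eq_vecI) (auto simp: block_def top_part_index block_index_less)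

lemma start_top_part: "i < 7 \<Longrightarrow> top_part v $ (i * width n) = v $ (i * width n)"
  using block_index_less[of i 0 n] by (intro top_part_index) simp

text \<open>\<open>top_form_image\<close> is evaluated on the three kinds of label triples, which
  gives the facts 1, 2 and 3. Invertibility of the diagonal blocks of \<open>f\<close> is not known
  beforehand; it comes out of fact 2, the invariance of the dual pairing.\<close>

lemma equivalent_out_forms_imp:
  assumes \<phi>: "trilinear_form n \<phi>" and \<psi>: "trilinear_form n \<psi>"
    and equiv: "equivalent_forms (out_dim n) (out_form n \<epsilon> \<phi>) (out_form n \<epsilon> \<psi>)"
  shows "equivalent_forms n \<phi> \<psi>"
proof -
  let ?N = "out_dim n"
  obtain f g where fg: "linear_endo ?N f" "linear_endo ?N g"
    "\<forall>v\<in>carrier_vec ?N. g (f v) = v \<and> f (g v) = v"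
    "\<forall>u\<in>carrier_vec ?N. \<forall>v\<in>carrier_vec ?N. \<forall>w\<in>carrier_vec ?N.
      out_form n \<epsilon> \<phi> u v w = out_form n \<epsilon> \<psi> (f u) (f v) (f w)"
    using equiv unfolding equivalent_forms_iff by blast
  interpret gadget_isomorphism ?N "top_dim n" "top_dim n + 1" "\<lambda>x. x div width n" "label_rank n"
    "p_index n" "q_index n" \<epsilon> "base_form n \<phi>" "base_form n \<psi>" f g
    by unfold_locales (use fg \<phi> \<psi> in \<open>simp_all add: top_form_base_form gform_out_form\<close>)
  define F where "F i u = block n i (f (block_inc n i u))" for i u
  define \<zeta> where "\<zeta> i = f (unit_vec ?N (i * width n)) $ (i * width n)" for i
  have F: "linear_endo n (F i)" if "i < 7" for i
    using f that unfolding linear_endo_def F_def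
    by (simp add: block_inc_add block_inc_smult block_add block_smult)
  note pt = pure_top_part[OF f_pure]
  have 1: "\<phi> u v w = \<psi> (F 0 u) (F 1 v) (F 2 w)"
    if c: "u \<in> carrier_vec n" "v \<in> carrier_vec n" "w \<in> carrier_vec n" for u v w
  proof -
    have "\<phi> u v w = sym3 \<epsilon> (base_form n \<phi>) (block_inc n 0 u) (block_inc n 1 v) (block_inc n 2 w)"
      using c by (simp add: sym3_base_form_pure(1)[OF \<phi> block_inc_pure block_inc_pure block_inc_pure] block_block_inc)
    also have "\<dots> = sym3 \<epsilon> (base_form n \<psi>) (top_part (f (block_inc n 0 u)))
        (top_part (f (block_inc n 1 v))) (top_part (f (block_inc n 2 w)))"
      by (rule top_form_image[of _ 0 _ 1 _ 2]) (simp_all add: block_inc_pure block_inc_flat)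
    also have "\<dots> = \<psi> (F 0 u) (F 1 v) (F 2 w)"
      by (simp add: sym3_base_form_pure(1)[OF \<psi> pt[OF block_inc_pure] pt[OF block_inc_pure] pt[OF block_inc_pure]]
          block_top_part F_def)
    finally show ?thesis .
  qed
  have 2: "dot n u v = dot n (F i u) (F 3 v) * \<zeta> (4 + i)"
    if i: "i < 3" and c: "u \<in> carrier_vec n" "v \<in> carrier_vec n" for i u v
  proof -
    let ?e = "unit_vec ?N ((4 + i) * width n) :: 'a vec"
    have i7: "i < 7" "4 + i < 7" using i by auto
    have "dot n u v = sym3 \<epsilon> (base_form n \<phi>) (block_inc n i u) (block_inc n 3 v) ?e"
      using c i block_start_less[OF i7(2), of n]
      by (simp add: sym3_base_form_pure(2)[OF \<phi> block_inc_pure block_inc_pure unit_pure[OF i7(2)] i]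
          block_block_inc)
    also have "\<dots> = sym3 \<epsilon> (base_form n \<psi>) (top_part (f (block_inc n i u)))
        (top_part (f (block_inc n 3 v))) (top_part (f ?e))"
      by (rule top_form_image[of _ i _ 3 _ "4 + i"])
        (use i7 i in \<open>simp_all add: block_inc_pure block_inc_flat unit_pure unit_flat\<close>)
    also have "\<dots> = dot n (F i u) (F 3 v) * \<zeta> (4 + i)"
      unfolding sym3_base_form_pure(2)[OF \<psi> pt[OF block_inc_pure] pt[OF block_inc_pure] pt[OF unit_pure[OF i7(2)]] i refl refl]
        \<zeta>_def F_def block_top_part[OF i7(1)] start_top_part[OF i7(2)]
      by (simp add: block_top_part)
    finally show ?thesis .
  qed
  have 3: "\<zeta> 4 * \<zeta> 5 * \<zeta> 6 = 1"
  proof -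
    let ?e = "\<lambda>i. unit_vec ?N (i * width n) :: 'a vec"
    have lt: "4 < (7::nat)" "5 < (7::nat)" "6 < (7::nat)" by auto
    have "1 = sym3 \<epsilon> (base_form n \<phi>) (?e 4) (?e 5) (?e 6)"
      using block_start_less[OF lt(1), of n] block_start_less[OF lt(2), of n] block_start_less[OF lt(3), of n]
      unfolding sym3_base_form_pure(3)[OF \<phi> unit_pure[OF lt(1)] unit_pure[OF lt(2)] unit_pure[OF lt(3)] refl refl refl]
      by simp
    also have "\<dots> = sym3 \<epsilon> (base_form n \<psi>) (top_part (f (?e 4))) (top_part (f (?e 5))) (top_part (f (?e 6)))"
      by (rule top_form_image[of _ 4 _ 5 _ 6]) (simp_all add: unit_pure unit_flat)
    also have "\<dots> = \<zeta> 4 * \<zeta> 5 * \<zeta> 6"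
      unfolding sym3_base_form_pure(3)[OF \<psi> pt[OF unit_pure[OF lt(1)]] pt[OF unit_pure[OF lt(2)]] pt[OF unit_pure[OF lt(3)]] refl refl refl]
        \<zeta>_def start_top_part[OF lt(1)] start_top_part[OF lt(2)] start_top_part[OF lt(3)] ..
    finally show ?thesis by simp
  qed
  have "\<forall>i. \<exists>A. i < 7 \<longrightarrow> A \<in> carrier_mat n n \<and> (\<forall>v\<in>carrier_vec n. F i v = A *\<^sub>v v)"
    using linear_endo_matrix[OF F] by blast
  then obtain A where A: "\<And>i. i < 7 \<Longrightarrow> A i \<in> carrier_mat n n"
    "\<And>i v. i < 7 \<Longrightarrow> v \<in> carrier_vec n \<Longrightarrow> F i v = A i *\<^sub>v v"
    by metis
  \<comment> \<open>With its scalar absorbed, every block becomes the inverse transpose of the same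
    \<open>A 3\<close>, and so independent of \<open>i\<close>.\<close>
  define B where "B i = \<zeta> (4 + i) \<cdot>\<^sub>m A i" for i
  have B: "B i \<in> carrier_mat n n" if "i < 3" for i using A(1)[of i] that by (simp add: B_def)
  have A3: "A 3 \<in> carrier_mat n n" using A(1) by simp
  have BC: "transpose_mat (B i) * A 3 = 1\<^sub>m n" if i: "i < 3" for i
  proof (rule eq_matI)
    fix a b assume "a < dim_row (1\<^sub>m n :: 'a mat)" "b < dim_col (1\<^sub>m n :: 'a mat)"
    then have ab: "a < n" "b < n" by auto
    have Ai: "A i \<in> carrier_mat n n" using A(1) i by simp
    have col: "F i (unit_vec n a) $ c = A i $$ (c, a)" "F 3 (unit_vec n b) $ c = A 3 $$ (c, b)" if "c < n" for c
      using Ai A3 A(2)[of i "unit_vec n a"] A(2)[of 3 "unit_vec n b"] i ab that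
      by (auto simp: scalar_prod_right_unit)
    have "(transpose_mat (B i) * A 3) $$ (a, b) = (\<Sum>c<n. B i $$ (c, a) * A 3 $$ (c, b))"
      using B[OF i] A3 ab by (simp add: scalar_prod_def lessThan_atLeast0)
    also have "\<dots> = dot n (F i (unit_vec n a)) (F 3 (unit_vec n b)) * \<zeta> (4 + i)"
      using Ai ab by (simp add: dot_def col B_def sum_distrib_left mult_ac)
    also have "\<dots> = dot n (unit_vec n a) (unit_vec n b)" using 2[OF i, of "unit_vec n a" "unit_vec n b"] by simp
    also have "\<dots> = 1\<^sub>m n $$ (a, b)"
      using ab by (simp add: dot_unit)
    finally show "(transpose_mat (B i) * A 3) $$ (a, b) = 1\<^sub>m n $$ (a, b)" .
  qed (use B[OF i] A3 in auto)
  have CB: "A 3 * transpose_mat (B 0) = 1\<^sub>m n"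
    by (rule mat_mult_left_right_inverse[OF _ A3 BC]) (use B[of 0] in auto)
  have B_eq: "B i = B 0" if i: "i < 3" for i
  proof -
    have Bt: "transpose_mat (B j) \<in> carrier_mat n n" if "j < 3" for j using B[OF that] by simp
    have "transpose_mat (B i) = transpose_mat (B i) * (A 3 * transpose_mat (B 0))"
      using right_mult_one_mat[OF Bt[OF i]] by (simp add: CB)
    also have "\<dots> = (transpose_mat (B i) * A 3) * transpose_mat (B 0)"
      by (rule assoc_mult_mat[symmetric, OF Bt[OF i] A3 Bt]) simp
    also have "\<dots> = transpose_mat (B 0)" using left_mult_one_mat[OF Bt[of 0]] by (simp add: BC[OF i])
    finally show ?thesis by (metis transpose_transpose)
  qed
  define D where "D = transpose_mat (A 3)"
  have D: "D \<in> carrier_mat n n" using A3 by (simp add: D_def)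
  have "B 0 * D = 1\<^sub>m n"
    using arg_cong[OF CB, of transpose_mat] transpose_mult[OF A3, of "transpose_mat (B 0)" n] B[of 0] by (simp add: D_def)
  moreover have "D * B 0 = 1\<^sub>m n"
    using arg_cong[OF BC[of 0], of transpose_mat] transpose_mult[of "transpose_mat (B 0)" n n "A 3" n] B[of 0] A3
    by (simp add: D_def)
  ultimately have inv: "D *\<^sub>v (B 0 *\<^sub>v v) = v" "B 0 *\<^sub>v (D *\<^sub>v v) = v" if "v \<in> carrier_vec n" for v
    using assoc_mult_mat_vec[OF D B[of 0] that] assoc_mult_mat_vec[OF B[of 0] D that] that by auto
  have "\<phi> u v w = \<psi> (B 0 *\<^sub>v u) (B 0 *\<^sub>v v) (B 0 *\<^sub>v w)"
    if c: "u \<in> carrier_vec n" "v \<in> carrier_vec n" "w \<in> carrier_vec n" for u v w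
  proof -
    \<comment> \<open>Since all \<open>B i\<close> agree, \<open>B 0\<close> can be written with a
      different scalar in each of the three slots; fact 3 says that the product of these scalars is
      1.\<close>
    have BF: "B 0 *\<^sub>v x = \<zeta> (4 + i) \<cdot>\<^sub>v F i x" if "x \<in> carrier_vec n" "i < 3" for x i
      using A(1)[of i] A(2)[of i x] B_eq[OF that(2), symmetric] that
      by (auto simp: B_def intro!: eq_vecI)
    have Fc: "F i x \<in> carrier_vec n" if "x \<in> carrier_vec n" for i x by (simp add: F_def)
    have sm: "\<psi> (a \<cdot>\<^sub>v x) (b \<cdot>\<^sub>v y) (d \<cdot>\<^sub>v z) = a * b * d * \<psi> x y z"
      if "x \<in> carrier_vec n" "y \<in> carrier_vec n" "z \<in> carrier_vec n" for a b d x y z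
      using \<psi> that unfolding trilinear_form_def linear_form_def by simp
    have "\<psi> (B 0 *\<^sub>v u) (B 0 *\<^sub>v v) (B 0 *\<^sub>v w) = \<zeta> 4 * \<zeta> 5 * \<zeta> 6 * \<psi> (F 0 u) (F 1 v) (F 2 w)"
      using BF[OF c(1), of 0] BF[OF c(2), of 1] BF[OF c(3), of 2] by (simp add: sm Fc c)
    then show ?thesis using 1[OF c] 3 by simp
  qed
  then show ?thesis
    unfolding equivalent_forms_iff
    using linear_endo_mult_mat_vec[OF B[of 0]] linear_endo_mult_mat_vec[OF D] inv
    by (intro exI[of _ "(*\<^sub>v) (B 0)"] exI[of _ "(*\<^sub>v) D"]) auto
qed

end

section \<open>Extending an isomorphism of the input forms to the output forms\<close>

lemma sum_class:
  fixes h :: "nat \<Rightarrow> 'a::comm_monoid_add"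
  assumes i: "i < 7"
  shows "(\<Sum>y<top_dim n. if y div width n = i then h y else 0) = (\<Sum>b<width n. h (i * width n + b))"
proof -
  have "(\<Sum>y<top_dim n. if y div width n = i then h y else 0) = (\<Sum>y | y < top_dim n \<and> y div width n = i. h y)"
    by (intro sum.mono_neutral_cong_right) auto
  also have "\<dots> = (\<Sum>b<width n. h (i * width n + b))"
  proof (rule sum.reindex_bij_witness[of _ "\<lambda>b. i * width n + b" "\<lambda>y. y mod width n"], goal_cases)
    case (1 a)
    then show ?case using div_mult_mod_eq[of a "width n"] by auto
  next
    case (2 a)
    then show ?case using mod_less_divisor[OF width_pos] by blast
  next
    case (3 b)
    then show ?case by (simp del: less_width)
  next
    case (4 b)
    then show ?case using block_index_less[OF i, of b n] by (auto simp: width_def simp del: mult_Suc_right)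
  next
    case (5 a)
    then show ?case using div_mult_mod_eq[of a "width n"] by auto
  qed
  finally show ?thesis .
qed

text \<open>\<open>A\<close> on the three copies and, with \<open>A'\<close> meant as the inverse of
  \<open>A\<close>, the inverse transpose on the dual copy; the identity on the scalar blocks and on
  the last coordinate \<open>n\<close> of every block.\<close>

definition class_block :: "nat \<Rightarrow> (nat \<Rightarrow> nat \<Rightarrow> 'a::field) \<Rightarrow> (nat \<Rightarrow> nat \<Rightarrow> 'a) \<Rightarrow> nat \<Rightarrow> nat \<Rightarrow> nat \<Rightarrow> 'a" where
  "class_block n A A' i a b = (if a < n \<and> b < n \<and> i < 4 then if i = 3 then A' b a else A a b
     else if a = b then 1 else 0)"

definition class_mat :: "nat \<Rightarrow> (nat \<Rightarrow> nat \<Rightarrow> 'a::field) \<Rightarrow> (nat \<Rightarrow> nat \<Rightarrow> 'a) \<Rightarrow> nat \<Rightarrow> nat \<Rightarrow> 'a" where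
  "class_mat n A A' x y = (if y div width n = x div width n
     then class_block n A A' (x div width n) (x mod width n) (y mod width n) else 0)"

text \<open>The identity on \<open>P\<close>; on \<open>Q\<close> the inverse transpose of the
  action on the top coordinates, hence the exchanged \<open>A\<close> and \<open>A'\<close> and the
  exchanged indices of \<open>class_mat\<close>.\<close>

definition lift :: "nat \<Rightarrow> (nat \<Rightarrow> nat \<Rightarrow> 'a::field) \<Rightarrow> (nat \<Rightarrow> nat \<Rightarrow> 'a) \<Rightarrow> 'a vec \<Rightarrow> 'a vec" where
  "lift n A A' v = vec (out_dim n) (\<lambda>z.
     if z < top_dim n then \<Sum>y<top_dim n. class_mat n A A' z y * v $ y
     else if z < top_dim n + 7 * stride n then v $ z
     else let z' = z - (top_dim n + 7 * stride n) in
       \<Sum>y<top_dim n. class_mat n A' A y (z' div stride n) * v $ q_index n y (z' mod stride n))"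

lemma lift_carrier[simp]: "lift n A A' v \<in> carrier_vec (out_dim n)"
  by (simp add: lift_def)

lemma dim_lift[simp]: "dim_vec (lift n A A' v) = out_dim n"
  by (simp add: lift_def)

lemma lift_top: "x < top_dim n \<Longrightarrow> lift n A A' v $ x = (\<Sum>y<top_dim n. class_mat n A A' x y * v $ y)"
  using top_dim_le[of n] by (simp add: lift_def)

lemma lift_p: "i < 7 \<Longrightarrow> r < stride n \<Longrightarrow> lift n A A' v $ p_index n i r = v $ p_index n i r"
  using p_index_less[of i r n] by (simp add: lift_def out_dim_def p_index_def)

lemma lift_q:
  assumes "x < top_dim n" "r < stride n"
  shows "lift n A A' v $ q_index n x r = (\<Sum>y<top_dim n. class_mat n A' A y x * v $ q_index n y r)"
proof -
  let ?z = "q_index n x r"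
  have "?z - (top_dim n + 7 * stride n) = x * stride n + r" by (simp add: q_index_def)
  moreover have "(x * stride n + r) div stride n = x" "(x * stride n + r) mod stride n = r" using assms by auto
  moreover have "\<not> ?z < top_dim n" "\<not> ?z < top_dim n + 7 * stride n" by (auto simp: q_index_def)
  ultimately show ?thesis using q_index_less[OF assms] by (simp add: lift_def)
qed

lemma lift_eqI:
  assumes "u \<in> carrier_vec (out_dim n)" "v \<in> carrier_vec (out_dim n)"
    and "\<And>x. x < top_dim n \<Longrightarrow> u $ x = v $ x"
    and "\<And>i r. i < 7 \<Longrightarrow> r < stride n \<Longrightarrow> u $ p_index n i r = v $ p_index n i r"
    and "\<And>x r. x < top_dim n \<Longrightarrow> r < stride n \<Longrightarrow> u $ q_index n x r = v $ q_index n x r"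
  shows "u = v"
proof (rule eq_vecI)
  fix z assume "z < dim_vec v"
  then have "z < out_dim n" using assms by simp
  then show "u $ z = v $ z" by (cases z rule: index_cases) (use assms in auto)
qed (use assms in auto)

lemma p_index_less_out: "i < 7 \<Longrightarrow> r < stride n \<Longrightarrow> p_index n i r < out_dim n"
  using p_index_less[of i r n] by (simp add: out_dim_def)

lemma linear_endo_lift: "linear_endo (out_dim n) (lift n A A')"
  unfolding linear_endo_def
proof (intro conjI ballI allI)
  fix u v :: "'a vec" and c :: 'a
  assume u: "u \<in> carrier_vec (out_dim n)"
  have lt: "x < out_dim n" if "x < top_dim n" for x using that top_dim_le[of n] by simp
  show "lift n A A' (c \<cdot>\<^sub>v u) = c \<cdot>\<^sub>v lift n A A' u"
    by (rule lift_eqI[of _ n])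
      (use u in \<open>simp_all add: lift_top lift_p lift_q lt p_index_less_out q_index_less sum_distrib_left mult_ac\<close>)
  assume v: "v \<in> carrier_vec (out_dim n)"
  show "lift n A A' (u + v) = lift n A A' u + lift n A A' v"
    by (rule lift_eqI[of _ n])
      (use u v in \<open>simp_all add: lift_top lift_p lift_q lt p_index_less_out q_index_less sum.distrib algebra_simps\<close>)
qed simp

definition inverse_arrays :: "nat \<Rightarrow> (nat \<Rightarrow> nat \<Rightarrow> 'a::field) \<Rightarrow> (nat \<Rightarrow> nat \<Rightarrow> 'a) \<Rightarrow> bool" where
  "inverse_arrays n A B \<longleftrightarrow> (\<forall>a<n. \<forall>c<n. (\<Sum>b<n. A a b * B b c) = (if a = c then 1 else 0))"

lemma class_mat_inverse:
  assumes AA: "inverse_arrays n A A'" "inverse_arrays n A' A" and x: "x < top_dim n" and z: "z < top_dim n"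
  shows "(\<Sum>y<top_dim n. class_mat n A' A x y * class_mat n A A' y z) = (if x = z then 1 else 0)"
proof (cases "x div width n = z div width n")
  case False
  then have "class_mat n A' A x y * class_mat n A A' y z = 0" for y by (simp add: class_mat_def)
  then show ?thesis using False by (auto intro: sum.neutral)
next
  case True
  define i where "i = x div width n"
  define a where "a = x mod width n"
  define c where "c = z mod width n"
  have i: "i < 7" using class_less[OF x] by (simp add: i_def)
  have ac: "a \<le> n" "c \<le> n" using mod_less_divisor[OF width_pos, of x n] mod_less_divisor[OF width_pos, of z n]
    by (simp_all add: a_def c_def)
  have xz: "x = z \<longleftrightarrow> a = c"
    using True div_mult_mod_eq[of x "width n"] div_mult_mod_eq[of z "width n"] by (metis a_def c_def)
  have "(\<Sum>y<top_dim n. class_mat n A' A x y * class_mat n A A' y z) =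
      (\<Sum>y<top_dim n. if y div width n = i
        then class_block n A' A i a (y mod width n) * class_block n A A' i (y mod width n) c else 0)"
    using True by (intro sum.cong refl) (auto simp: class_mat_def i_def a_def c_def)
  also have "\<dots> = (\<Sum>b<width n. class_block n A' A i a b * class_block n A A' i b c)"
    unfolding sum_class[OF i] by (intro sum.cong refl) (simp del: less_width)
  also have "\<dots> = (\<Sum>b<n. class_block n A' A i a b * class_block n A A' i b c)
      + class_block n A' A i a n * class_block n A A' i n c"
    by (simp add: width_def)
  also have "\<dots> = (if a = c then 1 else 0)"
  \<comment> \<open>The first case collects the positions where \<open>class_block\<close> is the
    identity.\<close>
  proof (cases "a = n \<or> c = n \<or> \<not> i < 4")
    case True
    have delta: "(\<Sum>b<n. (if a = b then 1 else 0) * f b) = (if a < n then f a else 0)"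
      "(\<Sum>b<n. f b * (if b = c then 1 else 0)) = (if c < n then f c else 0)" for f :: "nat \<Rightarrow> 'a"
    proof -
      have "(\<Sum>b<n. (if a = b then 1 else 0) * f b) = (\<Sum>b<n. if a = b then f b else 0)"
        by (intro sum.cong) auto
      then show "(\<Sum>b<n. (if a = b then 1 else 0) * f b) = (if a < n then f a else 0)"
        by (simp add: sum.delta')
      have "(\<Sum>b<n. f b * (if b = c then 1 else 0)) = (\<Sum>b<n. if b = c then f b else 0)"
        by (intro sum.cong) auto
      then show "(\<Sum>b<n. f b * (if b = c then 1 else 0)) = (if c < n then f c else 0)"
        by (simp add: sum.delta)
    qed
    consider "\<not> i < 4" | "a = n" | "a < n" "c = n" using True ac by linarith
    then show ?thesis
    proof cases
      case 1
      then show ?thesis using ac by (auto simp: class_block_def delta)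
    next
      case 2
      have "(\<Sum>b<n. class_block n A' A i a b * class_block n A A' i b c) = 0"
        using 2 by (intro sum.neutral) (auto simp: class_block_def)
      then show ?thesis using 2 by (auto simp: class_block_def)
    next
      case 3
      have "(\<Sum>b<n. class_block n A' A i a b * class_block n A A' i b c) = 0"
        using 3 by (intro sum.neutral) (auto simp: class_block_def)
      then show ?thesis using 3 by (auto simp: class_block_def)
    qed
  next
    case False
    then have ac': "a < n" "c < n" "i < 4" using ac by auto
    show ?thesis
    proof (cases "i = 3")
      case True
      have "(\<Sum>b<n. A b a * A' c b) = (if c = a then 1 else 0)"
        using AA(2) ac' by (simp add: inverse_arrays_def mult.commute)
      then show ?thesis using True ac' by (auto simp: class_block_def)
    next
      case False
      have "(\<Sum>b<n. A' a b * A b c) = (if a = c then 1 else 0)"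
        using AA(2) ac' by (simp add: inverse_arrays_def)
      then show ?thesis using False ac' by (simp add: class_block_def)
    qed
  qed
  finally show ?thesis using xz by simp
qed

lemma sum_matrix_inverse:
  fixes G H :: "nat \<Rightarrow> nat \<Rightarrow> 'a::field"
  assumes "\<And>z. z < K \<Longrightarrow> (\<Sum>y<K. H x y * G y z) = (if x = z then 1 else 0)" "x < K"
  shows "(\<Sum>y<K. H x y * (\<Sum>z<K. G y z * v z)) = v x"
proof -
  have "(\<Sum>y<K. H x y * (\<Sum>z<K. G y z * v z)) = (\<Sum>z<K. (\<Sum>y<K. H x y * G y z) * v z)"
    by (simp add: sum_distrib_left sum_distrib_right mult.assoc) (rule sum.swap)
  also have "\<dots> = (\<Sum>z<K. if z = x then v z else 0)"
    using assms(1) by (intro sum.cong refl) auto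
  finally show ?thesis using assms(2) by (simp add: sum.delta)
qed

lemma lift_inverse:
  assumes AA: "inverse_arrays n A A'" "inverse_arrays n A' A" and v: "v \<in> carrier_vec (out_dim n)"
  shows "lift n A' A (lift n A A' v) = v"
proof (rule lift_eqI)
  note inv = class_mat_inverse[OF AA]
  show "lift n A' A (lift n A A' v) $ x = v $ x" if x: "x < top_dim n" for x
    using sum_matrix_inverse[of "top_dim n" "class_mat n A' A" x "class_mat n A A'" "\<lambda>y. v $ y"] inv[OF x] x
    by (simp add: lift_top)
  show "lift n A' A (lift n A A' v) $ q_index n x r = v $ q_index n x r" if x: "x < top_dim n" and r: "r < stride n" for x r
  proof -
    have "lift n A' A (lift n A A' v) $ q_index n x r =
        (\<Sum>y<top_dim n. class_mat n A A' y x * (\<Sum>z<top_dim n. class_mat n A' A z y * v $ q_index n z r))"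
      using x r by (simp add: lift_q)
    also have "\<dots> = v $ q_index n x r"
      using sum_matrix_inverse[of "top_dim n" "\<lambda>x y. class_mat n A A' y x" x "\<lambda>y z. class_mat n A' A z y" "\<lambda>z. v $ q_index n z r"]
        inv[OF _ x] x by (simp add: mult.commute)
    finally show ?thesis .
  qed
qed (use v in \<open>simp_all add: lift_p\<close>)

text \<open>The top action \<open>?G\<close> of the first slot meets its transposed inverse
  \<open>?H\<close> in the third, and summing over \<open>x\<close> turns their product into the
  identity.\<close>

lemma label_form_lift:
  assumes AA: "inverse_arrays n A A'" "inverse_arrays n A' A"
  shows "label_form n (lift n A A' u) (lift n A A' v) (lift n A A' w) = label_form n u v w"
proof -
  let ?K = "top_dim n" and ?cl = "\<lambda>x. x div width n"
  let ?G = "class_mat n A A'" and ?H = "class_mat n A' A"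
  let ?t = "\<lambda>z y. \<Sum>r<label_rank n (?cl z). u $ y * v $ p_index n (?cl z) r * w $ q_index n z r"
  have S: "r < stride n" if "x < ?K" "r < label_rank n (?cl x)" for x r
    using that label_rank_less[OF class_less[OF that(1)], of n] by simp
  have "label_form n (lift n A A' u) (lift n A A' v) (lift n A A' w) =
      (\<Sum>x<?K. \<Sum>r<label_rank n (?cl x). (\<Sum>y<?K. ?G x y * u $ y) * v $ p_index n (?cl x) r
        * (\<Sum>z<?K. ?H z x * w $ q_index n z r))"
    unfolding label_form_def by (intro sum.cong refl) (simp add: lift_top lift_p lift_q S class_less)
  also have "\<dots> = (\<Sum>x<?K. \<Sum>z<?K. \<Sum>y<?K. ?H z x * ?G x y * ?t z y)"
  proof (rule sum.cong[OF refl])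
    fix x assume "x \<in> {..<?K}"
    \<comment> \<open>\<open>?H z x\<close> is zero unless \<open>x\<close> and \<open>z\<close>
      share their label, and the range of \<open>r\<close> and the \<open>P\<close> coordinates
      depend on the label only. Taking them from \<open>z\<close> frees the sum over
      \<open>x\<close>.\<close>
    have eq: "?H z x * (\<Sum>r<label_rank n (?cl x). u $ y * v $ p_index n (?cl x) r * w $ q_index n z r) = ?H z x * ?t z y" for y z
      by (cases "?cl x = ?cl z") (auto simp: class_mat_def)
    have "(\<Sum>r<label_rank n (?cl x). (\<Sum>y<?K. ?G x y * u $ y) * v $ p_index n (?cl x) r
        * (\<Sum>z<?K. ?H z x * w $ q_index n z r)) =
      (\<Sum>r<label_rank n (?cl x). \<Sum>z<?K. \<Sum>y<?K. ?H z x * ?G x y * (u $ y * v $ p_index n (?cl x) r * w $ q_index n z r))"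
      by (intro sum.cong refl, simp add: sum_distrib_left sum_distrib_right mult_ac, rule sum.swap)
    also have "\<dots> = (\<Sum>z<?K. \<Sum>r<label_rank n (?cl x). \<Sum>y<?K. ?H z x * ?G x y * (u $ y * v $ p_index n (?cl x) r * w $ q_index n z r))"
      by (rule sum.swap)
    also have "\<dots> = (\<Sum>z<?K. \<Sum>y<?K. \<Sum>r<label_rank n (?cl x). ?H z x * ?G x y * (u $ y * v $ p_index n (?cl x) r * w $ q_index n z r))"
      by (intro sum.cong refl sum.swap)
    also have "\<dots> = (\<Sum>z<?K. \<Sum>y<?K. ?G x y * (?H z x * (\<Sum>r<label_rank n (?cl x). u $ y * v $ p_index n (?cl x) r * w $ q_index n z r)))"
      by (simp add: sum_distrib_left mult_ac)
    also have "\<dots> = (\<Sum>z<?K. \<Sum>y<?K. ?H z x * ?G x y * ?t z y)"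
      unfolding eq by (simp add: mult_ac)
    finally show "(\<Sum>r<label_rank n (?cl x). (\<Sum>y<?K. ?G x y * u $ y) * v $ p_index n (?cl x) r
        * (\<Sum>z<?K. ?H z x * w $ q_index n z r)) = \<dots>" .
  qed
  also have "\<dots> = (\<Sum>z<?K. \<Sum>x<?K. \<Sum>y<?K. ?H z x * ?G x y * ?t z y)" by (rule sum.swap)
  also have "\<dots> = (\<Sum>z<?K. \<Sum>x<?K. ?H z x * (\<Sum>y<?K. ?G x y * ?t z y))"
    by (simp add: sum_distrib_left mult.assoc)
  also have "\<dots> = (\<Sum>z<?K. ?t z z)"
    using class_mat_inverse[OF AA] by (intro sum.cong refl sum_matrix_inverse) auto
  finally show ?thesis by (simp add: label_form_def)
qed

lemma class_mat_block_sum: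
  assumes i: "i < 4" and a: "a < n"
  shows "(\<Sum>y<top_dim n. class_mat n A A' (i * width n + a) y * v y) =
    (\<Sum>b<n. (if i = 3 then A' b a else A a b) * v (i * width n + b))"
proof -
  have ia: "(i * width n + a) div width n = i" "(i * width n + a) mod width n = a"
    using a by (auto simp: width_def simp del: mult_Suc_right)
  have i7: "i < 7" using i by simp
  have "(\<Sum>y<top_dim n. class_mat n A A' (i * width n + a) y * v y) =
      (\<Sum>y<top_dim n. if y div width n = i then class_block n A A' i a (y mod width n) * v y else 0)"
    by (intro sum.cong refl) (simp only: class_mat_def ia if_distrib[of "\<lambda>t. t * _"] mult_zero_left)
  also have "\<dots> = (\<Sum>b<width n. class_block n A A' i a b * v (i * width n + b))"
    unfolding sum_class[OF i7] by (intro sum.cong refl) (simp del: less_width)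
  also have "\<dots> = (\<Sum>b<n. class_block n A A' i a b * v (i * width n + b))"
    using a by (simp add: width_def class_block_def)
  also have "\<dots> = (\<Sum>b<n. (if i = 3 then A' b a else A a b) * v (i * width n + b))"
    using a i by (intro sum.cong refl) (simp add: class_block_def)
  finally show ?thesis .
qed

lemma lift_block:
  assumes "i < 4" "a < n"
  shows "block n i (lift n A A' v) $ a = (\<Sum>b<n. (if i = 3 then A' b a else A a b) * block n i v $ b)"
  using assms class_mat_block_sum[OF assms, of A A' "\<lambda>y. v $ y"] block_index_less[of i a n]
  by (simp add: block_def lift_top)

lemma lift_start:
  assumes i: "4 \<le> i" "i < 7"
  shows "lift n A A' v $ (i * width n) = v $ (i * width n)"
proof -
  have "i * width n < top_dim n" using block_index_less[OF i(2), of 0 n] by simp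
  then have "lift n A A' v $ (i * width n) = (\<Sum>y<top_dim n. class_mat n A A' (i * width n) y * v $ y)"
    by (rule lift_top)
  also have "\<dots> = (\<Sum>y<top_dim n. if y div width n = i then class_block n A A' i 0 (y mod width n) * v $ y else 0)"
    by (intro sum.cong refl) (simp add: class_mat_def)
  also have "\<dots> = (\<Sum>b<width n. class_block n A A' i 0 b * v $ (i * width n + b))"
    unfolding sum_class[OF i(2)] by (intro sum.cong refl) (simp del: less_width)
  also have "\<dots> = (\<Sum>b<width n. if b = 0 then v $ (i * width n + b) else 0)"
    using i by (intro sum.cong refl) (auto simp: class_block_def)
  also have "\<dots> = v $ (i * width n)" by (simp add: sum.delta)
  finally show ?thesis .
qed

text \<open>As all three copies move by the same \<open>A\<close> and the dual copy by its inverse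
  transpose, the scalars can stay fixed.\<close>

lemma equivalent_forms_imp_out_forms:
  fixes \<phi> \<psi> :: "'a::field form3"
  assumes "equivalent_forms n \<phi> \<psi>"
  shows "equivalent_forms (out_dim n) (out_form n \<epsilon> \<phi>) (out_form n \<epsilon> \<psi>)"
proof -
  obtain f g where fg: "linear_endo n f" "linear_endo n g"
    "\<forall>v\<in>carrier_vec n. g (f v) = v \<and> f (g v) = v"
    "\<forall>u\<in>carrier_vec n. \<forall>v\<in>carrier_vec n. \<forall>w\<in>carrier_vec n. \<phi> u v w = \<psi> (f u) (f v) (f w)"
    using assms unfolding equivalent_forms_iff by blast
  define A where "A a b = f (unit_vec n b) $ a" for a b
  define A' where "A' a b = g (unit_vec n b) $ a" for a b
  have fA: "f v $ a = (\<Sum>b<n. A a b * v $ b)" "g v $ a = (\<Sum>b<n. A' a b * v $ b)"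
    if "v \<in> carrier_vec n" "a < n" for v a
    using linear_endo_index[OF fg(1) that(2,1)] linear_endo_index[OF fg(2) that(2,1)]
    by (simp_all add: A_def A'_def mult.commute)
  have AA: "inverse_arrays n A A'" "inverse_arrays n A' A"
    unfolding inverse_arrays_def
  proof (safe)
    fix a c assume "a < n" "c < n"
    have "(\<Sum>b<n. A a b * A' b c) = f (g (unit_vec n c)) $ a"
      using fA(1)[OF linear_endo_carrier[OF fg(2)] \<open>a < n\<close>] by (simp add: A'_def)
    then show "(\<Sum>b<n. A a b * A' b c) = (if a = c then 1 else 0)"
      using fg(3) \<open>a < n\<close> \<open>c < n\<close> by simp
    have "(\<Sum>b<n. A' a b * A b c) = g (f (unit_vec n c)) $ a"
      using fA(2)[OF linear_endo_carrier[OF fg(1)] \<open>a < n\<close>] by (simp add: A_def)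
    then show "(\<Sum>b<n. A' a b * A b c) = (if a = c then 1 else 0)"
      using fg(3) \<open>a < n\<close> \<open>c < n\<close> by simp
  qed
  let ?f = "lift n A A'" and ?g = "lift n A' A"
  have blk: "block n i (?f v) = f (block n i v)" if "i < 3" for i v
    using that linear_endo_carrier[OF fg(1), of "block n i v"]
    by (intro eq_vecI) (auto simp: lift_block fA)
  have dot: "dot n (block n i (?f u)) (block n 3 (?f v)) = dot n (block n i u) (block n 3 v)" if "i < 3" for i u v
  proof -
    have "dot n (block n i (?f u)) (block n 3 (?f v)) =
        (\<Sum>a<n. (\<Sum>b<n. A a b * block n i u $ b) * (\<Sum>c<n. A' c a * block n 3 v $ c))"
      unfolding dot_def using that by (intro sum.cong refl) (simp add: lift_block)
    also have "\<dots> = (\<Sum>a<n. \<Sum>c<n. block n 3 v $ c * (A' c a * (\<Sum>b<n. A a b * block n i u $ b)))"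
      by (simp add: sum_distrib_left mult_ac)
    also have "\<dots> = (\<Sum>c<n. block n 3 v $ c * (\<Sum>a<n. A' c a * (\<Sum>b<n. A a b * block n i u $ b)))"
      by (subst sum.swap) (simp add: sum_distrib_left)
    also have "\<dots> = (\<Sum>c<n. block n 3 v $ c * block n i u $ c)"
      using AA(2) by (intro sum.cong refl arg_cong2[of _ _ _ _ "(*)"] sum_matrix_inverse) (auto simp: inverse_arrays_def)
    finally show ?thesis by (simp add: dot_def mult.commute)
  qed
  have "base_form n \<psi> (?f u) (?f v) (?f w) = base_form n \<phi> u v w" for u v w
  proof -
    have "(\<Sum>i<3. dot n (block n i (?f u)) (block n 3 (?f v)) * ?f w $ ((4 + i) * width n)) =
        (\<Sum>i<3. dot n (block n i u) (block n 3 v) * w $ ((4 + i) * width n))"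
      by (intro sum.cong refl) (simp add: dot lift_start)
    then show ?thesis unfolding base_form_def using fg(4) by (simp add: blk lift_start)
  qed
  then have "out_form n \<epsilon> \<phi> u v w = out_form n \<epsilon> \<psi> (?f u) (?f v) (?f w)" for u v w
    by (simp add: out_form_def sym3_def label_form_lift[OF AA])
  then show ?thesis
    unfolding equivalent_forms_iff
    using linear_endo_lift[of n A A'] linear_endo_lift[of n A' A] lift_inverse[OF AA] lift_inverse[OF AA(2,1)]
    by (intro exI[of _ ?f] exI[of _ ?g]) simp
qed

theorem equivalent_out_forms_iff:
  assumes "trilinear_form n \<phi>" "trilinear_form n \<psi>" "\<epsilon> \<noteq> 0"
  shows "equivalent_forms (out_dim n) (out_form n \<epsilon> \<phi>) (out_form n \<epsilon> \<psi>) \<longleftrightarrow> equivalent_forms n \<phi> \<psi>"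
  using equivalent_out_forms_imp[OF assms(3,1,2)] equivalent_forms_imp_out_forms by blast

section \<open>Arrays of forms and their entries\<close>

lemma length_concat_upt:
  "(\<And>i. i < n \<Longrightarrow> length (g i) = L) \<Longrightarrow> length (concat (map g [0..<n])) = n * L"
  by (induction n) auto

lemma nth_concat_upt:
  assumes "\<And>i. i < n \<Longrightarrow> length (g i) = L" "i < n" "j < L"
  shows "concat (map g [0..<n]) ! (i * L + j) = g i ! j"
  using assms
proof (induction n)
  case (Suc n)
  have len: "length (concat (map g [0..<n])) = n * L" using Suc.prems by (intro length_concat_upt) auto
  show ?case
  proof (cases "i = n")
    case True
    then show ?thesis by (simp add: nth_append len)
  next
    case False
    then have "i < n" using Suc.prems by simp
    then have "i * L + j < n * L" using Suc.prems by (intro mult_add_less)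
    then show ?thesis using Suc \<open>i < n\<close> by (simp add: nth_append len)
  qed
qed simp

lemma length_form_array: "length (form_array n \<phi>) = n * n * n"
  unfolding form_array_def by (subst length_concat_upt, subst length_concat_upt) (auto simp: mult.assoc)

lemma nth_form_array:
  assumes "a < n" "b < n" "c < n"
  shows "form_array n \<phi> ! ((a * n + b) * n + c) = \<phi> (unit_vec n a) (unit_vec n b) (unit_vec n c)"
proof -
  let ?h = "\<lambda>a b. map (\<lambda>c. \<phi> (unit_vec n a) (unit_vec n b) (unit_vec n c)) [0..<n]"
  let ?g = "\<lambda>a. concat (map (?h a) [0..<n])"
  have arr: "form_array n \<phi> = concat (map ?g [0..<n])" by (simp add: form_array_def)
  have lg: "length (?g i) = n * n" for i by (rule length_concat_upt) simp
  have "(a * n + b) * n + c = a * (n * n) + (b * n + c)" by (simp add: algebra_simps)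
  then have "form_array n \<phi> ! ((a * n + b) * n + c) = concat (map ?g [0..<n]) ! (a * (n * n) + (b * n + c))"
    by (simp only: arr)
  also have "\<dots> = ?g a ! (b * n + c)" using assms by (intro nth_concat_upt lg mult_add_less)
  also have "\<dots> = ?h a b ! c" using assms by (intro nth_concat_upt) auto
  finally show ?thesis using assms by simp
qed

lemma form_array_eqD:
  assumes "form_array n \<phi> = form_array n \<psi>" "a < n" "b < n" "c < n"
  shows "\<phi> (unit_vec n a) (unit_vec n b) (unit_vec n c) = \<psi> (unit_vec n a) (unit_vec n b) (unit_vec n c)"
  using nth_form_array[OF assms(2-4), of \<phi>] nth_form_array[OF assms(2-4), of \<psi>] assms(1) by simp

lemma cube_inj: "n * n * n = m * m * m \<Longrightarrow> n = (m::nat)"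
  by (metis less_irrefl linorder_neqE_nat mult_strict_mono not_gr_zero mult_is_0 zero_le)

text \<open>Yes-instances are words for which some suitable forms exist. The length of the word
  fixes the dimension, as cubing is injective, and an array fixes a trilinear form on the carrier,
  so those forms agree with the given ones.\<close>

lemma snd_form_equivalence_problem_iff:
  assumes "trilinear_form n \<phi>" "trilinear_form n \<psi>" "P n \<phi>" "P n \<psi>"
  shows "form_array n \<phi> @ form_array n \<psi> \<in> snd (form_equivalence_problem P) \<longleftrightarrow> equivalent_forms n \<phi> \<psi>"
proof
  assume "equivalent_forms n \<phi> \<psi>"
  then show "form_array n \<phi> @ form_array n \<psi> \<in> snd (form_equivalence_problem P)"
    using assms by (auto simp: form_equivalence_problem_def)
next
  assume "form_array n \<phi> @ form_array n \<psi> \<in> snd (form_equivalence_problem P)"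
  then obtain m \<phi>' \<psi>' where eq: "form_array n \<phi> @ form_array n \<psi> = form_array m \<phi>' @ form_array m \<psi>'"
    and m: "trilinear_form m \<phi>'" "trilinear_form m \<psi>'" "equivalent_forms m \<phi>' \<psi>'"
    unfolding form_equivalence_problem_def snd_conv mem_Collect_eq by blast
  have "n * n * n = m * m * m" using arg_cong[OF eq, of length] by (simp add: length_form_array)
  then have mn: "m = n" using cube_inj[of n m] by simp
  have arr: "form_array n \<phi> = form_array n \<phi>'" "form_array n \<psi> = form_array n \<psi>'"
    using eq[unfolded mn] by (simp_all add: length_form_array)
  have 1: "\<phi> u v w = \<phi>' u v w" if "u \<in> carrier_vec n" "v \<in> carrier_vec n" "w \<in> carrier_vec n" for u v w
    using trilinear_form_cong_unit[OF assms(1) _ form_array_eqD[OF arr(1)] that] m(1)[unfolded mn] by blast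
  have 2: "\<psi> u v w = \<psi>' u v w" if "u \<in> carrier_vec n" "v \<in> carrier_vec n" "w \<in> carrier_vec n" for u v w
    using trilinear_form_cong_unit[OF assms(2) _ form_array_eqD[OF arr(2)] that] m(2)[unfolded mn] by blast
  from m(3) show "equivalent_forms n \<phi> \<psi>"
    unfolding equivalent_forms_iff mn
    by (elim exE conjE, intro exI conjI) (assumption, assumption, assumption, simp add: 1 2 linear_endo_carrier)
qed

lemma block_unit:
  assumes "i < 7" "x < out_dim n"
  shows "block n i (unit_vec (out_dim n) x) =
    (if i * width n \<le> x \<and> x < i * width n + n then unit_vec n (x - i * width n) else 0\<^sub>v n)"
  using assms block_index_less'[OF assms(1)] by (intro eq_vecI) (auto simp: block_def)

text \<open>The conditions use only comparisons and sums of indices, which the machine can evaluate.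
  \<open>y = x + (3 - i) * width n\<close> expresses that \<open>x\<close> and \<open>y\<close> have
  the same position in their blocks.\<close>

lemma base_form_unit:
  assumes \<phi>: "trilinear_form n \<phi>" and xyz: "x < out_dim n" "y < out_dim n" "z < out_dim n"
  shows "base_form n \<phi> (unit_vec (out_dim n) x) (unit_vec (out_dim n) y) (unit_vec (out_dim n) z) =
    (if x < n \<and> width n \<le> y \<and> y < width n + n \<and> 2 * width n \<le> z \<and> z < 2 * width n + n
      then \<phi> (unit_vec n x) (unit_vec n (y - width n)) (unit_vec n (z - 2 * width n)) else 0)
    + (\<Sum>i<3. if i * width n \<le> x \<and> x < i * width n + n \<and> y = x + (3 - i) * width n \<and> z = (4 + i) * width n
        then 1 else 0)
    + (if x = 4 * width n \<and> y = 5 * width n \<and> z = 6 * width n then 1 else 0)"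
proof -
  let ?e = "unit_vec (out_dim n) :: nat \<Rightarrow> 'a vec"
  have 1: "\<phi> (block n 0 (?e x)) (block n 1 (?e y)) (block n 2 (?e z)) =
    (if x < n \<and> width n \<le> y \<and> y < width n + n \<and> 2 * width n \<le> z \<and> z < 2 * width n + n
      then \<phi> (unit_vec n x) (unit_vec n (y - width n)) (unit_vec n (z - 2 * width n)) else 0)"
    using xyz trilinear_form_zero[OF \<phi>] by (auto simp: block_unit)
  have 2: "dot n (block n i (?e x)) (block n 3 (?e y)) * ?e z $ ((4 + i) * width n) =
      (if i * width n \<le> x \<and> x < i * width n + n \<and> y = x + (3 - i) * width n \<and> z = (4 + i) * width n then 1 else 0)"
    if i: "i < 3" for i
  proof -
    have eq: "3 * width n = i * width n + (3 - i) * width n"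
      using i by (simp add: add_mult_distrib[symmetric] del: distrib_right_numeral)
    have "(4 + i) * width n < out_dim n" using i by (intro block_start_less) simp
    then have z: "?e z $ ((4 + i) * width n) = (if z = (4 + i) * width n then 1 else 0)" using xyz by auto
    have "dot n (block n i (?e x)) (block n 3 (?e y)) =
        (if i * width n \<le> x \<and> x < i * width n + n \<and> y = x + (3 - i) * width n then 1 else 0)"
      using i xyz unfolding eq by (auto simp: block_unit dot_zero dot_unit eq)
    then show ?thesis by (simp add: z)
  qed
  have 3: "?e x $ (4 * width n) * ?e y $ (5 * width n) * ?e z $ (6 * width n) =
      (if x = 4 * width n \<and> y = 5 * width n \<and> z = 6 * width n then 1 else 0)"
    using xyz block_start_less[of 4 n] block_start_less[of 5 n] block_start_less[of 6 n] by auto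
  show ?thesis
    unfolding base_form_def by (intro arg_cong2[of _ _ _ _ "(+)"] sum.cong refl 1 2 3) auto
qed

text \<open>The machine cannot divide, so the label of \<open>x\<close> is found by comparison with
  the seven blocks; at most one summand is nonzero.\<close>

lemma label_form_unit:
  assumes xyz: "x < out_dim n" "y < out_dim n" "z < out_dim n"
  shows "label_form n (unit_vec (out_dim n) x) (unit_vec (out_dim n) y) (unit_vec (out_dim n) z :: 'a::field vec) =
    (\<Sum>i<7. if i * width n \<le> x \<and> x < i * width n + width n \<and> p_index n i 0 \<le> y
       \<and> y < p_index n i (label_rank n i) \<and> z = q_index n x (y - p_index n i 0) then 1 else 0)"
proof -
  let ?e = "unit_vec (out_dim n) :: nat \<Rightarrow> 'a vec"
  let ?cl = "\<lambda>x. x div width n"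
  let ?c = "\<lambda>i. p_index n i 0 \<le> y \<and> y < p_index n i (label_rank n i) \<and> z = q_index n x (y - p_index n i 0)"
  have inner: "(\<Sum>r<label_rank n (?cl x'). ?e x $ x' * ?e y $ p_index n (?cl x') r * ?e z $ q_index n x' r) =
      (if x' = x then if ?c (?cl x) then 1 else 0 else 0)" if x': "x' < top_dim n" for x'
  proof (cases "x' = x")
    case False
    then show ?thesis using x' top_dim_le[of n] xyz by (simp add: sum.neutral)
  next
    case True
    define i where "i = ?cl x"
    have i: "i < 7" using class_less x' True by (simp add: i_def)
    have lt: "p_index n i r < out_dim n" "q_index n x r < out_dim n" if "r < label_rank n i" for r
      using that p_index_less_out[OF i, of r n] q_index_less[of x n r] x' True label_rank_less[OF i, of n] by auto
    have "(\<Sum>r<label_rank n i. ?e x $ x * ?e y $ p_index n i r * ?e z $ q_index n x r) =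
        (\<Sum>r<label_rank n i. if r = y - p_index n i 0 then if ?c i then 1 else 0 else 0)"
      using xyz lt by (intro sum.cong refl) (auto simp: p_index_def)
    also have "\<dots> = (if ?c i then 1 else 0)" by (auto simp: sum.delta p_index_def)
    finally show ?thesis using True by (simp add: i_def)
  qed
  have "label_form n (?e x) (?e y) (?e z) = (\<Sum>x'<top_dim n. if x' = x then if ?c (?cl x) then 1 else 0 else 0)"
    unfolding label_form_def by (intro sum.cong refl inner) simp
  also have "\<dots> = (if x < top_dim n \<and> ?c (?cl x) then 1 else 0)" by (simp add: sum.delta)
  also have "\<dots> = (\<Sum>i<7. if i = ?cl x then if ?c i then 1 else 0 else 0)"
  proof -
    have "x < top_dim n \<longleftrightarrow> ?cl x < 7"
      using div_less_iff_less_mult[of "width n" x 7] by (simp add: top_dim_def)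
    then show ?thesis by (simp add: sum.delta)
  qed
  also have "\<dots> = (\<Sum>i<7. if i * width n \<le> x \<and> x < i * width n + width n \<and> ?c i then 1 else 0)"
  proof (intro sum.cong refl)
    fix i
    have "i = ?cl x \<longleftrightarrow> i * width n \<le> x \<and> x < i * width n + width n"
    proof
      assume "i = ?cl x"
      then show "i * width n \<le> x \<and> x < i * width n + width n"
        using div_mult_mod_eq[of x "width n"] mod_less_divisor[OF width_pos, of x n]
        by (metis add_less_cancel_left le_add1)
    next
      assume "i * width n \<le> x \<and> x < i * width n + width n"
      then show "i = ?cl x" using div_nat_eqI[of "width n" i x] by (simp add: mult.commute)
    qed
    then show "(if i = ?cl x then if ?c i then 1 else 0 else 0) =
        (if i * width n \<le> x \<and> x < i * width n + width n \<and> ?c i then 1 else (0::'a))" by auto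
  qed
  finally show ?thesis .
qed

section \<open>Verified programs for the random access machine\<close>

text \<open>A total-correctness judgement in which \<open>k\<close> bounds the cost, so that time
  and result are established together.\<close>

definition runs :: "('a::field \<Rightarrow> nat) \<Rightarrow> 'a com \<Rightarrow> 'a state \<Rightarrow> nat \<Rightarrow> ('a state \<Rightarrow> bool) \<Rightarrow> bool" where
  "runs sz c s k Q \<longleftrightarrow> (\<exists>t s'. exec sz c s t s' \<and> t \<le> k \<and> Q s')"

lemma runs_mono: "runs sz c s k P \<Longrightarrow> k \<le> k' \<Longrightarrow> (\<And>s'. P s' \<Longrightarrow> Q s') \<Longrightarrow> runs sz c s k' Q"
  unfolding runs_def by (meson order_trans)

lemma runs_Seq:
  "runs sz c s ka P \<Longrightarrow> (\<And>s'. P s' \<Longrightarrow> runs sz c' s' kb Q) \<Longrightarrow> ka + kb \<le> k \<Longrightarrow> runs sz (Seq c c') s k Q"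
  unfolding runs_def by (meson exec.Seq add_mono order_trans)

lemma runs_Skip: "Q s \<Longrightarrow> runs sz Skip s 1 Q"
  unfolding runs_def using exec.Skip by blast

lemma runs_IndexConst: "Q (I(r := k), M) \<Longrightarrow> 1 \<le> j \<Longrightarrow> runs sz (IndexConst r k) (I, M) j Q"
  unfolding runs_def using exec.IndexConst by blast

lemma runs_IndexAdd: "Q (I(r := I p + I q), M) \<Longrightarrow> 1 \<le> j \<Longrightarrow> runs sz (IndexAdd r p q) (I, M) j Q"
  unfolding runs_def using exec.IndexAdd by blast

lemma runs_IndexSub: "Q (I(r := I p - I q), M) \<Longrightarrow> 1 \<le> j \<Longrightarrow> runs sz (IndexSub r p q) (I, M) j Q"
  unfolding runs_def using exec.IndexSub by blast

lemma runs_FieldConst: "Q (I, M(I r := a)) \<Longrightarrow> sz a \<le> Z \<Longrightarrow> runs sz (FieldConst r a) (I, M) (1 + Z) Q"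
  unfolding runs_def using exec.FieldConst[of sz r a I M] by (meson add_left_mono)

lemma runs_FieldCopy:
  "Q (I, M(I r := M (I p))) \<Longrightarrow> sz (M (I p)) \<le> Z \<Longrightarrow> runs sz (FieldCopy r p) (I, M) (1 + Z) Q"
  unfolding runs_def using exec.FieldCopy[of sz r p I M] by (meson add_left_mono)

lemma runs_FieldOp:
  assumes "Q (I, M(I r := eval_op f (M (I p)) (M (I q))))"
    "sz (M (I p)) \<le> Z" "sz (M (I q)) \<le> Z" "sz (eval_op f (M (I p)) (M (I q))) \<le> Z"
  shows "runs sz (FieldOp f r p q) (I, M) (1 + 3 * Z) Q"
proof -
  have "exec sz (FieldOp f r p q) (I, M)
      (1 + sz (M (I p)) + sz (M (I q)) + sz (eval_op f (M (I p)) (M (I q))))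
      (I, M(I r := eval_op f (M (I p)) (M (I q))))"
    by (rule exec.FieldOp) auto
  moreover have "1 + sz (M (I p)) + sz (M (I q)) + sz (eval_op f (M (I p)) (M (I q))) \<le> 1 + 3 * Z"
    using assms(2-4) by simp
  ultimately show ?thesis using assms(1) unfolding runs_def by blast
qed

lemma runs_Cond_IndexLess:
  assumes "I r < I s \<Longrightarrow> runs sz c1 (I, M) k Q" "\<not> I r < I s \<Longrightarrow> runs sz c2 (I, M) k Q"
  shows "runs sz (Cond (IndexLess r s) c1 c2) (I, M) (1 + k) Q"
proof (cases "I r < I s")
  case True
  then obtain t s' where "exec sz c1 (I, M) t s'" "t \<le> k" "Q s'" using assms(1) unfolding runs_def by blast
  then have "exec sz (Cond (IndexLess r s) c1 c2) (I, M) (1 + t) s'" "1 + t \<le> 1 + k" "Q s'"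
    using exec.CondTrue[of "IndexLess r s" "(I, M)" sz c1 t s' c2] True by simp_all
  then show ?thesis unfolding runs_def by blast
next
  case False
  then obtain t s' where "exec sz c2 (I, M) t s'" "t \<le> k" "Q s'" using assms(2) unfolding runs_def by blast
  then have "exec sz (Cond (IndexLess r s) c1 c2) (I, M) (1 + t) s'" "1 + t \<le> 1 + k" "Q s'"
    using exec.CondFalse[of "IndexLess r s" "(I, M)" sz c2 t s' c1] False by simp_all
  then show ?thesis unfolding runs_def by blast
qed

lemma runs_While_False:
  "\<not> I r < I s \<Longrightarrow> Q (I, M) \<Longrightarrow> runs sz (While (IndexLess r s) c) (I, M) 1 Q"
  using exec.WhileFalse[of "IndexLess r s" "(I, M)" sz c] unfolding runs_def by auto

lemma runs_While_True:
  assumes "I r < I s" "runs sz c (I, M) ka P" "\<And>s'. P s' \<Longrightarrow> runs sz (While (IndexLess r s) c) s' kb Q"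
    and k: "1 + ka + kb \<le> k"
  shows "runs sz (While (IndexLess r s) c) (I, M) k Q"
proof -
  obtain t1 s1 where 1: "exec sz c (I, M) t1 s1" "t1 \<le> ka" "P s1" using assms(2) unfolding runs_def by blast
  obtain t2 s2 where 2: "exec sz (While (IndexLess r s) c) s1 t2 s2" "t2 \<le> kb" "Q s2"
    using assms(3)[OF 1(3)] unfolding runs_def by blast
  have "exec sz (While (IndexLess r s) c) (I, M) (1 + t1 + t2) s2"
    using exec.WhileTrue[OF _ 1(1) 2(1)] assms(1) by simp
  moreover have "1 + t1 + t2 \<le> k" using 1 2 k by simp
  ultimately show ?thesis using 2(3) unfolding runs_def by blast
qed

section \<open>Index expressions and their compilation\<close>

datatype iexp = IC nat | IR nat | IPlus iexp iexp | IMinus iexp iexp | ITimes iexp iexp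

primrec ival :: "iexp \<Rightarrow> (nat \<Rightarrow> nat) \<Rightarrow> nat" where
  "ival (IC k) I = k"
| "ival (IR r) I = I r"
| "ival (IPlus a b) I = ival a I + ival b I"
| "ival (IMinus a b) I = ival a I - ival b I"
| "ival (ITimes a b) I = ival a I * ival b I"

primrec iscoped :: "nat \<Rightarrow> iexp \<Rightarrow> bool" where
  "iscoped d (IC k) \<longleftrightarrow> True"
| "iscoped d (IR r) \<longleftrightarrow> r < d"
| "iscoped d (IPlus a b) \<longleftrightarrow> iscoped d a \<and> iscoped d b"
| "iscoped d (IMinus a b) \<longleftrightarrow> iscoped d a \<and> iscoped d b"
| "iscoped d (ITimes a b) \<longleftrightarrow> iscoped d a \<and> iscoped d b"

primrec ival_bound :: "iexp \<Rightarrow> nat \<Rightarrow> nat" where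
  "ival_bound (IC k) B = k"
| "ival_bound (IR r) B = B"
| "ival_bound (IPlus a b) B = ival_bound a B + ival_bound b B"
| "ival_bound (IMinus a b) B = ival_bound a B"
| "ival_bound (ITimes a b) B = ival_bound a B * ival_bound b B"

text \<open>For a product: three steps per pass of the loop, and five for three initialisations, the
  final failing test and the move of the result.\<close>

primrec itime :: "iexp \<Rightarrow> nat \<Rightarrow> nat" where
  "itime (IC k) B = 1"
| "itime (IR r) B = 2"
| "itime (IPlus a b) B = itime a B + itime b B + 1"
| "itime (IMinus a b) B = itime a B + itime b B + 1"
| "itime (ITimes a b) B = itime a B + itime b B + (3 * ival_bound b B + 5)"

text \<open>The value goes to register \<open>d\<close>; the registers above \<open>d\<close> serve as workspace. The machine has no
  multiplication of indices, so products are iterated sums.\<close>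

primrec icompile :: "iexp \<Rightarrow> nat \<Rightarrow> 'a com" where
  "icompile (IC k) d = IndexConst d k"
| "icompile (IR r) d = Seq (IndexConst d 0) (IndexAdd d r d)"
| "icompile (IPlus a b) d = Seq (icompile a d) (Seq (icompile b (d + 1)) (IndexAdd d d (d + 1)))"
| "icompile (IMinus a b) d = Seq (icompile a d) (Seq (icompile b (d + 1)) (IndexSub d d (d + 1)))"
| "icompile (ITimes a b) d = Seq (icompile a d) (Seq (icompile b (d + 1))
     (Seq (IndexConst (d + 2) 0) (Seq (IndexConst (d + 3) 1) (Seq (IndexConst (d + 4) 0)
       (Seq (While (IndexLess (d + 4) (d + 1))
               (Seq (IndexAdd (d + 2) (d + 2) d) (IndexSub (d + 1) (d + 1) (d + 3))))
         (IndexAdd d (d + 2) (d + 4)))))))"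

lemma ival_cong: "iscoped d e \<Longrightarrow> (\<And>r. r < d \<Longrightarrow> I r = J r) \<Longrightarrow> ival e I = ival e J"
  by (induction e) auto

lemma ival_le_bound: "iscoped d e \<Longrightarrow> (\<And>r. r < d \<Longrightarrow> I r \<le> B) \<Longrightarrow> ival e I \<le> ival_bound e B"
  by (induction e) (auto intro: add_mono mult_mono le_trans[OF diff_le_self])

text \<open>The multiplier in \<open>d + 1\<close> is counted down to the zero kept in
  \<open>d + 4\<close>, using the one kept in \<open>d + 3\<close>.\<close>

lemma runs_mult_loop:
  assumes "I (d + 4) = 0" "I (d + 3) = 1"
  shows "runs sz (While (IndexLess (d + 4) (d + 1))
      (Seq (IndexAdd (d + 2) (d + 2) d) (IndexSub (d + 1) (d + 1) (d + 3)))) (I, M) (3 * I (d + 1) + 1)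
    (\<lambda>(I', M'). M' = M \<and> I' (d + 2) = I (d + 2) + I d * I (d + 1) \<and> I' (d + 4) = 0 \<and> (\<forall>r\<le>d. I' r = I r))"
  using assms
proof (induction "I (d + 1)" arbitrary: I)
  case 0
  then show ?case by (intro runs_mono[OF runs_While_False[where Q = "\<lambda>s. s = (I, M)"]]) auto
next
  case (Suc k)
  define J where "J = I(d + 2 := I (d + 2) + I d, d + 1 := k)"
  have "runs sz (Seq (IndexAdd (d + 2) (d + 2) d) (IndexSub (d + 1) (d + 1) (d + 3))) (I, M) 2 (\<lambda>s. s = (J, M))"
  proof (rule runs_Seq[OF runs_IndexAdd[where Q = "\<lambda>s. s = (I(d + 2 := I (d + 2) + I d), M)" and j = 1]])
    fix s' assume s': "s' = (I(d + 2 := I (d + 2) + I d), M)"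
    show "runs sz (IndexSub (d + 1) (d + 1) (d + 3)) s' 1 (\<lambda>s. s = (J, M))"
      unfolding s' by (rule runs_IndexSub) (use Suc.hyps(2)[symmetric] Suc.prems in \<open>auto simp: J_def\<close>)
  qed auto
  moreover have J: "J (d + 4) = 0" "J (d + 3) = 1" "J (d + 1) = k" "J (d + 2) = I (d + 2) + I d" "\<forall>r\<le>d. J r = I r"
    using Suc.prems by (auto simp: J_def)
  ultimately show ?case
  proof (rule_tac runs_While_True)
    show "I (d + 4) < I (d + 1)" using Suc by simp
    fix s' assume "s' = (J, M)"
    then show "runs sz (While (IndexLess (d + 4) (d + 1))
      (Seq (IndexAdd (d + 2) (d + 2) d) (IndexSub (d + 1) (d + 1) (d + 3)))) s' (3 * k + 1)
      (\<lambda>(I', M'). M' = M \<and> I' (d + 2) = I (d + 2) + I d * I (d + 1) \<and> I' (d + 4) = 0 \<and> (\<forall>r\<le>d. I' r = I r))"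
      using Suc.hyps(1)[OF J(3)[symmetric] J(1,2)] J Suc.hyps(2)[symmetric]
      by (auto elim!: runs_mono)
  next
    show "1 + 2 + (3 * k + 1) \<le> 3 * I (d + 1) + 1" using Suc.hyps(2) by simp
  qed auto
qed

lemma runs_Seq_index:
  assumes "runs sz c (I, M) ka (\<lambda>(I', M'). M' = M \<and> I' d = x \<and> (\<forall>r<d. I' r = I r))"
    and "\<And>J. J d = x \<Longrightarrow> (\<And>r. r < d \<Longrightarrow> J r = I r) \<Longrightarrow> runs sz c' (J, M) kb Q"
  shows "runs sz (Seq c c') (I, M) (ka + kb) Q"
  by (rule runs_Seq[OF assms(1), where kb = kb]) (auto intro!: assms(2))

text \<open>The scope \<open>s\<close> is kept apart from the target \<open>d\<close>, so that a
  second operand can be evaluated at \<open>d + 1\<close> while the first result waits in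
  \<open>d\<close>.\<close>

lemma runs_icompile:
  assumes "iscoped s e" "s \<le> d" "\<And>r. r < s \<Longrightarrow> I r \<le> B"
  shows "runs sz (icompile e d) (I, M) (itime e B)
    (\<lambda>(I', M'). M' = M \<and> I' d = ival e I \<and> (\<forall>r<d. I' r = I r))"
  using assms
proof (induction e arbitrary: d I)
  case (IC k)
  show ?case unfolding icompile.simps itime.simps by (rule runs_IndexConst) simp_all
next
  case (IR r)
  then show ?case
    by (auto intro!: runs_Seq[OF runs_IndexConst[where Q = "\<lambda>s. s = (I(d := 0), M)" and j = 1]] runs_IndexAdd)
next
  case (IPlus a b)
  have val: "ival b J = ival b I" if "\<And>r. r < d \<Longrightarrow> J r = I r" for J
    using IPlus.prems that by (intro ival_cong[of s]) auto
  show ?case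
    unfolding icompile.simps itime.simps add.assoc
  proof (rule runs_Seq_index[OF IPlus.IH(1)], goal_cases)
    case (4 J)
    show ?case
      by (rule runs_Seq_index[OF IPlus.IH(2)])
        (use IPlus.prems 4 val[of J] in \<open>auto intro!: runs_IndexAdd\<close>)
  qed (use IPlus.prems in auto)
next
  case (IMinus a b)
  have val: "ival b J = ival b I" if "\<And>r. r < d \<Longrightarrow> J r = I r" for J
    using IMinus.prems that by (intro ival_cong[of s]) auto
  show ?case
    unfolding icompile.simps itime.simps add.assoc
  proof (rule runs_Seq_index[OF IMinus.IH(1)], goal_cases)
    case (4 J)
    show ?case
      by (rule runs_Seq_index[OF IMinus.IH(2)])
        (use IMinus.prems 4 val[of J] in \<open>auto intro!: runs_IndexSub\<close>)
  qed (use IMinus.prems in auto)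
next
  case (ITimes a b)
  let ?W = "While (IndexLess (d + 4) (d + 1))
      (Seq (IndexAdd (d + 2) (d + 2) d) (IndexSub (d + 1) (d + 1) (d + 3)))"
  let ?Q = "\<lambda>(I', M'). M' = M \<and> I' d = ival (ITimes a b) I \<and> (\<forall>r<d. I' r = I r)"
  have bnd: "ival b I \<le> ival_bound b B" using ITimes.prems by (intro ival_le_bound[of s]) auto
  show ?case
    unfolding icompile.simps itime.simps add.assoc
  proof (rule runs_Seq_index[OF ITimes.IH(1)], goal_cases)
    case J: (4 J)
    have val: "ival b J = ival b I" using ITimes.prems J by (intro ival_cong[of s]) auto
    show ?case
    proof (rule runs_Seq_index[OF ITimes.IH(2)], goal_cases)
      case L: (4 L)
      define L' where "L' = L(d + 2 := 0, d + 3 := 1, d + 4 := 0)"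
      have L': "L' (d + 4) = 0" "L' (d + 3) = 1" "L' (d + 1) = ival b I" "L' (d + 2) = 0" "L' d = ival a I"
        "\<And>r. r < d \<Longrightarrow> L' r = I r"
        using L J val by (auto simp: L'_def)
      have loop: "runs sz (Seq ?W (IndexAdd d (d + 2) (d + 4))) (L', M) (3 * ival_bound b B + 2) ?Q"
        by (rule runs_Seq[OF runs_mult_loop[OF L'(1,2)], where kb = 1])
          (use bnd L' in \<open>auto intro!: runs_IndexAdd\<close>)
      show ?case
        by (rule runs_Seq[OF runs_IndexConst[where Q = "\<lambda>s. s = (L(d + 2 := 0), M)" and j = 1],
              where kb = "3 * ival_bound b B + 4"], simp, simp, hypsubst,
            rule runs_Seq[OF runs_IndexConst[where Q = "\<lambda>s. s = (L(d + 2 := 0, d + 3 := 1), M)" and j = 1],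
              where kb = "3 * ival_bound b B + 3"], simp, simp, hypsubst,
            rule runs_Seq[OF runs_IndexConst[where Q = "\<lambda>s. s = (L', M)" and j = 1],
              where kb = "3 * ival_bound b B + 2"])
          (use loop in \<open>auto simp: L'_def add.assoc\<close>)
    qed (use ITimes.prems J in auto)
  qed (use ITimes.prems in auto)
qed

lemma runs_icompile_Seq:
  assumes "iscoped s e" "s \<le> d" "\<And>r. r < s \<Longrightarrow> I r \<le> B"
    and "\<And>J. J d = ival e I \<Longrightarrow> (\<And>r. r < d \<Longrightarrow> J r = I r) \<Longrightarrow> runs sz c (J, M) k Q"
  shows "runs sz (Seq (icompile e d) c) (I, M) (itime e B + k) Q"
  by (rule runs_Seq_index[OF runs_icompile[OF assms(1-3)] assms(4)])

section \<open>Structured programs and their weakest preconditions\<close>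

text \<open>Registers are allocated in stack discipline: a loop entered at level \<open>d\<close> keeps its counter in
  register \<open>d\<close> and its bound in register \<open>d + 1\<close>, and its body lives at level \<open>d + 2\<close>.\<close>

datatype 'a prog =
    PSeq "'a prog" "'a prog"
  | PFor iexp "'a prog"
  | PIf iexp iexp "'a prog"
  | PConst iexp 'a
  | PCopy iexp iexp
  | POp field_op iexp iexp iexp

primrec pcompile :: "'a prog \<Rightarrow> nat \<Rightarrow> 'a com" where
  "pcompile (PSeq g h) d = Seq (pcompile g d) (pcompile h d)"
| "pcompile (PFor e h) d = Seq (icompile e (d + 1)) (Seq (IndexConst d 0)
     (While (IndexLess d (d + 1))
       (Seq (pcompile h (d + 2)) (Seq (IndexConst (d + 2) 1) (IndexAdd d d (d + 2))))))"
| "pcompile (PIf a b h) d = Seq (icompile a d) (Seq (icompile b (d + 1))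
     (Cond (IndexLess d (d + 1)) (pcompile h d) Skip))"
| "pcompile (PConst a c) d = Seq (icompile a d) (FieldConst d c)"
| "pcompile (PCopy a b) d = Seq (icompile a d) (Seq (icompile b (d + 1)) (FieldCopy d (d + 1)))"
| "pcompile (POp f a b c) d = Seq (icompile a d) (Seq (icompile b (d + 1)) (Seq (icompile c (d + 2))
     (FieldOp f d (d + 1) (d + 2))))"

primrec pscoped :: "nat \<Rightarrow> 'a prog \<Rightarrow> bool" where
  "pscoped d (PSeq g h) \<longleftrightarrow> pscoped d g \<and> pscoped d h"
| "pscoped d (PFor e h) \<longleftrightarrow> iscoped d e \<and> pscoped (d + 2) h"
| "pscoped d (PIf a b h) \<longleftrightarrow> iscoped d a \<and> iscoped d b \<and> pscoped d h"
| "pscoped d (PConst a c) \<longleftrightarrow> iscoped d a"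
| "pscoped d (PCopy a b) \<longleftrightarrow> iscoped d a \<and> iscoped d b"
| "pscoped d (POp f a b c) \<longleftrightarrow> iscoped d a \<and> iscoped d b \<and> iscoped d c"

text \<open>A loop body also sees the counter and the bound of the loop, so its register bound grows
  by \<open>ival_bound e B\<close>. Each pass adds a test and the two instructions that increment
  the counter.\<close>

primrec ptime :: "'a prog \<Rightarrow> nat \<Rightarrow> nat \<Rightarrow> nat" where
  "ptime (PSeq g h) B Z = ptime g B Z + ptime h B Z"
| "ptime (PFor e h) B Z = itime e B + ival_bound e B * (ptime h (B + ival_bound e B) Z + 3) + 2"
| "ptime (PIf a b h) B Z = itime a B + itime b B + ptime h B Z + 2"
| "ptime (PConst a c) B Z = itime a B + (1 + Z)"
| "ptime (PCopy a b) B Z = itime a B + itime b B + (1 + Z)"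
| "ptime (POp f a b c) B Z = itime a B + itime b B + itime c B + (1 + 3 * Z)"

text \<open>The bound \<open>Z\<close> on the sizes of all field elements read or written is part of the precondition, because
  it bounds the cost of the field instructions.\<close>

primrec wp :: "('a::field \<Rightarrow> nat) \<Rightarrow> nat \<Rightarrow> 'a prog \<Rightarrow> nat \<Rightarrow> (nat \<Rightarrow> nat) \<Rightarrow> ((nat \<Rightarrow> 'a) \<Rightarrow> bool) \<Rightarrow> (nat \<Rightarrow> 'a) \<Rightarrow> bool"
  where
  "wp sz Z (PSeq g h) d I Q M \<longleftrightarrow> wp sz Z g d I (wp sz Z h d I Q) M"
| "wp sz Z (PFor e h) d I Q M \<longleftrightarrow>
     foldr (\<lambda>i. wp sz Z h (d + 2) (I(d := i, d + 1 := ival e I))) [0..<ival e I] Q M"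
| "wp sz Z (PIf a b h) d I Q M \<longleftrightarrow> (if ival a I < ival b I then wp sz Z h d I Q M else Q M)"
| "wp sz Z (PConst a c) d I Q M \<longleftrightarrow> sz c \<le> Z \<and> Q (M(ival a I := c))"
| "wp sz Z (PCopy a b) d I Q M \<longleftrightarrow> sz (M (ival b I)) \<le> Z \<and> Q (M(ival a I := M (ival b I)))"
| "wp sz Z (POp f a b c) d I Q M \<longleftrightarrow> sz (M (ival b I)) \<le> Z \<and> sz (M (ival c I)) \<le> Z \<and>
     sz (eval_op f (M (ival b I)) (M (ival c I))) \<le> Z \<and>
     Q (M(ival a I := eval_op f (M (ival b I)) (M (ival c I))))"

lemma wp_cong: "pscoped d h \<Longrightarrow> (\<And>r. r < d \<Longrightarrow> I r = J r) \<Longrightarrow> wp sz Z h d I = wp sz Z h d J"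
proof (induction h arbitrary: d I J)
  case (PSeq g h)
  have "wp sz Z g d I = wp sz Z g d J" by (rule PSeq.IH(1)) (use PSeq.prems in auto)
  moreover have "wp sz Z h d I = wp sz Z h d J" by (rule PSeq.IH(2)) (use PSeq.prems in auto)
  ultimately show ?case by (intro ext) simp
next
  case (PFor e h)
  have "ival e I = ival e J" using PFor.prems by (intro ival_cong[of d]) auto
  moreover have "wp sz Z h (d + 2) (I(d := i, d + 1 := k)) = wp sz Z h (d + 2) (J(d := i, d + 1 := k))" for i k
    using PFor.prems by (intro PFor.IH) auto
  ultimately show ?case by (intro ext) simp
next
  case (PIf a b h)
  have "ival a I = ival a J" "ival b I = ival b J" using PIf.prems by (auto intro: ival_cong[of d])
  moreover have "wp sz Z h d I = wp sz Z h d J" by (rule PIf.IH) (use PIf.prems in auto)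
  ultimately show ?case by (intro ext) simp
next
  case (PConst a c)
  then have "ival a I = ival a J" by (auto intro: ival_cong[of d])
  then show ?case by (intro ext) simp
next
  case (PCopy a b)
  then have "ival a I = ival a J" "ival b I = ival b J" by (auto intro: ival_cong[of d])
  then show ?case by (intro ext) simp
next
  case (POp f a b c)
  then have "ival a I = ival a J" "ival b I = ival b J" "ival c I = ival c J" by (auto intro: ival_cong[of d])
  then show ?case by (intro ext) simp
qed

lemma wp_mono: "wp sz Z h d I P M \<Longrightarrow> (\<And>M. P M \<Longrightarrow> Q M) \<Longrightarrow> wp sz Z h d I Q M"
proof (induction h arbitrary: d I P Q M)
  case (PSeq g h)
  have "wp sz Z g d I (wp sz Z h d I P) M" using PSeq.prems(1) by simp
  then have "wp sz Z g d I (wp sz Z h d I Q) M"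
    by (rule PSeq.IH(1)) (rule PSeq.IH(2)[OF _ PSeq.prems(2)])
  then show ?case by simp
next
  case (PFor e h)
  have "foldr (\<lambda>i. wp sz Z h (d + 2) (J i)) xs P M \<Longrightarrow> foldr (\<lambda>i. wp sz Z h (d + 2) (J i)) xs Q M" for xs J M
    by (induction xs arbitrary: M) (auto intro: PFor.prems(2) PFor.IH)
  then show ?case using PFor.prems(1) by simp
qed (auto split: if_splits)

text \<open>The precondition of a loop is the composite of the transformers of its passes; the
  invariant is pushed through by induction from the last pass backwards.\<close>

lemma wp_For:
  assumes "P 0 M" and step: "\<And>i M. i < ival e I \<Longrightarrow> P i M \<Longrightarrow>
      wp sz Z h (d + 2) (I(d := i, d + 1 := ival e I)) (P (Suc i)) M"
    and Q: "\<And>M. P (ival e I) M \<Longrightarrow> Q M"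
  shows "wp sz Z (PFor e h) d I Q M"
proof -
  let ?n = "ival e I"
  define W where "W i = wp sz Z h (d + 2) (I(d := i, d + 1 := ?n))" for i
  have "foldr W [k..<?n] Q M" if "k \<le> ?n" "P k M" for k M
    using that
  proof (induction k arbitrary: M rule: inc_induct)
    case base
    then show ?case using Q by simp
  next
    case (step k)
    show ?case
      unfolding upt_conv_Cons[OF step.hyps(2)] foldr.simps o_apply W_def[of k]
      by (rule wp_mono[OF assms(2)[OF step.hyps(2) step.prems] step.IH])
  qed
  from this[of 0 M] show ?thesis using assms(1) by (simp add: W_def[abs_def])
qed

text \<open>Soundness of \<open>wp\<close>. Preservation of the registers below \<open>d\<close> is
  proved along with it, since a loop relies on its body leaving the counter and the bound
  intact.\<close>

theorem runs_pcompile: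
  assumes "wp sz Z h d I Q M" "pscoped d h" "\<And>r. r < d \<Longrightarrow> I r \<le> B"
  shows "runs sz (pcompile h d) (I, M) (ptime h B Z) (\<lambda>(I', M'). Q M' \<and> (\<forall>r<d. I' r = I r))"
  using assms
proof (induction h arbitrary: d I Q M B)
  case (PSeq g h)
  have "runs sz (pcompile g d) (I, M) (ptime g B Z) (\<lambda>(I', M'). wp sz Z h d I Q M' \<and> (\<forall>r<d. I' r = I r))"
    using PSeq by auto
  then show ?case
    unfolding pcompile.simps
  proof (rule runs_Seq[where kb = "ptime h B Z"])
    fix s' assume "case s' of (I', M') \<Rightarrow> wp sz Z h d I Q M' \<and> (\<forall>r<d. I' r = I r)"
    then obtain J M' where s': "s' = (J, M')" and wp: "wp sz Z h d I Q M'" and J: "\<And>r. r < d \<Longrightarrow> J r = I r" by auto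
    have "wp sz Z h d J Q M'" using wp wp_cong[of d h I J sz Z] PSeq.prems J by auto
    then have "runs sz (pcompile h d) (J, M') (ptime h B Z) (\<lambda>(I', M'). Q M' \<and> (\<forall>r<d. I' r = J r))"
      using PSeq.prems J by (intro PSeq.IH(2)) auto
    then show "runs sz (pcompile h d) s' (ptime h B Z) (\<lambda>(I', M'). Q M' \<and> (\<forall>r<d. I' r = I r))"
      unfolding s' by (rule runs_mono) (auto simp: J)
  qed simp
next
  case (PFor e h)
  let ?n = "ival e I" and ?E = "ival_bound e B"
  let ?k = "ptime h (B + ?E) Z"
  let ?body = "Seq (pcompile h (d + 2)) (Seq (IndexConst (d + 2) 1) (IndexAdd d d (d + 2)))"
  let ?Q = "\<lambda>(I', M'). Q M' \<and> (\<forall>r<d. I' r = I r)"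
  define W where "W i = wp sz Z h (d + 2) (I(d := i, d + 1 := ?n))" for i
  have n: "?n \<le> ?E" using PFor.prems by (intro ival_le_bound[of d]) auto
  have loop: "runs sz (While (IndexLess d (d + 1)) ?body) (J, M') ((?n - i) * (?k + 3) + 1) ?Q"
    if "i \<le> ?n" "J d = i" "J (d + 1) = ?n" "\<And>r. r < d \<Longrightarrow> J r = I r" "foldr W [i..<?n] Q M'" for i J M'
    using that
  proof (induction i arbitrary: J M' rule: inc_induct)
    case base
    then show ?case by (intro runs_mono[OF runs_While_False[where Q = "\<lambda>s. s = (J, M')"]]) auto
  next
    case (step i)
    let ?P = "foldr W [Suc i..<?n] Q"
    have "wp sz Z h (d + 2) J = W i"
      unfolding W_def
      using PFor.prems(2) step.prems by (intro wp_cong) (auto simp: less_Suc_eq)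
    moreover have "W i ?P M'" using step by (simp add: upt_conv_Cons)
    ultimately have "runs sz (pcompile h (d + 2)) (J, M') ?k (\<lambda>(I', M'). ?P M' \<and> (\<forall>r<d + 2. I' r = J r))"
      using PFor.prems(2,3) step n by (intro PFor.IH) (auto simp: less_Suc_eq intro: trans_le_add1)
    then have "runs sz ?body (J, M') (?k + 2)
        (\<lambda>(I', M'). ?P M' \<and> I' d = Suc i \<and> I' (d + 1) = ?n \<and> (\<forall>r<d. I' r = I r))"
    proof (rule runs_Seq[where kb = 2])
      fix s' assume "case s' of (I', M') \<Rightarrow> ?P M' \<and> (\<forall>r<d + 2. I' r = J r)"
      then obtain L M'' where s': "s' = (L, M'')" and L: "?P M''" "\<And>r. r < d + 2 \<Longrightarrow> L r = J r" by auto
      show "runs sz (Seq (IndexConst (d + 2) 1) (IndexAdd d d (d + 2))) s' 2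
        (\<lambda>(I', M'). ?P M' \<and> I' d = Suc i \<and> I' (d + 1) = ?n \<and> (\<forall>r<d. I' r = I r))"
        unfolding s'
        by (rule runs_Seq[OF runs_IndexConst[where Q = "\<lambda>s. s = (L(d + 2 := 1), M'')" and j = 1], where kb = 1])
          (use L step.prems in \<open>auto intro!: runs_IndexAdd\<close>)
    qed simp
    then show ?case
    proof (rule_tac runs_While_True[where kb = "(?n - Suc i) * (?k + 3) + 1"])
      show "J d < J (d + 1)" using step by simp
      have "?n - i = Suc (?n - Suc i)" using step.hyps by simp
      then show "1 + (?k + 2) + ((?n - Suc i) * (?k + 3) + 1) \<le> (?n - i) * (?k + 3) + 1" by simp
      fix s' assume "case s' of (I', M') \<Rightarrow> ?P M' \<and> I' d = Suc i \<and> I' (d + 1) = ?n \<and> (\<forall>r<d. I' r = I r)"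
      then show "runs sz (While (IndexLess d (d + 1)) ?body) s' ((?n - Suc i) * (?k + 3) + 1) ?Q"
        using step.IH by auto
    qed auto
  qed
  have "runs sz (Seq (icompile e (d + 1)) (Seq (IndexConst d 0) (While (IndexLess d (d + 1)) ?body))) (I, M)
      (itime e B + (?E * (?k + 3) + 2)) ?Q"
  proof (rule runs_icompile_Seq[of d])
    fix J assume J: "J (d + 1) = ?n" "\<And>r. r < d + 1 \<Longrightarrow> J r = I r"
    have "runs sz (While (IndexLess d (d + 1)) ?body) (J(d := 0), M) ((?n - 0) * (?k + 3) + 1) ?Q"
      using J PFor.prems(1) by (intro loop) (auto simp: W_def[abs_def])
    moreover have "(?n - 0) * (?k + 3) + 1 \<le> ?E * (?k + 3) + 1"
      using n by (simp del: distrib_left_numeral)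
    ultimately have *: "runs sz (While (IndexLess d (d + 1)) ?body) (J(d := 0), M) (?E * (?k + 3) + 1) ?Q"
      by (rule runs_mono)
    show "runs sz (Seq (IndexConst d 0) (While (IndexLess d (d + 1)) ?body)) (J, M) (?E * (?k + 3) + 2) ?Q"
      by (rule runs_Seq[OF runs_IndexConst[where Q = "\<lambda>s. s = (J(d := 0), M)" and j = 1],
            where kb = "?E * (?k + 3) + 1"])
        (use * in auto)
  qed (use PFor.prems in auto)
  then show ?case by (simp add: add.assoc)
next
  case (PIf a b h)
  let ?Q = "\<lambda>(I', M'). Q M' \<and> (\<forall>r<d. I' r = I r)"
  have "runs sz (pcompile (PIf a b h) d) (I, M) (itime a B + (itime b B + (1 + (ptime h B Z + 1)))) ?Q"
    unfolding pcompile.simps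
  proof (rule runs_icompile_Seq[of d], goal_cases)
    case (4 J)
    have vb: "ival b J = ival b I" using PIf.prems 4 by (intro ival_cong[of d]) auto
    show ?case
    proof (rule runs_icompile_Seq[of d], goal_cases)
      case L: (4 L)
      show ?case
      proof (rule runs_Cond_IndexLess)
        assume "L d < L (d + 1)"
        then have "wp sz Z h d I Q M" using PIf.prems(1) 4 L vb by simp
        then have "wp sz Z h d L Q M" using wp_cong[of d h I L sz Z] PIf.prems 4 L by auto
        then have "runs sz (pcompile h d) (L, M) (ptime h B Z) (\<lambda>(I', M'). Q M' \<and> (\<forall>r<d. I' r = L r))"
          using PIf.prems 4 L by (intro PIf.IH) auto
        then show "runs sz (pcompile h d) (L, M) (ptime h B Z + 1) ?Q"
          by (rule runs_mono) (auto simp: 4 L)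
      next
        assume "\<not> L d < L (d + 1)"
        then have "Q M" using PIf.prems(1) 4 L vb by simp
        then show "runs sz Skip (L, M) (ptime h B Z + 1) ?Q"
          by (intro runs_mono[OF runs_Skip[where Q = "\<lambda>s. s = (L, M)"]]) (auto simp: 4 L)
      qed
    qed (use PIf.prems 4 in auto)
  qed (use PIf.prems in auto)
  then show ?case by (rule runs_mono) auto
next
  case (PConst a c)
  show ?case
    unfolding pcompile.simps ptime.simps
    by (rule runs_icompile_Seq[of d])
      (use PConst.prems in \<open>auto intro!: runs_FieldConst[where Z = Z, simplified]\<close>)
next
  case (PCopy a b)
  let ?Q = "\<lambda>(I', M'). Q M' \<and> (\<forall>r<d. I' r = I r)"
  have "runs sz (pcompile (PCopy a b) d) (I, M) (itime a B + (itime b B + (1 + Z))) ?Q"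
    unfolding pcompile.simps
  proof (rule runs_icompile_Seq[of d], goal_cases)
    case (4 J)
    have vb: "ival b J = ival b I" using PCopy.prems 4 by (intro ival_cong[of d]) auto
    show ?case
    proof (rule runs_icompile_Seq[of d], goal_cases)
      case L: (4 L)
      show ?case by (rule runs_FieldCopy) (use PCopy.prems 4 L vb in auto)
    qed (use PCopy.prems 4 in auto)
  qed (use PCopy.prems in auto)
  then show ?case by (rule runs_mono) auto
next
  case (POp f a b c)
  let ?Q = "\<lambda>(I', M'). Q M' \<and> (\<forall>r<d. I' r = I r)"
  have "runs sz (pcompile (POp f a b c) d) (I, M) (itime a B + (itime b B + (itime c B + (1 + 3 * Z)))) ?Q"
    unfolding pcompile.simps
  proof (rule runs_icompile_Seq[of d], goal_cases)
    case (4 J)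
    have vb: "ival b J = ival b I" using POp.prems 4 by (intro ival_cong[of d]) auto
    show ?case
    proof (rule runs_icompile_Seq[of d], goal_cases)
      case L: (4 L)
      have vc: "ival c L = ival c I" using POp.prems 4 L by (intro ival_cong[of d]) auto
      show ?case
      proof (rule runs_icompile_Seq[of d], goal_cases)
        case P: (4 P)
        show ?case by (rule runs_FieldOp) (use POp.prems 4 L P vb vc in auto)
      qed (use POp.prems 4 L in auto)
    qed (use POp.prems 4 in auto)
  qed (use POp.prems in auto)
  then show ?case by (rule runs_mono) auto
qed

section \<open>Polynomial bounds for the running time of a fixed program\<close>

definition poly_bounded :: "(nat \<Rightarrow> nat) \<Rightarrow> bool" where
  "poly_bounded f \<longleftrightarrow> (\<exists>p :: nat poly. \<forall>x. f x \<le> poly p x)"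

lemma poly_nat_mono: "x \<le> y \<Longrightarrow> poly (p :: nat poly) x \<le> poly p y"
  by (induction p) (auto intro: add_mono mult_mono)

lemma poly_bounded_const: "poly_bounded (\<lambda>_. c)"
  unfolding poly_bounded_def by (rule exI[of _ "[:c:]"]) simp

lemma poly_bounded_id: "poly_bounded (\<lambda>x. x)"
  unfolding poly_bounded_def by (rule exI[of _ "[:0, 1:]"]) simp

lemma poly_bounded_add: "poly_bounded f \<Longrightarrow> poly_bounded g \<Longrightarrow> poly_bounded (\<lambda>x. f x + g x)"
  unfolding poly_bounded_def by (metis poly_add add_mono)

lemma poly_bounded_mult: "poly_bounded f \<Longrightarrow> poly_bounded g \<Longrightarrow> poly_bounded (\<lambda>x. f x * g x)"
  unfolding poly_bounded_def by (metis poly_mult mult_le_mono)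

lemma poly_bounded_comp_poly:
  assumes "poly_bounded f"
  shows "poly_bounded (\<lambda>x. poly p (f x))"
proof -
  obtain q where "\<And>x. f x \<le> poly q x" using assms unfolding poly_bounded_def by blast
  then have "poly p (f x) \<le> poly (pcompose p q) x" for x by (simp add: poly_pcompose poly_nat_mono)
  then show ?thesis unfolding poly_bounded_def by blast
qed

lemmas poly_bounded_intros =
  poly_bounded_const poly_bounded_id poly_bounded_add poly_bounded_mult poly_bounded_comp_poly

lemma poly_bounded_ival_bound: "poly_bounded \<beta> \<Longrightarrow> poly_bounded (\<lambda>x. ival_bound e (\<beta> x))"
  by (induction e) (simp_all add: poly_bounded_intros)

lemma poly_bounded_itime:
  assumes "poly_bounded \<beta>"
  shows "poly_bounded (\<lambda>x. itime e (\<beta> x))"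
  by (induction e) (unfold itime.simps, (assumption | intro poly_bounded_intros poly_bounded_ival_bound assms)+)

text \<open>The program is fixed, so nested loops compose polynomial bounds only finitely often.
  \<open>\<beta>\<close> is generalised because a loop body starts from a larger register
  bound.\<close>

lemma poly_bounded_ptime:
  assumes "poly_bounded \<zeta>"
  shows "poly_bounded \<beta> \<Longrightarrow> poly_bounded (\<lambda>x. ptime h (\<beta> x) (\<zeta> x))"
proof (induction h arbitrary: \<beta>)
  case (PFor e h)
  have "poly_bounded (\<lambda>x. ptime h (\<beta> x + ival_bound e (\<beta> x)) (\<zeta> x))"
    by (intro PFor.IH poly_bounded_add poly_bounded_ival_bound PFor.prems)
  then show ?case
    unfolding ptime.simps
    by (intro poly_bounded_add poly_bounded_mult poly_bounded_const poly_bounded_itime poly_bounded_ival_bound PFor.prems)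
qed (unfold ptime.simps, (assumption | intro poly_bounded_add poly_bounded_mult poly_bounded_const poly_bounded_itime assms)+)

section \<open>The reduction as a program\<close>

text \<open>
  Register 0 holds the length of the input and register 1 the dimension \<open>n\<close>. The input is first copied
  behind the \<open>out_size n\<close> cells of the output and is followed there by the constants \<open>1\<close> and \<open>\<epsilon>\<close> and two
  accumulators. The loop counters 2, 4, 6, 8 are the number of the form (0 or 1) and the index triple
  of the entry being computed.
\<close>

definition width_e :: iexp where "width_e = IPlus (IR 1) (IC 1)"
definition top_e :: iexp where "top_e = ITimes (IC 7) width_e"
definition stride_e :: iexp where "stride_e = IPlus top_e (IC 8)"
definition dim_e :: iexp where
  "dim_e = IPlus (IPlus top_e (ITimes (IC 7) stride_e)) (ITimes top_e stride_e)"
definition size_e :: iexp where "size_e = ITimes (ITimes (ITimes (IC 2) dim_e) dim_e) dim_e"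
definition one_e :: iexp where "one_e = IPlus size_e (IR 0)"
definition eps_e :: iexp where "eps_e = IPlus one_e (IC 3)"
definition acc_e :: iexp where "acc_e = IPlus one_e (IC 4)"
definition acc'_e :: iexp where "acc'_e = IPlus one_e (IC 5)"
text \<open>Form number and index triple are digits in base \<open>dim_e\<close>, so the second
  output array directly follows the first.\<close>

definition cell_e :: iexp where
  "cell_e = IPlus (ITimes (IPlus (ITimes (IPlus (ITimes (IR 2) dim_e) (IR 4)) dim_e) (IR 6)) dim_e) (IR 8)"

definition out_size :: "nat \<Rightarrow> nat" where "out_size n = 2 * out_dim n * out_dim n * out_dim n"

lemma ival_dims:
  "ival width_e I = width (I 1)" "ival top_e I = top_dim (I 1)" "ival stride_e I = stride (I 1)"
  "ival dim_e I = out_dim (I 1)" "ival size_e I = out_size (I 1)" "ival one_e I = out_size (I 1) + I 0"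
  "ival eps_e I = out_size (I 1) + I 0 + 3" "ival acc_e I = out_size (I 1) + I 0 + 4"
  "ival acc'_e I = out_size (I 1) + I 0 + 5"
  "ival cell_e I = ((I 2 * out_dim (I 1) + I 4) * out_dim (I 1) + I 6) * out_dim (I 1) + I 8"
  by (simp_all add: width_e_def top_e_def stride_e_def dim_e_def size_e_def one_e_def eps_e_def acc_e_def
      acc'_e_def cell_e_def width_def top_dim_def stride_def out_dim_def out_size_def)

lemma iscoped_dims[simp]:
  assumes "1 < d"
  shows "iscoped d width_e" "iscoped d top_e" "iscoped d stride_e" "iscoped d dim_e" "iscoped d size_e"
    "iscoped d one_e" "iscoped d eps_e" "iscoped d acc_e" "iscoped d acc'_e"
  using assms by (simp_all add: width_e_def top_e_def stride_e_def dim_e_def size_e_def one_e_def eps_e_def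
      acc_e_def acc'_e_def)

section \<open>Guards and guarded sums\<close>

type_synonym guard = "(iexp \<times> iexp) list"

definition holds :: "guard \<Rightarrow> (nat \<Rightarrow> nat) \<Rightarrow> bool" where
  "holds g I \<longleftrightarrow> (\<forall>(a, b)\<in>set g. ival a I < ival b I)"

text \<open>The machine tests strict inequality only; over the naturals \<open>a \<le> b\<close>
  amounts to \<open>a < b + 1\<close>.\<close>

definition le_g :: "iexp \<Rightarrow> iexp \<Rightarrow> guard" where "le_g a b = [(a, IPlus b (IC 1))]"
definition less_g :: "iexp \<Rightarrow> iexp \<Rightarrow> guard" where "less_g a b = [(a, b)]"
definition eq_g :: "iexp \<Rightarrow> iexp \<Rightarrow> guard" where "eq_g a b = le_g a b @ le_g b a"

lemma holds_simps[simp]: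
  "holds [] I" "holds (g @ h) I \<longleftrightarrow> holds g I \<and> holds h I" "holds (le_g a b) I \<longleftrightarrow> ival a I \<le> ival b I"
  "holds (less_g a b) I \<longleftrightarrow> ival a I < ival b I" "holds (eq_g a b) I \<longleftrightarrow> ival a I = ival b I"
  by (auto simp: holds_def le_g_def less_g_def eq_g_def)

definition gscoped :: "nat \<Rightarrow> guard \<Rightarrow> bool" where
  "gscoped d g \<longleftrightarrow> (\<forall>(a, b)\<in>set g. iscoped d a \<and> iscoped d b)"

lemma gscoped_simps[simp]:
  "gscoped d []" "gscoped d (g @ h) \<longleftrightarrow> gscoped d g \<and> gscoped d h"
  "gscoped d (le_g a b) \<longleftrightarrow> iscoped d a \<and> iscoped d b" "gscoped d (less_g a b) \<longleftrightarrow> iscoped d a \<and> iscoped d b"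
  "gscoped d (eq_g a b) \<longleftrightarrow> iscoped d a \<and> iscoped d b"
  by (auto simp: gscoped_def le_g_def less_g_def eq_g_def)

primrec guarded :: "guard \<Rightarrow> 'a prog \<Rightarrow> 'a prog" where
  "guarded [] h = h"
| "guarded (ab # g) h = PIf (fst ab) (snd ab) (guarded g h)"

lemma wp_guarded: "wp sz Z (guarded g h) d I Q M \<longleftrightarrow> (if holds g I then wp sz Z h d I Q M else Q M)"
  by (induction g) (auto simp: holds_def)

lemma pscoped_guarded: "pscoped d (guarded g h) \<longleftrightarrow> gscoped d g \<and> pscoped d h"
  by (induction g) (auto simp: gscoped_def)

primrec adds :: "iexp \<Rightarrow> (guard \<times> iexp) list \<Rightarrow> 'a prog \<Rightarrow> 'a prog" where
  "adds acc [] h = h"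
| "adds acc (t # ts) h = PSeq (guarded (fst t) (POp FPlus acc acc (snd t))) (adds acc ts h)"

lemma pscoped_adds:
  "pscoped d (adds acc ts h) \<longleftrightarrow> (\<forall>t\<in>set ts. gscoped d (fst t) \<and> iscoped d acc \<and> iscoped d (snd t)) \<and> pscoped d h"
  by (induction ts) (auto simp: pscoped_guarded)

text \<open>Bounds sizes after \<open>k\<close> successive operations on values of size at most
  \<open>X\<close>; the first summand makes it increasing in \<open>k\<close>. For constant
  \<open>k\<close> it is polynomial in \<open>X\<close>, however fast the degree grows with
  \<open>k\<close>.\<close>

primrec size_bound :: "nat poly \<Rightarrow> nat \<Rightarrow> nat \<Rightarrow> nat" where
  "size_bound p 0 X = X"
| "size_bound p (Suc k) X = size_bound p k X + poly p (size_bound p k X + size_bound p k X)"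

lemma size_bound_mono: "k \<le> l \<Longrightarrow> size_bound p k X \<le> size_bound p l X"
  by (induction rule: dec_induct) auto

lemma poly_bounded_size_bound: "poly_bounded \<beta> \<Longrightarrow> poly_bounded (\<lambda>x. size_bound p k (\<beta> x))"
  by (induction k) (simp_all add: poly_bounded_intros)

lemma size_bound_op:
  assumes "\<And>f x y. sz (eval_op f x y) \<le> poly p (sz x + sz y)"
    and "sz x \<le> size_bound p k X" "sz y \<le> size_bound p k X"
  shows "sz (eval_op f x y) \<le> size_bound p (Suc k) X"
proof -
  have "sz (eval_op f x y) \<le> poly p (sz x + sz y)" by (rule assms(1))
  also have "\<dots> \<le> poly p (size_bound p k X + size_bound p k X)" using assms by (intro poly_nat_mono add_mono)
  finally show ?thesis by simp
qed

text \<open>Each term costs at most one addition and hence one level of \<open>size_bound\<close>.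
  No source is the accumulator, so the sources keep their values and the bound \<open>X\<close>
  throughout.\<close>

lemma wp_adds:
  fixes sz :: "'a::field \<Rightarrow> nat"
  assumes adm: "\<And>f x y. sz (eval_op f x y) \<le> poly p (sz x + sz y)"
    and "\<And>t. t \<in> set ts \<Longrightarrow> holds (fst t) I \<Longrightarrow> ival (snd t) I \<noteq> ival acc I \<and> sz (M (ival (snd t) I)) \<le> X"
    and "sz (M (ival acc I)) \<le> size_bound p k X" "size_bound p (k + length ts) X \<le> Z"
    and "\<And>v. v = M (ival acc I) + (\<Sum>t\<leftarrow>ts. if holds (fst t) I then M (ival (snd t) I) else 0) \<Longrightarrow>
      sz v \<le> size_bound p (k + length ts) X \<Longrightarrow> wp sz Z h d I Q (M(ival acc I := v))"
  shows "wp sz Z (adds acc ts h) d I Q M"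
  using assms(2-)
proof (induction ts arbitrary: k M)
  case Nil
  then show ?case by simp
next
  case (Cons t ts)
  let ?A = "ival acc I"
  let ?s = "if holds (fst t) I then M (ival (snd t) I) else 0"
  define M' where "M' = M(?A := M ?A + ?s)"
  have X: "X \<le> size_bound p k X" using size_bound_mono[of 0 k p X] by simp
  have kZ: "size_bound p k X \<le> Z" "size_bound p (Suc k) X \<le> Z"
    by (rule le_trans[OF size_bound_mono Cons.prems(3)], simp)+
  have "sz (M' ?A) \<le> size_bound p (Suc k) X"
  proof (cases "holds (fst t) I")
    case True
    have "sz (eval_op FPlus (M ?A) (M (ival (snd t) I))) \<le> size_bound p (Suc k) X"
      using Cons.prems(1)[of t] Cons.prems(2) X True by (intro size_bound_op adm) auto
    then show ?thesis using True by (simp add: M'_def)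
  next
    case False
    then show ?thesis using Cons.prems(2) size_bound_mono[of k "Suc k" p X] by (simp add: M'_def)
  qed
  moreover have M'eq: "M' (ival (snd u) I) = M (ival (snd u) I)" if "u \<in> set ts" "holds (fst u) I" for u
    using Cons.prems(1)[of u] that by (simp add: M'_def)
  ultimately have "wp sz Z (adds acc ts h) d I Q M'"
  proof (intro Cons.IH[where k = "Suc k"])
    fix u assume "u \<in> set ts" "holds (fst u) I"
    then show "ival (snd u) I \<noteq> ?A \<and> sz (M' (ival (snd u) I)) \<le> X" using Cons.prems(1)[of u] M'eq by auto
  next
    fix v assume v: "v = M' ?A + (\<Sum>t\<leftarrow>ts. if holds (fst t) I then M' (ival (snd t) I) else 0)"
      "sz v \<le> size_bound p (Suc k + length ts) X"
    have "(\<Sum>t\<leftarrow>ts. if holds (fst t) I then M' (ival (snd t) I) else 0) =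
        (\<Sum>t\<leftarrow>ts. if holds (fst t) I then M (ival (snd t) I) else 0)"
      by (intro arg_cong[of _ _ sum_list] map_cong) (auto simp: M'eq)
    then have "v = M ?A + (\<Sum>t\<leftarrow>t # ts. if holds (fst t) I then M (ival (snd t) I) else 0)"
      using v(1) by (simp add: M'_def add.assoc)
    moreover have "sz v \<le> size_bound p (k + length (t # ts)) X" using v(2) by simp
    ultimately have "wp sz Z h d I Q (M(?A := v))" by (rule Cons.prems(4))
    then show "wp sz Z h d I Q (M'(?A := v))" by (simp only: M'_def fun_upd_upd)
  qed (use Cons.prems(3) in auto)
  then show ?case
    using Cons.prems(1)[of t] Cons.prems(2) kZ X size_bound_op[OF adm, of "M ?A" k X "M (ival (snd t) I)" FPlus]
    by (cases "holds (fst t) I") (auto simp: wp_guarded M'_def)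
qed

section \<open>The entries of the output as guarded sums\<close>

definition base_guard :: "iexp \<Rightarrow> iexp \<Rightarrow> iexp \<Rightarrow> guard" where
  "base_guard x y z = less_g x (IR 1) @ le_g width_e y @ less_g y (IPlus width_e (IR 1))
     @ le_g (ITimes (IC 2) width_e) z @ less_g z (IPlus (ITimes (IC 2) width_e) (IR 1))"

text \<open>Address of an entry of form number \<open>IR 2\<close> in the copy of the input behind
  the output. Under \<open>base_guard\<close> the truncated subtractions are exact.\<close>

definition base_src :: "iexp \<Rightarrow> iexp \<Rightarrow> iexp \<Rightarrow> iexp" where
  "base_src x y z = IPlus size_e (IPlus (ITimes (IR 2) (ITimes (ITimes (IR 1) (IR 1)) (IR 1)))
     (IPlus (ITimes (IPlus (ITimes x (IR 1)) (IMinus y width_e)) (IR 1)) (IMinus z (ITimes (IC 2) width_e))))"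

definition link_guard :: "iexp \<Rightarrow> iexp \<Rightarrow> iexp \<Rightarrow> nat \<Rightarrow> guard" where
  "link_guard x y z i = le_g (ITimes (IC i) width_e) x @ less_g x (IPlus (ITimes (IC i) width_e) (IR 1))
     @ eq_g y (IPlus x (ITimes (IC (3 - i)) width_e)) @ eq_g z (ITimes (IC (4 + i)) width_e)"

definition scale_guard :: "iexp \<Rightarrow> iexp \<Rightarrow> iexp \<Rightarrow> guard" where
  "scale_guard x y z = eq_g x (ITimes (IC 4) width_e) @ eq_g y (ITimes (IC 5) width_e)
     @ eq_g z (ITimes (IC 6) width_e)"

definition p_start_e :: "nat \<Rightarrow> iexp" where
  "p_start_e i = IPlus top_e (ITimes (IC i) stride_e)"

definition label_guard :: "iexp \<Rightarrow> iexp \<Rightarrow> iexp \<Rightarrow> nat \<Rightarrow> guard" where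
  "label_guard x y z i = le_g (ITimes (IC i) width_e) x @ less_g x (IPlus (ITimes (IC i) width_e) width_e)
     @ le_g (p_start_e i) y @ less_g y (IPlus (p_start_e i) (IPlus top_e (IC (1 + i))))
     @ eq_g z (IPlus (IPlus (IPlus top_e (ITimes (IC 7) stride_e)) (ITimes x stride_e)) (IMinus y (p_start_e i)))"

text \<open>These are the summands of \<open>base_form_unit\<close> and
  \<open>label_form_unit\<close>, \<open>1 + 3 + 1 + 7\<close> in number: one reads an input entry,
  the others read the constant 1.\<close>

definition entry_terms :: "iexp \<Rightarrow> iexp \<Rightarrow> iexp \<Rightarrow> (guard \<times> iexp) list" where
  "entry_terms x y z = (base_guard x y z, base_src x y z) # map (\<lambda>i. (link_guard x y z i, one_e)) [0..<3]
     @ (scale_guard x y z, one_e) # map (\<lambda>i. (label_guard x y z i, one_e)) [0..<7]"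

lemma length_entry_terms: "length (entry_terms x y z) = 12"
  by (simp add: entry_terms_def)

lemma entry_terms_scoped:
  assumes "2 < d" "iscoped d x" "iscoped d y" "iscoped d z" "t \<in> set (entry_terms x y z)"
  shows "gscoped d (fst t) \<and> iscoped d (snd t)"
  using assms by (auto simp: entry_terms_def base_guard_def base_src_def link_guard_def scale_guard_def
      label_guard_def p_start_e_def)

lemma holds_base_guard: "holds (base_guard x y z) I \<longleftrightarrow> ival x I < I 1 \<and> width (I 1) \<le> ival y I \<and>
    ival y I < width (I 1) + I 1 \<and> 2 * width (I 1) \<le> ival z I \<and> ival z I < 2 * width (I 1) + I 1"
  by (simp add: base_guard_def ival_dims)

lemma holds_link_guard: "holds (link_guard x y z i) I \<longleftrightarrow> i * width (I 1) \<le> ival x I \<and>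
    ival x I < i * width (I 1) + I 1 \<and> ival y I = ival x I + (3 - i) * width (I 1) \<and> ival z I = (4 + i) * width (I 1)"
  by (simp add: link_guard_def ival_dims)

lemma holds_scale_guard: "holds (scale_guard x y z) I \<longleftrightarrow>
    ival x I = 4 * width (I 1) \<and> ival y I = 5 * width (I 1) \<and> ival z I = 6 * width (I 1)"
  by (simp add: scale_guard_def ival_dims)

lemma holds_label_guard: "holds (label_guard x y z i) I \<longleftrightarrow> i * width (I 1) \<le> ival x I \<and>
    ival x I < i * width (I 1) + width (I 1) \<and> p_index (I 1) i 0 \<le> ival y I \<and>
    ival y I < p_index (I 1) i (label_rank (I 1) i) \<and> ival z I = q_index (I 1) (ival x I) (ival y I - p_index (I 1) i 0)"
  by (simp add: label_guard_def ival_dims p_start_e_def p_index_def q_index_def label_rank_def add.assoc)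

lemma entry_terms_sum:
  assumes \<phi>: "trilinear_form n \<phi>" and n: "I 1 = n"
    and xyz: "ival x I < out_dim n" "ival y I < out_dim n" "ival z I < out_dim n"
    and one: "M (out_size n + I 0) = 1"
    and src: "\<And>a b c. a < n \<Longrightarrow> b < n \<Longrightarrow> c < n \<Longrightarrow>
      M (out_size n + (I 2 * (n * n * n) + ((a * n + b) * n + c))) = \<phi> (unit_vec n a) (unit_vec n b) (unit_vec n c)"
  shows "(\<Sum>t\<leftarrow>entry_terms x y z. if holds (fst t) I then M (ival (snd t) I) else 0) =
    base_form n \<phi> (unit_vec (out_dim n) (ival x I)) (unit_vec (out_dim n) (ival y I)) (unit_vec (out_dim n) (ival z I))
    + label_form n (unit_vec (out_dim n) (ival x I)) (unit_vec (out_dim n) (ival y I)) (unit_vec (out_dim n) (ival z I))"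
proof -
  have upt: "(\<Sum>i\<leftarrow>[0..<k]. h i) = (\<Sum>i<k. h i)" for h :: "nat \<Rightarrow> 'a" and k
    by (simp add: interv_sum_list_conv_sum_set_nat atLeast0LessThan)
  have base: "(if holds (base_guard x y z) I then M (ival (base_src x y z) I) else 0) =
     (if ival x I < n \<and> width n \<le> ival y I \<and> ival y I < width n + n \<and> 2 * width n \<le> ival z I \<and> ival z I < 2 * width n + n
      then \<phi> (unit_vec n (ival x I)) (unit_vec n (ival y I - width n)) (unit_vec n (ival z I - 2 * width n)) else 0)"
  proof (cases "holds (base_guard x y z) I")
    case True
    note c = True[unfolded holds_base_guard n]
    have "M (ival (base_src x y z) I) =
        \<phi> (unit_vec n (ival x I)) (unit_vec n (ival y I - width n)) (unit_vec n (ival z I - 2 * width n))"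
      using src[of "ival x I" "ival y I - width n" "ival z I - 2 * width n"] c
      unfolding base_src_def ival.simps ival_dims n by linarith
    then show ?thesis using True c by simp
  next
    case False
    note c = False[unfolded holds_base_guard n]
    show ?thesis by (simp only: False c if_False)
  qed
  have "(\<Sum>t\<leftarrow>entry_terms x y z. if holds (fst t) I then M (ival (snd t) I) else 0) =
      (if holds (base_guard x y z) I then M (ival (base_src x y z) I) else 0)
      + (\<Sum>i<3. if holds (link_guard x y z i) I then M (ival one_e I) else 0)
      + (if holds (scale_guard x y z) I then M (ival one_e I) else 0)
      + (\<Sum>i<7. if holds (label_guard x y z i) I then M (ival one_e I) else 0)"
    unfolding upt[symmetric] by (simp add: entry_terms_def comp_def add.assoc del: upt_rec_numeral cong: if_cong)
  then show ?thesis
    unfolding base_form_unit[OF \<phi> xyz] label_form_unit[OF xyz] base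
    by (simp only: holds_link_guard holds_scale_guard holds_label_guard n one ival_dims)
qed

definition even_terms :: "(guard \<times> iexp) list" where
  "even_terms = entry_terms (IR 4) (IR 6) (IR 8) @ entry_terms (IR 6) (IR 8) (IR 4) @ entry_terms (IR 8) (IR 4) (IR 6)"

definition odd_terms :: "(guard \<times> iexp) list" where
  "odd_terms = entry_terms (IR 6) (IR 4) (IR 8) @ entry_terms (IR 4) (IR 8) (IR 6) @ entry_terms (IR 8) (IR 6) (IR 4)"

text \<open>The odd permutations have an accumulator of their own, so that \<open>\<epsilon>\<close>
  is applied only once.\<close>

definition entry_prog :: "'a::field prog" where
  "entry_prog = PSeq (PConst acc_e 0) (adds acc_e even_terms
     (PSeq (PConst acc'_e 0) (adds acc'_e odd_terms
       (PSeq (POp FTimes acc'_e eps_e acc'_e) (POp FPlus cell_e acc_e acc'_e)))))"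

definition main_prog :: "'a::field \<Rightarrow> 'a prog" where
  "main_prog \<epsilon> = PSeq (PFor (IR 0) (PCopy (IPlus size_e (IR 2)) (IR 2)))
     (PSeq (PConst one_e 1) (PSeq (PConst eps_e \<epsilon>)
       (PFor (IC 2) (PFor dim_e (PFor dim_e (PFor dim_e entry_prog))))))"

lemma pscoped_main_prog: "pscoped 2 (main_prog \<epsilon>)"
proof -
  have "gscoped 10 (fst t) \<and> iscoped 10 (snd t)" if "t \<in> set even_terms \<or> t \<in> set odd_terms" for t
    using that unfolding even_terms_def odd_terms_def set_append Un_iff
    by (elim disjE) (rule entry_terms_scoped; simp; fail)+
  then show ?thesis
    by (auto simp: main_prog_def entry_prog_def pscoped_adds cell_e_def)
qed

section \<open>Correctness of the main program\<close>

text \<open>The 38 levels of \<open>size_bound\<close> are the 36 additions of three permutations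
  with 12 terms each, one multiplication by \<open>\<epsilon>\<close>, and the addition of the two
  accumulators.\<close>

locale reduction_run =
  fixes sz :: "'a::field \<Rightarrow> nat" and p :: "nat poly" and \<epsilon> :: 'a and n :: nat and \<phi> \<psi> :: "'a form3" and X Z :: nat
  assumes adm: "\<And>f x y. sz (eval_op f x y) \<le> poly p (sz x + sz y)"
    and \<phi>: "trilinear_form n \<phi>" and \<psi>: "trilinear_form n \<psi>" and eps: "\<epsilon> \<noteq> 0"
    and X: "sz 0 \<le> X" "sz 1 \<le> X" "sz \<epsilon> \<le> X" "\<And>x. x \<in> set (form_array n \<phi> @ form_array n \<psi>) \<Longrightarrow> sz x \<le> X"
    and Z: "size_bound p 38 X \<le> Z"
begin

definition word where "word = form_array n \<phi> @ form_array n \<psi>"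
definition out where
  "out = form_array (out_dim n) (out_form n \<epsilon> \<phi>) @ form_array (out_dim n) (out_form n \<epsilon> \<psi>)"
definition src_form where "src_form f = (if f = (0::nat) then \<phi> else \<psi>)"

lemma length_word: "length word = 2 * (n * n * n)"
  by (simp add: word_def length_form_array)

lemma length_out: "length out = out_size n"
  by (simp add: out_def length_form_array out_size_def)

lemma nth_word:
  assumes "f < 2" "a < n" "b < n" "c < n"
  shows "f * (n * n * n) + ((a * n + b) * n + c) < length word"
    "word ! (f * (n * n * n) + ((a * n + b) * n + c)) = src_form f (unit_vec n a) (unit_vec n b) (unit_vec n c)"
proof -
  have "(a * n + b) * n + c < n * n * n" using assms by (intro mult_add_less)
  then show "f * (n * n * n) + ((a * n + b) * n + c) < length word"
    unfolding length_word by (rule mult_add_less[OF assms(1)])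
  show "word ! (f * (n * n * n) + ((a * n + b) * n + c)) = src_form f (unit_vec n a) (unit_vec n b) (unit_vec n c)"
    using \<open>(a * n + b) * n + c < n * n * n\<close> assms
    by (cases "f = 0") (auto simp: word_def src_form_def nth_append length_form_array nth_form_array less_2_cases_iff)
qed

lemma nth_out:
  assumes "f < 2" "a < out_dim n" "b < out_dim n" "c < out_dim n"
  shows "((f * out_dim n + a) * out_dim n + b) * out_dim n + c < out_size n"
    "out ! (((f * out_dim n + a) * out_dim n + b) * out_dim n + c) =
      out_form n \<epsilon> (src_form f) (unit_vec (out_dim n) a) (unit_vec (out_dim n) b) (unit_vec (out_dim n) c)"
proof -
  let ?N = "out_dim n"
  have lt: "(a * ?N + b) * ?N + c < ?N * ?N * ?N" using assms by (intro mult_add_less)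
  have eq: "((f * ?N + a) * ?N + b) * ?N + c = f * (?N * ?N * ?N) + ((a * ?N + b) * ?N + c)"
    by (simp add: algebra_simps)
  have "f * (?N * ?N * ?N) + ((a * ?N + b) * ?N + c) < 2 * (?N * ?N * ?N)"
    by (rule mult_add_less[OF assms(1) lt])
  then show "((f * ?N + a) * ?N + b) * ?N + c < out_size n" unfolding eq by (simp add: out_size_def mult.assoc)
  show "out ! (((f * ?N + a) * ?N + b) * ?N + c) =
      out_form n \<epsilon> (src_form f) (unit_vec ?N a) (unit_vec ?N b) (unit_vec ?N c)"
    unfolding eq using lt assms
    by (cases "f = 0") (auto simp: out_def src_form_def nth_append length_form_array nth_form_array less_2_cases_iff)
qed

text \<open>The common loop invariant: the first \<open>k\<close> output entries are finished, and
  the copied input and the two constants are intact. Nothing is said about the accumulators.\<close>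

definition progress :: "nat \<Rightarrow> (nat \<Rightarrow> 'a) \<Rightarrow> bool" where
  "progress k M \<longleftrightarrow> (\<forall>j<k. M j = out ! j \<and> sz (out ! j) \<le> Z) \<and> (\<forall>j<length word. M (out_size n + j) = word ! j) \<and>
     M (out_size n + length word) = 1 \<and> M (out_size n + length word + 3) = \<epsilon>"

lemma size_word: "j < length word \<Longrightarrow> sz (word ! j) \<le> X"
  using X(4)[of "word ! j"] nth_mem[of j word] by (simp only: word_def)

lemma entry_terms_size:
  assumes I: "I 0 = length word" "I 1 = n" "I 2 < 2"
    and M: "\<forall>j<length word. M (out_size n + j) = word ! j" "M (out_size n + length word) = 1"
    and t: "t \<in> set (entry_terms x y z)" "holds (fst t) I"
  shows "ival (snd t) I \<le> out_size n + length word \<and> sz (M (ival (snd t) I)) \<le> X"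
proof (cases "t = (base_guard x y z, base_src x y z)")
  case True
  define j where "j = I 2 * (n * n * n) + ((ival x I * n + (ival y I - width n)) * n + (ival z I - 2 * width n))"
  have g: "ival x I < n" "ival y I - width n < n" "ival z I - 2 * width n < n"
  proof -
    have "holds (base_guard x y z) I" using t(2) True by simp
    then show "ival x I < n" "ival y I - width n < n" "ival z I - 2 * width n < n"
      unfolding holds_base_guard I(2) by linarith+
  qed
  have "ival (snd t) I = out_size n + j"
    unfolding True snd_conv base_src_def ival.simps ival_dims I(2) j_def ..
  moreover have "j < length word" unfolding j_def by (rule nth_word(1)[OF I(3) g])
  ultimately show ?thesis using M(1) size_word by simp
next
  case False
  then have "snd t = one_e" using t(1) by (auto simp: entry_terms_def)
  then have "ival (snd t) I = out_size n + length word" by (simp only: ival_dims I)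
  then show ?thesis using M(2) X(2) by simp
qed

lemma wp_entry_prog:
  assumes I: "I 0 = length word" "I 1 = n" "I 2 < 2" "I 4 < out_dim n" "I 6 < out_dim n" "I 8 < out_dim n"
    and progress: "progress (ival cell_e I) M"
  shows "wp sz Z entry_prog d I (progress (Suc (ival cell_e I))) M"
proof -
  let ?S = "out_size n + length word"
  let ?T = "\<lambda>x y z. base_form n (src_form (I 2)) (unit_vec (out_dim n) x) (unit_vec (out_dim n) y) (unit_vec (out_dim n) z)
    + label_form n (unit_vec (out_dim n) x) (unit_vec (out_dim n) y) (unit_vec (out_dim n) z)"
  have acc: "ival acc_e I = ?S + 4" "ival acc'_e I = ?S + 5" "ival eps_e I = ?S + 3"
    by (simp_all only: ival_dims I)
  have X_le: "X \<le> size_bound p k X" for k using size_bound_mono[of 0 k p X] by simp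
  have le_Z: "size_bound p k X \<le> Z" if "k \<le> 38" for k using size_bound_mono[OF that, of p X] Z by simp
  have trilin: "trilinear_form n (src_form (I 2))" using \<phi> \<psi> by (simp add: src_form_def)
  \<comment> \<open>The sums read only cells below the accumulators, so they are evaluated for every
    memory that agrees with \<open>M\<close> there; this covers the memory before and after the
    first accumulator is filled.\<close>
  have val: "(\<Sum>t\<leftarrow>entry_terms x y z. if holds (fst t) I then M' (ival (snd t) I) else 0) = ?T (ival x I) (ival y I) (ival z I)"
    if M': "\<And>j. j < ?S + 4 \<Longrightarrow> M' j = M j" and "ival x I < out_dim n" "ival y I < out_dim n" "ival z I < out_dim n" for M' x y z
  proof (rule entry_terms_sum[OF trilin I(2) that(2-4)])
    show "M' (out_size n + I 0) = 1" using M' progress by (simp add: I progress_def)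
    fix a b c assume "a < n" "b < n" "c < n"
    note nw = nth_word[OF I(3) this]
    then show "M' (out_size n + (I 2 * (n * n * n) + ((a * n + b) * n + c))) =
        src_form (I 2) (unit_vec n a) (unit_vec n b) (unit_vec n c)"
      using M' progress unfolding progress_def by simp
  qed
  have terms: "ival (snd t) I \<noteq> ?S + 4 \<and> ival (snd t) I \<noteq> ?S + 5 \<and> sz (M' (ival (snd t) I)) \<le> X"
    if M': "\<And>j. j < ?S + 4 \<Longrightarrow> M' j = M j" and t: "t \<in> set even_terms \<union> set odd_terms" "holds (fst t) I" for M' t
  proof -
    obtain x y z where "t \<in> set (entry_terms x y z)" using t(1) by (auto simp: even_terms_def odd_terms_def)
    from entry_terms_size[OF I(1-3) _ _ this t(2), of M'] M' progress show ?thesis by (auto simp: progress_def)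
  qed
  have len: "length even_terms = 36" "length odd_terms = 36"
    by (simp_all add: even_terms_def odd_terms_def length_entry_terms)
  let ?x = "I 4" and ?y = "I 6" and ?z = "I 8"
  define v where "v = ?T ?x ?y ?z + ?T ?y ?z ?x + ?T ?z ?x ?y"
  define v' where "v' = ?T ?y ?x ?z + ?T ?x ?z ?y + ?T ?z ?y ?x"
  have sum_even: "(\<Sum>t\<leftarrow>even_terms. if holds (fst t) I then M' (ival (snd t) I) else 0) = v"
    if "\<And>j. j < ?S + 4 \<Longrightarrow> M' j = M j" for M'
    unfolding even_terms_def v_def map_append sum_list.append using I by (simp add: val[OF that])
  have sum_odd: "(\<Sum>t\<leftarrow>odd_terms. if holds (fst t) I then M' (ival (snd t) I) else 0) = v'"
    if "\<And>j. j < ?S + 4 \<Longrightarrow> M' j = M j" for M'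
    unfolding odd_terms_def v'_def map_append sum_list.append using I by (simp add: val[OF that])
  have cell: "ival cell_e I < out_size n" "out ! ival cell_e I = v + \<epsilon> * v'"
    using nth_out[OF I(3-6)] unfolding ival_dims I(2) v_def v'_def out_form_def sym3_def by simp_all
  have eps_M: "M (?S + 3) = \<epsilon>" using progress by (simp add: progress_def)
  define M1 where "M1 = M(?S + 4 := 0)"
  define M2 where "M2 = M(?S + 4 := v, ?S + 5 := 0)"
  have "wp sz Z (adds acc_e even_terms (PSeq (PConst acc'_e 0) (adds acc'_e odd_terms
       (PSeq (POp FTimes acc'_e eps_e acc'_e) (POp FPlus cell_e acc_e acc'_e))))) d I (progress (Suc (ival cell_e I))) M1"
  proof (rule wp_adds[OF adm, where k = 0 and X = X])
    fix t assume "t \<in> set even_terms" "holds (fst t) I"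
    then show "ival (snd t) I \<noteq> ival acc_e I \<and> sz (M1 (ival (snd t) I)) \<le> X"
      using terms[of M1 t] by (auto simp: acc M1_def)
  next
    fix u assume "u = M1 (ival acc_e I) + (\<Sum>t\<leftarrow>even_terms. if holds (fst t) I then M1 (ival (snd t) I) else 0)"
      "sz u \<le> size_bound p (0 + length even_terms) X"
    then have u: "u = v" "sz v \<le> size_bound p 36 X"
      using sum_even[of M1] by (simp_all add: acc M1_def len)
    have "wp sz Z (adds acc'_e odd_terms (PSeq (POp FTimes acc'_e eps_e acc'_e) (POp FPlus cell_e acc_e acc'_e)))
        d I (progress (Suc (ival cell_e I))) M2"
    proof (rule wp_adds[OF adm, where k = 0 and X = X])
      fix t assume "t \<in> set odd_terms" "holds (fst t) I"
      then show "ival (snd t) I \<noteq> ival acc'_e I \<and> sz (M2 (ival (snd t) I)) \<le> X"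
        using terms[of M2 t] by (auto simp: acc M2_def)
    next
      fix u' assume "u' = M2 (ival acc'_e I) + (\<Sum>t\<leftarrow>odd_terms. if holds (fst t) I then M2 (ival (snd t) I) else 0)"
        "sz u' \<le> size_bound p (0 + length odd_terms) X"
      then have u': "u' = v'" "sz v' \<le> size_bound p 36 X"
        using sum_odd[of M2] by (simp_all add: acc M2_def len)
      have "sz (eval_op FTimes \<epsilon> v') \<le> size_bound p (Suc 36) X"
        using u'(2) X(3) X_le[of 36] by (intro size_bound_op adm) auto
      then have e: "sz (\<epsilon> * v') \<le> size_bound p 37 X" by simp
      have "sz (eval_op FPlus v (\<epsilon> * v')) \<le> size_bound p (Suc 37) X"
        using e u(2) size_bound_mono[of 36 37 p X] by (intro size_bound_op adm) auto
      then have s: "sz (v + \<epsilon> * v') \<le> size_bound p 38 X" by simp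
      have sizes: "sz v \<le> Z" "sz v' \<le> Z" "sz \<epsilon> \<le> Z" "sz (\<epsilon> * v') \<le> Z" "sz (v + \<epsilon> * v') \<le> Z"
        using u(2) u'(2) X(3) e s le_Z[of 0] le_Z[of 36] le_Z[of 37] le_Z[of 38] by auto
      have "progress (Suc (ival cell_e I)) (M(?S + 4 := v, ?S + 5 := \<epsilon> * v', ival cell_e I := v + \<epsilon> * v'))"
        using progress cell sizes(5) unfolding progress_def by (auto simp: less_Suc_eq)
      then show "wp sz Z (PSeq (POp FTimes acc'_e eps_e acc'_e) (POp FPlus cell_e acc_e acc'_e)) d I
          (progress (Suc (ival cell_e I))) (M2(ival acc'_e I := u'))"
        using sizes by (simp add: u' acc M2_def eps_M)
    qed (use X(1) le_Z[of 36] in \<open>auto simp: acc M2_def len\<close>)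
    then show "wp sz Z (PSeq (PConst acc'_e 0) (adds acc'_e odd_terms
        (PSeq (POp FTimes acc'_e eps_e acc'_e) (POp FPlus cell_e acc_e acc'_e)))) d I
        (progress (Suc (ival cell_e I))) (M1(ival acc_e I := u))"
      using X(1) le_Z[of 0] by (simp add: u(1) acc M1_def M2_def)
  qed (use X(1) le_Z[of 36] in \<open>auto simp: acc M1_def len\<close>)
  then show ?thesis using X(1) le_Z[of 0] by (simp add: entry_prog_def acc M1_def)
qed

end

context reduction_run
begin

text \<open>Each loop maintains \<open>progress\<close> at the number whose leading digits in base
  \<open>?N\<close> are the counters so far; a completed inner loop carries into the next
  digit.\<close>

lemma wp_loops:
  assumes I: "I 0 = length word" "I 1 = n" and start: "progress 0 M"
  shows "wp sz Z (PFor (IC 2) (PFor dim_e (PFor dim_e (PFor dim_e entry_prog)))) 2 I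
    (\<lambda>M. \<forall>j<out_size n. M j = out ! j \<and> sz (out ! j) \<le> Z) M"
proof -
  let ?N = "out_dim n"
  have entry: "wp sz Z entry_prog 10 J (progress (Suc (((J 2 * ?N + J 4) * ?N + J 6) * ?N + J 8))) M"
    if "J 0 = length word" "J 1 = n" "J 2 < 2" "J 4 < ?N" "J 6 < ?N" "J 8 < ?N"
      "progress (((J 2 * ?N + J 4) * ?N + J 6) * ?N + J 8) M" for J M
    using wp_entry_prog[OF that(1-6), unfolded ival_dims that(2)] that(7) by blast
  have l3: "wp sz Z (PFor dim_e entry_prog) 8 J (progress (Suc ((J 2 * ?N + J 4) * ?N + J 6) * ?N)) M"
    if J: "J 0 = length word" "J 1 = n" "J 2 < 2" "J 4 < ?N" "J 6 < ?N"
      "progress (((J 2 * ?N + J 4) * ?N + J 6) * ?N) M" for J M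
  proof (rule wp_For[where P = "\<lambda>i. progress (((J 2 * ?N + J 4) * ?N + J 6) * ?N + i)"])
    fix i M' assume "i < ival dim_e J" "progress (((J 2 * ?N + J 4) * ?N + J 6) * ?N + i) M'"
    then show "wp sz Z entry_prog (8 + 2) (J(8 := i, 8 + 1 := ival dim_e J))
        (progress (((J 2 * ?N + J 4) * ?N + J 6) * ?N + Suc i)) M'"
      using entry[of "J(8 := i, 8 + 1 := ival dim_e J)" M'] J unfolding ival_dims by (simp del: wp.simps(2))
  qed (use J in \<open>simp_all add: ival_dims add.commute\<close>)
  have l2: "wp sz Z (PFor dim_e (PFor dim_e entry_prog)) 6 J (progress (Suc (J 2 * ?N + J 4) * ?N * ?N)) M"
    if J: "J 0 = length word" "J 1 = n" "J 2 < 2" "J 4 < ?N" "progress ((J 2 * ?N + J 4) * ?N * ?N) M" for J M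
  proof (rule wp_For[where P = "\<lambda>i. progress (((J 2 * ?N + J 4) * ?N + i) * ?N)"])
    fix i M' assume "i < ival dim_e J" "progress (((J 2 * ?N + J 4) * ?N + i) * ?N) M'"
    then show "wp sz Z (PFor dim_e entry_prog) (6 + 2) (J(6 := i, 6 + 1 := ival dim_e J))
        (progress (((J 2 * ?N + J 4) * ?N + Suc i) * ?N)) M'"
      using l3[of "J(6 := i, 6 + 1 := ival dim_e J)" M'] J unfolding ival_dims by (simp del: wp.simps(2))
  qed (use J in \<open>simp_all add: ival_dims add.commute\<close>)
  have l1: "wp sz Z (PFor dim_e (PFor dim_e (PFor dim_e entry_prog))) 4 J (progress (Suc (J 2) * ?N * ?N * ?N)) M"
    if J: "J 0 = length word" "J 1 = n" "J 2 < 2" "progress (J 2 * ?N * ?N * ?N) M" for J M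
  proof (rule wp_For[where P = "\<lambda>i. progress ((J 2 * ?N + i) * ?N * ?N)"])
    fix i M' assume "i < ival dim_e J" "progress ((J 2 * ?N + i) * ?N * ?N) M'"
    then show "wp sz Z (PFor dim_e (PFor dim_e entry_prog)) (4 + 2) (J(4 := i, 4 + 1 := ival dim_e J))
        (progress ((J 2 * ?N + Suc i) * ?N * ?N)) M'"
      using l2[of "J(4 := i, 4 + 1 := ival dim_e J)" M'] J unfolding ival_dims by (simp del: wp.simps(2))
  qed (use J in \<open>simp_all add: ival_dims add.commute\<close>)
  show ?thesis
  proof (rule wp_For[where P = "\<lambda>i. progress (i * ?N * ?N * ?N)"])
    fix i M' assume "i < ival (IC 2) I" "progress (i * ?N * ?N * ?N) M'"
    then show "wp sz Z (PFor dim_e (PFor dim_e (PFor dim_e entry_prog))) (2 + 2) (I(2 := i, 2 + 1 := ival (IC 2) I))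
        (progress (Suc i * ?N * ?N * ?N)) M'"
      using l1[of "I(2 := i, 2 + 1 := ival (IC 2) I)" M'] I by (simp del: wp.simps(2))
  qed (use start in \<open>auto simp: progress_def out_size_def\<close>)
qed

text \<open>Ensures that copying the input behind the output does not overwrite input cells still to
  be read.\<close>

lemma word_le_out: "length word \<le> out_size n"
proof -
  have n: "n \<le> out_dim n" by (simp add: out_dim_def top_dim_def width_def)
  then have "n * n * n \<le> out_dim n * out_dim n * out_dim n" by (intro mult_le_mono)
  then show ?thesis by (simp add: length_word out_size_def mult.assoc)
qed

lemma wp_main_prog:
  assumes I: "I 0 = length word" "I 1 = n" and M: "\<And>j. j < length word \<Longrightarrow> M j = word ! j"
  shows "wp sz Z (main_prog \<epsilon>) 2 I (\<lambda>M. \<forall>j<out_size n. M j = out ! j \<and> sz (out ! j) \<le> Z) M"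
proof -
  have XZ: "X \<le> Z" using size_bound_mono[of 0 38 p X] Z by simp
  let ?rest = "PSeq (PConst one_e 1) (PSeq (PConst eps_e \<epsilon>)
       (PFor (IC 2) (PFor dim_e (PFor dim_e (PFor dim_e entry_prog)))))"
  define Q where "Q = wp sz Z ?rest 2 I (\<lambda>M. \<forall>j<out_size n. M j = out ! j \<and> sz (out ! j) \<le> Z)"
  have rest: "Q M'" if M': "\<forall>j<length word. M' (out_size n + j) = word ! j" for M'
  proof -
    let ?M = "M'(out_size n + length word := 1, out_size n + length word + 3 := \<epsilon>)"
    have "progress 0 ?M" using M' by (simp add: progress_def)
    then show ?thesis
      using wp_loops[OF I, of ?M] X XZ I by (simp add: Q_def ival_dims del: wp.simps(2))
  qed
  have "wp sz Z (PFor (IR 0) (PCopy (IPlus size_e (IR 2)) (IR 2))) 2 I Q M"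
  proof (rule wp_For[where P = "\<lambda>i M. (\<forall>j<length word. M j = word ! j) \<and> (\<forall>j<i. M (out_size n + j) = word ! j)"])
    fix i M' assume "i < ival (IR 0) I"
      and M': "(\<forall>j<length word. M' j = word ! j) \<and> (\<forall>j<i. M' (out_size n + j) = word ! j)"
    then have i: "i < length word" using I by simp
    then have "sz (M' i) \<le> Z" using M' size_word[of i] XZ by simp
    then show "wp sz Z (PCopy (IPlus size_e (IR 2)) (IR 2)) (2 + 2) (I(2 := i, 2 + 1 := ival (IR 0) I))
        (\<lambda>M. (\<forall>j<length word. M j = word ! j) \<and> (\<forall>j<Suc i. M (out_size n + j) = word ! j)) M'"
      using M' i I word_le_out by (auto simp: ival_dims less_Suc_eq)
  qed (use M rest I in auto)
  then show ?thesis unfolding main_prog_def wp.simps(1)[of sz Z _ ?rest] Q_def .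
qed

end

section \<open>Finding the dimension and assembling the machine program\<close>

definition cube_e :: iexp where "cube_e = ITimes (ITimes (ITimes (IC 2) (IR 1)) (IR 1)) (IR 1)"

text \<open>For lack of roots and division, register 1 is counted up until \<open>2 * n ^ 3\<close>
  reaches the input length, which on valid inputs has exactly this form.\<close>

definition find_com :: "'a com" where
  "find_com = Seq (icompile cube_e 2) (While (IndexLess 2 0)
     (Seq (IndexConst 3 1) (Seq (IndexAdd 1 1 3) (icompile cube_e 2))))"

text \<open>Puts the output length into register 0, where the output convention expects it; adding
  the zero of register 3 is a register move.\<close>

definition finish_com :: "'a com" where
  "finish_com = Seq (icompile size_e 2) (Seq (IndexConst 3 0) (IndexAdd 0 2 3))"

definition reduction_com :: "'a::field \<Rightarrow> 'a com" where
  "reduction_com \<epsilon> = Seq find_com (Seq (pcompile (main_prog \<epsilon>) 2) finish_com)"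

lemma ival_cube: "ival cube_e I = 2 * (I 1 * I 1 * I 1)"
  by (simp add: cube_e_def)

lemma iscoped_cube: "iscoped 2 cube_e"
  by (simp add: cube_e_def)

lemma cube_mono: "a < b \<Longrightarrow> a * a * a < b * b * (b::nat)"
  by (intro mult_strict_mono') auto

lemma le_cube: "n \<le> n * n * (n::nat)"
  by (cases n) auto

lemma runs_find_loop:
  fixes sz :: "'a::field \<Rightarrow> nat"
  assumes "k \<le> n" "I 0 = 2 * (n * n * n)" "I 1 = k" "I 2 = 2 * (k * k * k)" "I 0 \<le> B" "n \<le> B"
  shows "runs sz (While (IndexLess 2 0) (Seq (IndexConst 3 1) (Seq (IndexAdd 1 1 3) (icompile cube_e 2))))
    (I, M) ((n - k) * (itime cube_e B + 3) + 1) (\<lambda>(I', M'). M' = M \<and> I' 0 = 2 * (n * n * n) \<and> I' 1 = n)"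
  using assms
proof (induction k arbitrary: I rule: inc_induct)
  case base
  then show ?case
    by (intro runs_mono[OF runs_While_False[where Q = "\<lambda>s. s = (I, M)"]]) auto
next
  case (step k)
  let ?P = "\<lambda>(I', M'). M' = M \<and> I' 0 = 2 * (n * n * n) \<and> I' 1 = Suc k \<and> I' 2 = 2 * (Suc k * Suc k * Suc k)"
  define J where "J = I(3 := 1, 1 := Suc k)"
  have J: "J 0 = 2 * (n * n * n)" "J 1 = Suc k" using step.prems by (auto simp: J_def)
  have "runs sz (icompile cube_e 2) (J, M) (itime cube_e B)
      (\<lambda>(I', M'). M' = M \<and> I' 2 = ival cube_e J \<and> (\<forall>r<2. I' r = J r))"
    using step J by (intro runs_icompile[OF iscoped_cube]) (auto simp: less_2_cases_iff)
  then have ce: "runs sz (icompile cube_e 2) (J, M) (itime cube_e B) ?P"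
    by (rule runs_mono) (auto simp: ival_cube J[simplified])
  have body: "runs sz (Seq (IndexConst 3 1) (Seq (IndexAdd 1 1 3) (icompile cube_e 2))) (I, M) (itime cube_e B + 2) ?P"
  proof (rule runs_Seq[OF runs_IndexConst[where Q = "\<lambda>s. s = (I(3 := 1), M)" and j = 1], where kb = "itime cube_e B + 1"])
    fix s1 assume s1: "s1 = (I(3 := 1), M)"
    show "runs sz (Seq (IndexAdd 1 1 3) (icompile cube_e 2)) s1 (itime cube_e B + 1) ?P"
      unfolding s1
    proof (rule runs_Seq[OF runs_IndexAdd[where Q = "\<lambda>s. s = (J, M)" and j = 1], where kb = "itime cube_e B"])
      fix s2 assume "s2 = (J, M)"
      then show "runs sz (icompile cube_e 2) s2 (itime cube_e B) ?P" using ce by simp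
    qed (use step.prems in \<open>auto simp: J_def\<close>)
  qed auto
  show ?case
  proof (rule runs_While_True[OF _ body, where kb = "(n - Suc k) * (itime cube_e B + 3) + 1"])
    show "I 2 < I 0" using cube_mono[OF step.hyps(2)] step.prems by simp
    have "n - k = Suc (n - Suc k)" using step.hyps by simp
    then show "1 + (itime cube_e B + 2) + ((n - Suc k) * (itime cube_e B + 3) + 1) \<le> (n - k) * (itime cube_e B + 3) + 1"
      by simp
    fix s' :: "'a state" assume "?P s'"
    then obtain J where "s' = (J, M)" "J 0 = 2 * (n * n * n)" "J 1 = Suc k" "J 2 = 2 * (Suc k * Suc k * Suc k)"
      by (auto simp del: mult_Suc mult_Suc_right)
    then show "runs sz (While (IndexLess 2 0) (Seq (IndexConst 3 1) (Seq (IndexAdd 1 1 3) (icompile cube_e 2))))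
      s' ((n - Suc k) * (itime cube_e B + 3) + 1) (\<lambda>(I', M'). M' = M \<and> I' 0 = 2 * (n * n * n) \<and> I' 1 = n)"
      using step.IH[of J] step.prems by simp
  qed
qed

lemma runs_find_com:
  assumes "I 0 = 2 * (n * n * n)" "I 1 = 0" "I 0 \<le> B"
  shows "runs sz find_com (I, M) (itime cube_e B + B * (itime cube_e B + 3) + 1)
    (\<lambda>(I', M'). M' = M \<and> I' 0 = 2 * (n * n * n) \<and> I' 1 = n)"
proof -
  have nB: "n \<le> B"
    using le_cube[of n] assms by linarith
  have "runs sz (icompile cube_e 2) (I, M) (itime cube_e B)
      (\<lambda>(I', M'). M' = M \<and> I' 2 = ival cube_e I \<and> (\<forall>r<2. I' r = I r))"
    using assms by (intro runs_icompile[OF iscoped_cube]) (auto simp: less_2_cases_iff)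
  then show ?thesis
    unfolding find_com_def
  proof (rule runs_Seq[where kb = "(n - 0) * (itime cube_e B + 3) + 1"])
    fix s' assume "case s' of (I', M') \<Rightarrow> M' = M \<and> I' 2 = ival cube_e I \<and> (\<forall>r<2. I' r = I r)"
    then obtain J where s': "s' = (J, M)" and J: "J 2 = ival cube_e I" "\<forall>r<2. J r = I r" by auto
    have "J 0 = 2 * (n * n * n)" "J 1 = 0" "J 2 = 2 * (0 * 0 * 0)"
      using J assms by (auto simp: ival_cube)
    then show "runs sz (While (IndexLess 2 0) (Seq (IndexConst 3 1) (Seq (IndexAdd 1 1 3) (icompile cube_e 2))))
        s' ((n - 0) * (itime cube_e B + 3) + 1) (\<lambda>(I', M'). M' = M \<and> I' 0 = 2 * (n * n * n) \<and> I' 1 = n)"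
      unfolding s' using assms nB by (intro runs_find_loop) auto
  next
    have "(n - 0) * (itime cube_e B + 3) \<le> B * (itime cube_e B + 3)" using nB by (intro mult_le_mono1) simp
    then show "itime cube_e B + ((n - 0) * (itime cube_e B + 3) + 1) \<le> itime cube_e B + B * (itime cube_e B + 3) + 1"
      by linarith
  qed
qed

lemma runs_finish_com:
  assumes "I 1 = n" "I 0 \<le> B" "n \<le> B"
  shows "runs sz finish_com (I, M) (itime size_e B + 2) (\<lambda>(I', M'). M' = M \<and> I' 0 = out_size n)"
proof -
  have "runs sz (icompile size_e 2) (I, M) (itime size_e B)
      (\<lambda>(I', M'). M' = M \<and> I' 2 = ival size_e I \<and> (\<forall>r<2. I' r = I r))"
    using assms by (intro runs_icompile[of 2]) (auto simp: less_2_cases_iff)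
  then show ?thesis
    unfolding finish_com_def
  proof (rule runs_Seq[where kb = 2])
    fix s' assume "case s' of (I', M') \<Rightarrow> M' = M \<and> I' 2 = ival size_e I \<and> (\<forall>r<2. I' r = I r)"
    then obtain J where s': "s' = (J, M)" and J: "J 2 = out_size n" by (auto simp: ival_dims assms(1)[simplified])
    show "runs sz (Seq (IndexConst 3 0) (IndexAdd 0 2 3)) s' 2 (\<lambda>(I', M'). M' = M \<and> I' 0 = out_size n)"
      unfolding s'
      by (rule runs_Seq[OF runs_IndexConst[where Q = "\<lambda>s. s = (J(3 := 0), M)" and j = 1], where kb = 1])
        (auto intro!: runs_IndexAdd simp: J)
  qed simp
qed

definition time_bound :: "'a::field \<Rightarrow> nat \<Rightarrow> nat \<Rightarrow> nat" where
  "time_bound \<epsilon> B Z = (itime cube_e B + B * (itime cube_e B + 3) + 1) + ptime (main_prog \<epsilon>) B Z + (itime size_e B + 2)"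

lemma (in reduction_run) runs_reduction_com:
  assumes B: "length word \<le> B"
  shows "runs sz (reduction_com \<epsilon>) (input_state word) (time_bound \<epsilon> B Z) (\<lambda>s. output_word s = out \<and> (\<forall>x\<in>set out. sz x \<le> Z))"
proof -
  define I where "I = (\<lambda>_::nat. 0::nat)(0 := length word)"
  define M where "M = (\<lambda>i. if i < length word then word ! i else 0)"
  have nB: "n \<le> B"
    using le_cube[of n] B unfolding length_word by linarith
  have find: "runs sz find_com (I, M) (itime cube_e B + B * (itime cube_e B + 3) + 1)
      (\<lambda>(I', M'). M' = M \<and> I' 0 = 2 * (n * n * n) \<and> I' 1 = n)"
    using B by (intro runs_find_com) (auto simp: I_def length_word)
  have main: "runs sz (Seq (pcompile (main_prog \<epsilon>) 2) finish_com) (J, M)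
      (ptime (main_prog \<epsilon>) B Z + (itime size_e B + 2)) (\<lambda>s. output_word s = out \<and> (\<forall>x\<in>set out. sz x \<le> Z))"
    if J: "J 0 = length word" "J 1 = n" for J
  proof (rule runs_Seq[where kb = "itime size_e B + 2"])
    show "runs sz (pcompile (main_prog \<epsilon>) 2) (J, M) (ptime (main_prog \<epsilon>) B Z)
        (\<lambda>(I', M'). (\<forall>j<out_size n. M' j = out ! j \<and> sz (out ! j) \<le> Z) \<and> (\<forall>r<2. I' r = J r))"
    proof (rule runs_pcompile)
      show "wp sz Z (main_prog \<epsilon>) 2 J (\<lambda>M'. \<forall>j<out_size n. M' j = out ! j \<and> sz (out ! j) \<le> Z) M"
        by (rule wp_main_prog[OF J]) (simp add: M_def)
      show "J r \<le> B" if "r < 2" for r using that J B nB by (auto simp: less_2_cases_iff)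
    qed (rule pscoped_main_prog)
    fix s' assume "case s' of (I', M') \<Rightarrow> (\<forall>j<out_size n. M' j = out ! j \<and> sz (out ! j) \<le> Z) \<and> (\<forall>r<2. I' r = J r)"
    then obtain L M' where s': "s' = (L, M')" and L: "\<forall>j<out_size n. M' j = out ! j \<and> sz (out ! j) \<le> Z" "L 0 = length word" "L 1 = n"
      using J by auto
    have "runs sz finish_com (L, M') (itime size_e B + 2) (\<lambda>(I', M''). M'' = M' \<and> I' 0 = out_size n)"
      using L B nB by (intro runs_finish_com) auto
    then show "runs sz finish_com s' (itime size_e B + 2) (\<lambda>s. output_word s = out \<and> (\<forall>x\<in>set out. sz x \<le> Z))"
      unfolding s'
    proof (rule runs_mono)
      fix s :: "'a state" assume "case s of (I', M'') \<Rightarrow> M'' = M' \<and> I' 0 = out_size n"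
      then show "output_word s = out \<and> (\<forall>x\<in>set out. sz x \<le> Z)"
        using L(1) by (auto simp: output_word_def length_out in_set_conv_nth intro!: nth_equalityI)
    qed simp
  qed simp
  have "runs sz (reduction_com \<epsilon>) (I, M) (time_bound \<epsilon> B Z) (\<lambda>s. output_word s = out \<and> (\<forall>x\<in>set out. sz x \<le> Z))"
    unfolding reduction_com_def
  proof (rule runs_Seq[OF find, where kb = "ptime (main_prog \<epsilon>) B Z + (itime size_e B + 2)"])
    fix s' :: "'a state" assume "case s' of (I', M') \<Rightarrow> M' = M \<and> I' 0 = 2 * (n * n * n) \<and> I' 1 = n"
    then obtain J where "s' = (J, M)" "J 0 = length word" "J 1 = n" unfolding length_word by (cases s') auto
    then show "runs sz (Seq (pcompile (main_prog \<epsilon>) 2) finish_com) s'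
        (ptime (main_prog \<epsilon>) B Z + (itime size_e B + 2)) (\<lambda>s. output_word s = out \<and> (\<forall>x\<in>set out. sz x \<le> Z))"
      using main by simp
  qed (simp add: time_bound_def)
  then show ?thesis by (simp add: input_state_def I_def M_def)
qed

section \<open>The polynomial-time reduction\<close>

lemma word_size_le: "(\<And>x. x \<in> set w \<Longrightarrow> sz x \<le> X) \<Longrightarrow> word_size sz w \<le> length w * (1 + X)"
proof (induction w)
  case (Cons a w)
  have "sz a \<le> X" "word_size sz w \<le> length w * (1 + X)" using Cons by auto
  then show ?case by (simp add: word_size_def)
qed (simp add: word_size_def)

lemma length_le_word_size: "length w \<le> word_size sz w"
  by (induction w) (auto simp: word_size_def)

lemma size_le_word_size: "x \<in> set w \<Longrightarrow> sz x \<le> word_size sz w"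
  by (induction w) (auto simp: word_size_def)

lemma poly_bounded_time_bound:
  "poly_bounded \<zeta> \<Longrightarrow> poly_bounded (\<lambda>x. time_bound \<epsilon> x (\<zeta> x))"
  unfolding time_bound_def
  by (intro poly_bounded_add poly_bounded_mult poly_bounded_const poly_bounded_id poly_bounded_itime poly_bounded_ptime)

lemma poly_time_reducible_form_equivalence:
  fixes sz :: "'a::field \<Rightarrow> nat"
  assumes sz: "admissible_size sz" and eps: "\<epsilon> \<noteq> 0" and P': "\<And>N T. P' N (sym3 \<epsilon> T)"
  shows "poly_time_reducible sz (form_equivalence_problem P) (form_equivalence_problem P')"
proof -
  obtain p where p: "\<And>f x y. sz (eval_op f x y) \<le> poly p (sz x + sz y)"
    using sz unfolding admissible_size_def by blast
  \<comment> \<open>The starting sizes cover the input entries as well as the constants 0, 1 and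
    \<open>\<epsilon>\<close> that the program writes.\<close>
  define \<zeta> where "\<zeta> x = size_bound p 38 (x + (sz 0 + sz 1 + sz \<epsilon>))" for x
  have \<zeta>: "poly_bounded \<zeta>"
    unfolding \<zeta>_def by (intro poly_bounded_size_bound poly_bounded_add poly_bounded_id poly_bounded_const)
  \<comment> \<open>Running time plus output size: at most \<open>ival_bound size_e x\<close> cells,
    each charged at most \<open>1 + \<zeta> x\<close>.\<close>
  define \<beta> where "\<beta> x = time_bound \<epsilon> x (\<zeta> x) + ival_bound size_e x * (1 + \<zeta> x)" for x
  have "poly_bounded \<beta>"
    unfolding \<beta>_def
    by (intro poly_bounded_add poly_bounded_mult poly_bounded_const poly_bounded_time_bound \<zeta>
        poly_bounded_ival_bound poly_bounded_id)
  then obtain b where b: "\<And>x. \<beta> x \<le> poly b x" unfolding poly_bounded_def by blast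
  show ?thesis
    unfolding poly_time_reducible_def
  proof (rule exI[of _ "reduction_com \<epsilon>"], rule exI[of _ b], rule ballI)
    fix w :: "'a list" assume "w \<in> fst (form_equivalence_problem P)"
    then obtain n \<phi> \<psi> where w: "w = form_array n \<phi> @ form_array n \<psi>"
      and tri_in: "trilinear_form n \<phi>" "trilinear_form n \<psi>" and P: "P n \<phi>" "P n \<psi>"
      unfolding form_equivalence_problem_def fst_conv mem_Collect_eq by blast
    define x where "x = word_size sz w"
    interpret reduction_run sz p \<epsilon> n \<phi> \<psi> "x + (sz 0 + sz 1 + sz \<epsilon>)" "\<zeta> x"
    proof
      show "sz y \<le> x + (sz 0 + sz 1 + sz \<epsilon>)" if "y \<in> set (form_array n \<phi> @ form_array n \<psi>)" for y
        using size_le_word_size[of y w sz] that unfolding w x_def by simp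
    qed (use p tri_in eps in \<open>auto simp: \<zeta>_def\<close>)
    have ww: "word = w" by (simp add: word_def w)
    have lx: "length word \<le> x" unfolding ww x_def by (rule length_le_word_size)
    \<comment> \<open>The input has length \<open>2 * n ^ 3\<close>, so the dimension, and with it
      the output length, is bounded in terms of the input size \<open>x\<close>.\<close>
    then have nx: "n \<le> x" using le_cube[of n] unfolding length_word by linarith
    obtain t s where ts: "exec sz (reduction_com \<epsilon>) (input_state w) t s" "t \<le> time_bound \<epsilon> x (\<zeta> x)"
      "output_word s = out" "\<forall>y\<in>set out. sz y \<le> \<zeta> x"
      using runs_reduction_com[OF lx] unfolding runs_def ww by blast
    have "length out \<le> ival_bound size_e x"
      using ival_le_bound[of 2 size_e "(\<lambda>_. 0)(1 := n)" x] nx by (simp add: length_out ival_dims)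
    then have "word_size sz out \<le> ival_bound size_e x * (1 + \<zeta> x)"
      using word_size_le[of out sz "\<zeta> x"] ts(4) mult_le_mono1 le_trans by blast
    then have time: "t + word_size sz (output_word s) \<le> poly b (word_size sz w)"
      using ts(2) b[of x] unfolding ts(3) \<beta>_def x_def by linarith
    have tri: "trilinear_form (out_dim n) (out_form n \<epsilon> \<phi>)" "trilinear_form (out_dim n) (out_form n \<epsilon> \<psi>)"
      using trilinear_form_out_form[OF eps] tri_in by auto
    have P'_out: "P' (out_dim n) (out_form n \<epsilon> \<phi>)" "P' (out_dim n) (out_form n \<epsilon> \<psi>)"
      unfolding out_form_def by (rule P')+
    have "output_word s \<in> fst (form_equivalence_problem P')"
      unfolding ts(3) out_def form_equivalence_problem_def using tri P'_out by auto
    moreover have "w \<in> snd (form_equivalence_problem P) \<longleftrightarrow> output_word s \<in> snd (form_equivalence_problem P')"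
      unfolding ts(3) out_def w snd_form_equivalence_problem_iff[OF tri_in, of P, OF P]
        snd_form_equivalence_problem_iff[OF tri, of P', OF P'_out] equivalent_out_forms_iff[OF tri_in eps] ..
    ultimately show "\<exists>t s. exec sz (reduction_com \<epsilon>) (input_state w) t s \<and>
        t + word_size sz (output_word s) \<le> poly b (word_size sz w) \<and>
        output_word s \<in> fst (form_equivalence_problem P') \<and>
        (w \<in> snd (form_equivalence_problem P) \<longleftrightarrow> output_word s \<in> snd (form_equivalence_problem P'))"
      using ts(1) time by blast
  qed
qed

theorem theorem1p2:
  fixes sz :: "'a::field \<Rightarrow> nat"
  assumes "admissible_size sz"
  shows "poly_time_equivalent sz
    (alternating_form_equivalence :: 'a problem) (symmetric_form_equivalence :: 'a problem)"
  unfolding poly_time_equivalent_def alternating_form_equivalence_def symmetric_form_equivalence_def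
  \<comment> \<open>\<open>\<epsilon> = 1\<close> produces symmetric forms and
    \<open>\<epsilon> = -1\<close> alternating ones; both values are nonzero in every field.\<close>
  using poly_time_reducible_form_equivalence[OF assms, of 1 symmetric_form alternating_form]
    poly_time_reducible_form_equivalence[OF assms, of "-1" alternating_form symmetric_form]
  by (simp add: symmetric_form_sym3 alternating_form_sym3)

end
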